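(* Consider the system $$\dot I_1=\varepsilon^{q_1}[A_1(\xi,\varepsilon)I_1+\varepsilon^{q_2}g_1],\quad \dot I_2=\varepsilon^{q_3}[A_2(\xi,\varepsilon)I_2+\varepsilon^{q_4}g_2],\quad \dot\varphi_1=\varepsilon^{q_5}[\omega_1(\xi,\varepsilon)+\varepsilon^{q_6}g_3],\quad \dot\varphi_2=\omega_2(\xi,\varepsilon)+\varepsilon^{q_7}g_4,$$ $g_j=g_j(I,\varphi;\xi,\varepsilon)$, satisfying assumptions (H1), (H2), (H3) stated in the context, and let $\Pi_\gamma$ be the Cantor set described in the context. Assume moreover that $n_3+n_3^2+\cdots+n_3^\alpha\ge n_2$ and, with $\widetilde\omega,\widetilde\omega_0,\widetilde\Lambda_2$ as in the context: (i) for all $\xi\in\Pi$, $${\rm rank}\Big(\widetilde\omega,\frac{\partial^{|\beta|_1}\widetilde\omega}{\partial\xi^\beta}:1\le|\beta|_1\le\alpha\Big)=n_2\ \text{ in the case } n_{22}=0,\qquad {\rm rank}\Big(\frac{\partial^{|\beta|_1}\widetilde\omega}{\partial\xi^\beta}:1\le|\beta|_1\le\alpha\Big)=n_2\ \text{ in the case } n_{22}\ne0;$$ (ii) for all integer vectors $0\ne k\in\mathbb{Z}^{n_2}$ and $m=(m_1,\dots,m_{n_{12}})\in\mathbb{Z}^{n_{12}}$ with $1\le|m|_1\le2$ and $m_1+\cdots+m_{n_{12}}=0$ or $-1$, $${\rm meas}\big\{\xi\in\Pi:\ \sqrt{-1}\langle k,\widetilde\omega_0+\varepsilon^{q_5}\widetilde\omega(\xi)\rangle+\varepsilon^{q_3}\langle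 m,\widetilde\Lambda_2(\xi)\rangle=0\big\}=0.$$ Then the Cantor set $\Pi_\gamma$ is of positive Lebesgue measure and ${\rm meas}(\Pi\setminus\Pi_\gamma)\to0$ as $\gamma\to0$.
   Context: Setting. $I={\rm col}(I_1,I_2)\in\Omega=\Omega_1\times\Omega_2\subset\mathbb{R}^{n_{11}}\times\mathbb{R}^{n_{12}}=\mathbb{R}^{n_1}$ with $\Omega_1,\Omega_2$ convex open neighbourhoods of the origin; $\varphi={\rm col}(\varphi_1,\varphi_2)\in\mathbb{T}^{n_{21}}\times\mathbb{T}^{n_{22}}=\mathbb{T}^{n_2}$; $\xi\in\Pi\subset\mathbb{R}^{n_3}$, $\Pi$ a convex bounded open set of positive Lebesgue measure; $\varepsilon>0$ a small parameter. $|x|$ is the maximum norm, $|x|_p$ the $p$-norm, $[x]$ the integer part; a diagonal matrix is also regarded as the column vector of its diagonal entries. For functions of $\xi$, $\|f\|_{\alpha;\Pi}$ is the supremum over $\Pi$ of all $|\partial_\xi^\beta f|$, $|\beta|_1\le\alpha$ (on closed sets, functions are assumed differentiable in a neighbourhood). $C^{l,\alpha}(\Omega\times\mathbb{T}^{n_2},\Pi)$ is the class of $f$ such that for some $M$ and all $|\beta|_1\le\alpha$: $|D^k\partial_\xi^\beta f|\le M$ for $|k|_1\le[l]$, and $D^k\partial^\beta_\xi f$ with $|k|_1=[l]$ is Hölder continuous in $x=(I,\varphi)$ with exponent $l-[l]$ and constant $M$, uniformly in $\xi$ ($D^k$ = derivatives in $x$); the norm is the smallest $M$. (H1) $q_1,\dots,q_7\ge0$,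 $q_1>q_3\ge q_5$, $q_7\ge q_2+q_5$, $0<q_2\le\min\{q_4,q_6\}$. (H2) $\omega_i,A_i\in C^\alpha(\Pi)$ with a positive integer $\alpha$, $A_i=B_i\Lambda_iB_i^{-1}$ with $\Lambda_i$ diagonal ($i=1,2$); $\omega={\rm col}(\varepsilon^{q_5}\omega_1,\omega_2)$, $\Lambda_1={\rm diag}(\lambda_1,\dots,\lambda_{n_{11}})$, $\Lambda_2={\rm diag}(\lambda_{n_{11}+1},\dots,\lambda_{n_1})$. There are positive $c_0,c_1,\varepsilon_*$ such that for $\varepsilon\in(0,\varepsilon_*]$: $\inf_\Pi|\lambda_j|\ge c_0$, $\inf_\Pi|\lambda_j-\lambda_i|\ge c_0$ for $i\ne j$ with $1\le i,j\le n_{11}$ or $n_{11}+1\le i,j\le n_1$; $\|B_i\|_{\alpha;\Pi},\|B_i^{-1}\|_{\alpha;\Pi},\|\Lambda_i\|_{\alpha;\Pi}\le c_1$, $\sup_\Pi|\omega_i|\le c_1$; $\sup_\Pi|\partial_\xi^\beta\omega|\le c_1\varepsilon^{q_5}$ for $1\le|\beta|_1\le\alpha$. (H3) $g_j\in C^{l,\alpha}(\Omega\times\mathbb{T}^{n_2},\Pi)$, $j=1,\dots,4$, with norms bounded uniformly in $\varepsilon$, $l>2(\alpha+1)(\iota+2)+\alpha\iota$, $\iota>\alpha n_2-1$. The limiting data. By (H2) one writes $\omega_2(\xi,\varepsilon)=\omega_{20}+\varepsilon^{q_5}\omega_{21}(\xi)+o(\varepsilon^{q_5})$ with $\omega_{20}$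 independent of $\xi$ and the $o(\varepsilon^{q_5})$ holding for derivatives in $\xi$ up to order $\alpha$. Put $\widetilde\Lambda_2(\xi)=\Lambda_2(\xi,0)$; $\widetilde\omega(\xi)={\rm col}(\omega_1(\xi,0),\omega_{21}(\xi))$ if $n_{22}\ne0$ and $\widetilde\omega(\xi)=\omega_1(\xi,0)$ if $n_{22}=0$; $\widetilde\omega_0={\rm col}(0,\omega_{20})$. The Cantor set $\Pi_\gamma$. Under (H1)-(H3), for every $0<\gamma\ll1$ there is a sufficiently small $\varepsilon_0^*=o(\gamma^{(\alpha+1)/q_2})$ such that for $0<\varepsilon\le\varepsilon_0^*$ there exist closed sets $\Pi_\nu\subset\Pi$, vectors $\omega^\nu={\rm col}(\varepsilon^{q_5}\omega_1^\nu,\omega_2^\nu)$ and diagonal matrices $\Lambda^\nu={\rm diag}(\varepsilon^{q_1}\Lambda_1^\nu,\varepsilon^{q_3}\Lambda_2^\nu)$ depending on $\xi$, $\nu\ge1$, with $\|\omega_1^\nu-\omega_1\|_{\alpha;\Pi_\nu}\le c\varepsilon^{q_6}$, $\|\omega_2^\nu-\omega_2\|_{\alpha;\Pi_\nu}\le c\varepsilon^{q_7}$, $\|\Lambda_1^\nu-\Lambda_1\|_{\alpha;\Pi_\nu}\le c\varepsilon^{q_2}$, $\|\Lambda_2^\nu-\Lambda_2\|_{\alpha;\Pi_\nu}\le c\varepsilon^{q_4}$ ($c$ independent of $\nu,\varepsilon,\gamma$), and $\Pi_\nu=\Pi_{\nu-1}\setminus\bigcup_{k,m}\mathfrak{R}^\nu_{km}(\gamma)$,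 the union being over $m\in\mathfrak{m}=\{m\in\mathbb{Z}^{n_1}:|m|_1\le2,\sum_jm_j=0\text{ or }-1\}$ and $k\in\mathbb{Z}^{n_2}$ with $K_{\nu-1}<|k|_2\le K_\nu$, where $\mathfrak{R}^\nu_{km}(\gamma)=\{\xi\in\Pi_{\nu-1}:|\sqrt{-1}\langle k,\omega^{\nu-1}\rangle+\langle m,\Lambda^{\nu-1}\rangle|<\gamma\varepsilon^{q_5}|k|_2^{-\iota}\}$, $\omega^0=\omega$, $\Lambda^0={\rm diag}(\varepsilon^{q_1}\Lambda_1,\varepsilon^{q_3}\Lambda_2)$, $K_0=0$, $K_\nu=[K'_\nu]+1$, $K'_\nu=r^{-1}3^{\nu+1}[(l+(n_2+1)(\nu+1)-\alpha)\ln3+(n_2+1)|\ln r|+\ln\widetilde C]$, $\widetilde C=24(n_2!)n_2^{n_2}e^{-n_2}$, $r$ the radius of $\Omega$, and $\Pi_0$ is a closed subset of $\Pi$ whose distance to $\partial\Pi$ is at least $\gamma$ (with ${\rm meas}(\Pi\setminus\Pi_0)=O(\gamma)$). Then $\Pi_\gamma=\bigcap_{\nu\ge0}\Pi_\nu$, and for each $\xi\in\Pi_\gamma$ the system has a quasi-periodic invariant torus $I=\Phi(\varphi;\xi)$, $\varphi\in\mathbb{T}^{n_2}$.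
   Formalization: The norms on the closed sets Π_ν are taken in Whitney's sense (extension to Π with the same bound), as bounds only on Π_ν do not imply the claim; ω_1 (with ξ-derivatives up to order α, uniformly in Π) and Λ_2 (pointwise) are assumed continuous at ε=0. *)

theory Defs
  imports "HOL-Analysis.Analysis" "HOL-Library.Landau_Symbols"
begin

text \<open>
  Conventions. Since the dimensions of the blocks in \<open>I = col(I\<^sub>1, I\<^sub>2)\<close> and
  \<open>\<phi> = col(\<phi>\<^sub>1, \<phi>\<^sub>2)\<close> may be zero, a block is a set of coordinates, not a type:
  \<open>J :: 'n1 set\<close> collects the coordinates of \<open>I\<^sub>1\<close> (those of \<open>I\<^sub>2\<close> are \<open>- J\<close>), and
  \<open>N :: 'n2 set\<close> those of \<open>\<phi>\<^sub>1\<close> (those of \<open>\<phi>\<^sub>2\<close> are \<open>- N\<close>). So \<open>n\<^sub>1\<^sub>1 = card J\<close>,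
  \<open>n\<^sub>1\<^sub>2 = card (- J)\<close>, \<open>n\<^sub>2\<^sub>1 = card N\<close>, \<open>n\<^sub>2\<^sub>2 = card (- N)\<close>. Quantities carrying an
  index 1 or 2 (\<open>\<omega>\<^sub>i\<close>, \<open>\<Lambda>\<^sub>i\<close>, \<open>A\<^sub>i\<close>, \<open>B\<^sub>i\<close>; \<open>g\<^sub>1, g\<^sub>2\<close> as \<open>gI\<close>; \<open>g\<^sub>3, g\<^sub>4\<close> as \<open>gphi\<close>) are stored
  as one vector or block diagonal matrix. The exponents \<open>q\<^sub>1, \<dots>, q\<^sub>7\<close> are \<open>q 1, \<dots>, q 7\<close>.
  Functions on the torus are functions of \<open>\<phi> :: real ^ 'n2\<close> that are
  \<open>2\<pi>\<close>-periodic in every coordinate. Eigenvalues are complex; bounds in the maximum norm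
  are written componentwise.
\<close>

definition coord_subspace :: "'n set \<Rightarrow> (real ^ 'n) set" where
  "coord_subspace J = {x. \<forall>i. i \<notin> J \<longrightarrow> x $ i = 0}"

definition diag :: "complex ^ 'n \<Rightarrow> complex ^ 'n ^ 'n" where
  "diag v = (\<chi> i j. if i = j then v $ i else 0)"

subsection \<open>Partial derivatives and smoothness classes\<close>

definition partial_exists :: "'a \<Rightarrow> ('a::real_normed_vector \<Rightarrow> 'b::real_normed_vector) \<Rightarrow> 'a \<Rightarrow> bool" where
  "partial_exists v f x \<longleftrightarrow> (\<lambda>t::real. f (x + t *\<^sub>R v)) differentiable (at 0)"

definition partial :: "'a \<Rightarrow> ('a::real_normed_vector \<Rightarrow> 'b::real_normed_vector) \<Rightarrow> 'a \<Rightarrow> 'b" where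
  "partial v f x = vector_derivative (\<lambda>t::real. f (x + t *\<^sub>R v)) (at 0)"

text \<open>
  A multi-index \<open>\<beta>\<close> is represented by the lists of unit coordinate vectors in which the
  \<open>i\<close>-th one occurs \<open>\<beta>\<^sub>i\<close> times; the length of such a list is \<open>|\<beta>|\<^sub>1\<close>.
  Quantifying over lists is quantifying over multi-indices and orders of differentiation.
\<close>

definition iter_partial :: "'a list \<Rightarrow> ('a::real_normed_vector \<Rightarrow> 'b::real_normed_vector) \<Rightarrow> 'a \<Rightarrow> 'b" where
  "iter_partial vs f = foldr partial vs f"

definition multi :: "nat \<Rightarrow> 'a::euclidean_space list set" where
  "multi a = {vs. set vs \<subseteq> Basis \<and> length vs \<le> a}"

definition Ck_on :: "nat \<Rightarrow> ('a::euclidean_space \<Rightarrow> 'b::real_normed_vector) \<Rightarrow> 'a set \<Rightarrow> bool" where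
  "Ck_on a f S \<longleftrightarrow>
     (\<forall>vs\<in>multi a. continuous_on S (iter_partial vs f)) \<and>
     (\<forall>vs\<in>multi a. length vs < a \<longrightarrow>
        (\<forall>v\<in>Basis. \<forall>x\<in>S. partial_exists v (iter_partial vs f) x))"

text \<open>The estimate \<open>\<parallel>f\<parallel>\<^bsub>\<alpha>;S\<^esub> \<le> M\<close> on an open set \<open>S\<close>.\<close>

definition Ck_bound :: "nat \<Rightarrow> 'a::euclidean_space set \<Rightarrow> ('a \<Rightarrow> 'b::real_normed_vector) \<Rightarrow> real \<Rightarrow> bool" where
  "Ck_bound a S f M \<longleftrightarrow>
     Ck_on a f S \<and> (\<forall>vs\<in>multi a. \<forall>x\<in>S. norm (iter_partial vs f x) \<le> M)"

text \<open>
  The estimate \<open>\<parallel>f\<parallel>\<^bsub>\<alpha>;F\<^esub> \<le> M\<close> on a closed subset \<open>F\<close> of the open convex set \<open>S\<close>, in the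
  sense of Whitney: \<open>f\<close> is the restriction to \<open>F\<close> of a function on \<open>S\<close> obeying the estimate.
  Bounding derivatives of \<open>f\<close> merely at the points of \<open>F\<close> would put no relation between the
  values of \<open>f\<close> on different components of \<open>F\<close>.
\<close>

definition Ck_bound_closed ::
  "nat \<Rightarrow> 'a::euclidean_space set \<Rightarrow> 'a set \<Rightarrow> ('a \<Rightarrow> 'b::real_normed_vector) \<Rightarrow> real \<Rightarrow> bool" where
  "Ck_bound_closed a S F f M \<longleftrightarrow> (\<exists>h. Ck_bound a S h M \<and> (\<forall>x\<in>F. h x = f x))"

text \<open>\<open>f\<close> belongs to \<open>C\<^bsup>l,\<alpha>\<^esup>(\<Omega> \<times> \<T>, \<Pi>)\<close> with norm at most \<open>M\<close>; \<open>ks\<close> lists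
  differentiations in \<open>x = (I, \<phi>)\<close>, \<open>bs\<close> those in \<open>\<xi>\<close>.\<close>

definition Cla_bound ::
  "real \<Rightarrow> nat \<Rightarrow> (real ^ 'n1) set \<Rightarrow> (real ^ 'n3) set \<Rightarrow>
   (real ^ 'n1 \<Rightarrow> real ^ 'n2 \<Rightarrow> real ^ 'n3 \<Rightarrow> real) \<Rightarrow> real \<Rightarrow> bool" where
  "Cla_bound l a Om Par f M \<longleftrightarrow>
    (let n = nat \<lfloor>l\<rfloor>;
         F = (\<lambda>((I, \<phi>), \<xi>). f I \<phi> \<xi>);
         D = (Om \<times> (UNIV :: (real ^ 'n2) set)) \<times> Par;
         X = (\<lambda>v. (v, 0)) ` (Basis :: ((real ^ 'n1) \<times> (real ^ 'n2)) set);
         Y = (\<lambda>w. (0, w)) ` (Basis :: (real ^ 'n3) set)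
     in (\<forall>I\<in>Om. \<forall>\<phi>. \<forall>\<xi>\<in>Par. \<forall>j. f I (\<phi> + axis j (2 * pi)) \<xi> = f I \<phi> \<xi>) \<and>
        (\<forall>bs. set bs \<subseteq> Y \<and> length bs < a \<longrightarrow>
           (\<forall>w\<in>Y. \<forall>p\<in>D. partial_exists w (iter_partial bs F) p)) \<and>
        (\<forall>ks bs. set ks \<subseteq> X \<and> length ks < n \<and> set bs \<subseteq> Y \<and> length bs \<le> a \<longrightarrow>
           (\<forall>v\<in>X. \<forall>p\<in>D. partial_exists v (iter_partial (ks @ bs) F) p)) \<and>
        (\<forall>ks bs. set ks \<subseteq> X \<and> length ks \<le> n \<and> set bs \<subseteq> Y \<and> length bs \<le> a \<longrightarrow>
           (\<forall>p\<in>D. \<bar>iter_partial (ks @ bs) F p\<bar> \<le> M)) \<and>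
        (\<forall>ks bs. set ks \<subseteq> X \<and> length ks = n \<and> set bs \<subseteq> Y \<and> length bs \<le> a \<longrightarrow>
           (\<forall>\<xi>\<in>Par. \<forall>x\<in>Om \<times> UNIV. \<forall>y\<in>Om \<times> UNIV.
              \<bar>iter_partial (ks @ bs) F (x, \<xi>) - iter_partial (ks @ bs) F (y, \<xi>)\<bar>
                \<le> M * infnorm (x - y) powr (l - real_of_int \<lfloor>l\<rfloor>))))"

subsection \<open>The system\<close>

definition scale_freq :: "(nat \<Rightarrow> real) \<Rightarrow> 'n2 set \<Rightarrow> real \<Rightarrow> real ^ 'n2 \<Rightarrow> real ^ 'n2" where
  "scale_freq q N e w = (\<chi> j. if j \<in> N then e powr q 5 * w $ j else w $ j)"

definition scale_eig :: "(nat \<Rightarrow> real) \<Rightarrow> 'n1 set \<Rightarrow> real \<Rightarrow> complex ^ 'n1 \<Rightarrow> complex ^ 'n1" where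
  "scale_eig q J e v =
     (\<chi> i. complex_of_real (if i \<in> J then e powr q 1 else e powr q 3) * v $ i)"

definition rhs_I ::
  "(nat \<Rightarrow> real) \<Rightarrow> 'n1::finite set \<Rightarrow> real \<Rightarrow> real ^ 'n1 ^ 'n1 \<Rightarrow> real ^ 'n1 \<Rightarrow> real ^ 'n1 \<Rightarrow> real ^ 'n1" where
  "rhs_I q J e A g I =
     (\<chi> i. if i \<in> J then e powr q 1 * ((A *v I) $ i + e powr q 2 * g $ i)
                    else e powr q 3 * ((A *v I) $ i + e powr q 4 * g $ i))"

definition rhs_phi ::
  "(nat \<Rightarrow> real) \<Rightarrow> 'n2 set \<Rightarrow> real \<Rightarrow> real ^ 'n2 \<Rightarrow> real ^ 'n2 \<Rightarrow> real ^ 'n2" where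
  "rhs_phi q N e w g =
     (\<chi> j. if j \<in> N then e powr q 5 * (w $ j + e powr q 6 * g $ j)
                    else w $ j + e powr q 7 * g $ j)"

text \<open>
  The graph \<open>I = Phi(\<phi>)\<close> is an invariant torus of \<open>I' = fI(I,\<phi>)\<close>, \<open>\<phi>' = fphi(I,\<phi>)\<close> on
  which the flow is conjugated by \<open>\<phi> = \<theta> + u(\<theta>)\<close> to \<open>\<theta>' = w\<close>, with rationally
  independent frequencies \<open>w\<close>.
\<close>

definition quasi_periodic_torus ::
  "(real ^ 'n1) set \<Rightarrow> (real ^ 'n1 \<Rightarrow> real ^ 'n2 \<Rightarrow> real ^ 'n1) \<Rightarrow>
   (real ^ 'n1 \<Rightarrow> real ^ 'n2 \<Rightarrow> real ^ 'n2) \<Rightarrow> (real ^ 'n2 \<Rightarrow> real ^ 'n1) \<Rightarrow> bool" where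
  "quasi_periodic_torus Om fI fphi Phi \<longleftrightarrow>
     continuous_on UNIV Phi \<and> range Phi \<subseteq> Om \<and>
     (\<forall>\<phi> j. Phi (\<phi> + axis j (2 * pi)) = Phi \<phi>) \<and>
     (\<exists>u w. continuous_on UNIV u \<and> (\<forall>\<theta> j. u (\<theta> + axis j (2 * pi)) = u \<theta>) \<and>
        bij (\<lambda>\<theta>. \<theta> + u \<theta>) \<and>
        (\<forall>k :: int ^ 'n2. k \<noteq> 0 \<longrightarrow> (\<Sum>j\<in>UNIV. of_int (k $ j) * w $ j) \<noteq> 0) \<and>
        (\<forall>\<theta> t. let \<phi> = (\<lambda>s. (\<theta> + s *\<^sub>R w) + u (\<theta> + s *\<^sub>R w)) in
           (\<phi> has_vector_derivative fphi (Phi (\<phi> t)) (\<phi> t)) (at t) \<and>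
           ((\<lambda>s. Phi (\<phi> s)) has_vector_derivative fI (Phi (\<phi> t)) (\<phi> t)) (at t)))"

subsection \<open>Standing hypotheses\<close>

definition H1 :: "(nat \<Rightarrow> real) \<Rightarrow> bool" where
  "H1 q \<longleftrightarrow> (\<forall>i\<in>{1..7}. 0 \<le> q i) \<and> q 1 > q 3 \<and> q 3 \<ge> q 5 \<and> q 7 \<ge> q 2 + q 5 \<and>
            0 < q 2 \<and> q 2 \<le> min (q 4) (q 6)"

definition H2 ::
  "(nat \<Rightarrow> real) \<Rightarrow> nat \<Rightarrow> 'n1::finite set \<Rightarrow> 'n2 set \<Rightarrow> (real ^ 'n3) set \<Rightarrow> real \<Rightarrow> real \<Rightarrow> real \<Rightarrow>
   (real ^ 'n3 \<Rightarrow> real \<Rightarrow> real ^ 'n1 ^ 'n1) \<Rightarrow> (real ^ 'n3 \<Rightarrow> real \<Rightarrow> complex ^ 'n1 ^ 'n1) \<Rightarrow>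
   (real ^ 'n3 \<Rightarrow> real \<Rightarrow> complex ^ 'n1) \<Rightarrow> (real ^ 'n3 \<Rightarrow> real \<Rightarrow> real ^ 'n2) \<Rightarrow> bool" where
  "H2 q a J N Par estar c0 c1 A B lam om \<longleftrightarrow>
     0 < a \<and> 0 < estar \<and> 0 < c0 \<and> 0 < c1 \<and>
     (\<forall>e\<in>{0<..estar}.
        (\<forall>i j. Ck_on a (\<lambda>\<xi>. A \<xi> e $ i $ j) Par) \<and>
        (\<forall>j. Ck_on a (\<lambda>\<xi>. om \<xi> e $ j) Par) \<and>
        (\<forall>\<xi>\<in>Par.
           invertible (B \<xi> e) \<and>
           (\<forall>i j. (i \<in> J) \<noteq> (j \<in> J) \<longrightarrow> B \<xi> e $ i $ j = 0) \<and>
           (\<chi> i j. complex_of_real (A \<xi> e $ i $ j))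
             = B \<xi> e ** diag (lam \<xi> e) ** matrix_inv (B \<xi> e) \<and>
           (\<forall>j. c0 \<le> cmod (lam \<xi> e $ j)) \<and>
           (\<forall>i j. i \<noteq> j \<and> (i \<in> J) = (j \<in> J) \<longrightarrow> c0 \<le> cmod (lam \<xi> e $ j - lam \<xi> e $ i)) \<and>
           (\<forall>j. \<bar>om \<xi> e $ j\<bar> \<le> c1)) \<and>
        (\<forall>i j. Ck_bound a Par (\<lambda>\<xi>. B \<xi> e $ i $ j) c1) \<and>
        (\<forall>i j. Ck_bound a Par (\<lambda>\<xi>. matrix_inv (B \<xi> e) $ i $ j) c1) \<and>
        (\<forall>i. Ck_bound a Par (\<lambda>\<xi>. lam \<xi> e $ i) c1) \<and>
        (\<forall>j. \<forall>vs\<in>multi a. 1 \<le> length vs \<longrightarrow>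
           (\<forall>\<xi>\<in>Par. \<bar>iter_partial vs (\<lambda>\<xi>. scale_freq q N e (om \<xi> e) $ j) \<xi>\<bar> \<le> c1 * e powr q 5)))"

definition H3 ::
  "nat \<Rightarrow> real \<Rightarrow> real \<Rightarrow> (real ^ 'n1) set \<Rightarrow> (real ^ 'n3) set \<Rightarrow> real \<Rightarrow>
   (real ^ 'n1 \<Rightarrow> real ^ 'n2 \<Rightarrow> real ^ 'n3 \<Rightarrow> real \<Rightarrow> real ^ 'n1) \<Rightarrow>
   (real ^ 'n1 \<Rightarrow> real ^ 'n2 \<Rightarrow> real ^ 'n3 \<Rightarrow> real \<Rightarrow> real ^ 'n2) \<Rightarrow> bool" where
  "H3 a l iota Om Par estar gI gphi \<longleftrightarrow>
     l > 2 * (real a + 1) * (iota + 2) + real a * iota \<and>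
     iota > real a * real CARD('n2) - 1 \<and>
     (\<exists>M. \<forall>e\<in>{0<..estar}.
        (\<forall>i. Cla_bound l a Om Par (\<lambda>I \<phi> \<xi>. gI I \<phi> \<xi> e $ i) M) \<and>
        (\<forall>j. Cla_bound l a Om Par (\<lambda>I \<phi> \<xi>. gphi I \<phi> \<xi> e $ j) M))"

subsection \<open>Limiting data\<close>

text \<open>
  The expansion of \<open>\<omega>\<^sub>2\<close>, and the continuity at \<open>\<epsilon> = 0\<close> that gives a meaning to
  \<open>\<omega>\<^sub>1(\<xi>, 0)\<close> (with derivatives in \<open>\<xi>\<close>) and \<open>\<Lambda>\<^sub>2(\<xi>, 0)\<close>. The entries of \<open>om20\<close>,
  \<open>om21\<close> with index in \<open>N\<close> are irrelevant.
\<close>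

definition limiting_data ::
  "(nat \<Rightarrow> real) \<Rightarrow> nat \<Rightarrow> 'n1 set \<Rightarrow> 'n2 set \<Rightarrow> (real ^ 'n3) set \<Rightarrow>
   (real ^ 'n3 \<Rightarrow> real \<Rightarrow> complex ^ 'n1) \<Rightarrow> (real ^ 'n3 \<Rightarrow> real \<Rightarrow> real ^ 'n2) \<Rightarrow>
   real ^ 'n2 \<Rightarrow> (real ^ 'n3 \<Rightarrow> real ^ 'n2) \<Rightarrow> bool" where
  "limiting_data q a J N Par lam om om20 om21 \<longleftrightarrow>
     (\<forall>j\<in>- N. Ck_on a (\<lambda>\<xi>. om21 \<xi> $ j) Par \<and>
        (\<forall>\<delta>>0. \<forall>\<^sub>F e in at_right 0.
           Ck_bound a Par (\<lambda>\<xi>. om \<xi> e $ j - om20 $ j - e powr q 5 * om21 \<xi> $ j) (\<delta> * e powr q 5))) \<and>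
     (\<forall>j\<in>N. Ck_on a (\<lambda>\<xi>. om \<xi> 0 $ j) Par \<and>
        (\<forall>\<delta>>0. \<forall>\<^sub>F e in at_right 0. Ck_bound a Par (\<lambda>\<xi>. om \<xi> e $ j - om \<xi> 0 $ j) \<delta>)) \<and>
     (\<forall>i\<in>- J. \<forall>\<xi>\<in>Par. ((\<lambda>e. lam \<xi> e $ i) \<longlongrightarrow> lam \<xi> 0 $ i) (at_right 0))"

definition om_tilde ::
  "'n2 set \<Rightarrow> (real ^ 'n3 \<Rightarrow> real \<Rightarrow> real ^ 'n2) \<Rightarrow> (real ^ 'n3 \<Rightarrow> real ^ 'n2) \<Rightarrow> real ^ 'n3 \<Rightarrow> real ^ 'n2" where
  "om_tilde N om om21 \<xi> = (\<chi> j. if j \<in> N then om \<xi> 0 $ j else om21 \<xi> $ j)"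

definition om_tilde0 :: "'n2 set \<Rightarrow> real ^ 'n2 \<Rightarrow> real ^ 'n2" where
  "om_tilde0 N om20 = (\<chi> j. if j \<in> N then 0 else om20 $ j)"

subsection \<open>The Cantor set\<close>

definition pairing :: "int ^ 'n2 \<Rightarrow> int ^ 'n1 \<Rightarrow> real ^ 'n2 \<Rightarrow> complex ^ 'n1 \<Rightarrow> complex" where
  "pairing k m w v =
     \<i> * complex_of_real (\<Sum>j\<in>UNIV. of_int (k $ j) * w $ j) + (\<Sum>i\<in>UNIV. of_int (m $ i) * v $ i)"

definition norm1 :: "int ^ 'n \<Rightarrow> int" where
  "norm1 m = (\<Sum>i\<in>UNIV. \<bar>m $ i\<bar>)"

definition norm2 :: "int ^ 'n \<Rightarrow> real" where
  "norm2 k = sqrt (\<Sum>j\<in>UNIV. (of_int (k $ j))\<^sup>2)"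

definition admissible_m :: "(int ^ 'n1) set" where
  "admissible_m = {m. norm1 m \<le> 2 \<and> ((\<Sum>i\<in>UNIV. m $ i) = 0 \<or> (\<Sum>i\<in>UNIV. m $ i) = - 1)}"

text \<open>\<open>K\<^sub>\<nu>\<close> for \<open>n\<^sub>2 = n\<close>.\<close>

definition Kcut :: "nat \<Rightarrow> nat \<Rightarrow> real \<Rightarrow> real \<Rightarrow> nat \<Rightarrow> real" where
  "Kcut n a l r \<nu> =
     (if \<nu> = 0 then 0
      else real_of_int \<lfloor>(1 / r) * 3 ^ (\<nu> + 1) *
             ((l + (real n + 1) * (real \<nu> + 1) - real a) * ln 3 + (real n + 1) * \<bar>ln r\<bar>
              + ln (24 * fact n * real n ^ n * exp (- real n)))\<rfloor> + 1)"

definition resonance_zone ::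
  "(nat \<Rightarrow> real) \<Rightarrow> 'n1 set \<Rightarrow> 'n2 set \<Rightarrow> real \<Rightarrow> real \<Rightarrow> real \<Rightarrow> (real ^ 'n3) set \<Rightarrow>
   (real ^ 'n3 \<Rightarrow> real ^ 'n2) \<Rightarrow> (real ^ 'n3 \<Rightarrow> complex ^ 'n1) \<Rightarrow>
   int ^ 'n2 \<Rightarrow> int ^ 'n1 \<Rightarrow> (real ^ 'n3) set" where
  "resonance_zone q J N iota \<gamma> e S w v k m =
     {\<xi>\<in>S. cmod (pairing k m (scale_freq q N e (w \<xi>)) (scale_eig q J e (v \<xi>)))
            < \<gamma> * e powr q 5 * norm2 k powr (- iota)}"

text \<open>
  The sequences \<open>\<Pi>\<^sub>\<nu> = PI \<nu>\<close>, \<open>col(\<omega>\<^sub>1\<^sup>\<nu>, \<omega>\<^sub>2\<^sup>\<nu>) = OM \<nu>\<close> and \<open>(\<Lambda>\<^sub>1\<^sup>\<nu>, \<Lambda>\<^sub>2\<^sup>\<nu>) = LAM \<nu>\<close> (both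
  without the scaling by powers of \<open>\<epsilon>\<close>) for fixed \<open>\<gamma>\<close> and \<open>\<epsilon>\<close>; the arguments \<open>A\<close>, \<open>lam\<close>,
  \<open>om\<close>, \<open>gI\<close>, \<open>gphi\<close> are taken at this \<open>\<epsilon>\<close>.
\<close>

definition cantor_data ::
  "(nat \<Rightarrow> real) \<Rightarrow> nat \<Rightarrow> real \<Rightarrow> real \<Rightarrow> real \<Rightarrow> 'n1::finite set \<Rightarrow> 'n2::finite set \<Rightarrow>
   (real ^ 'n1) set \<Rightarrow> (real ^ 'n3) set \<Rightarrow>
   (real ^ 'n3 \<Rightarrow> real ^ 'n1 ^ 'n1) \<Rightarrow> (real ^ 'n3 \<Rightarrow> complex ^ 'n1) \<Rightarrow> (real ^ 'n3 \<Rightarrow> real ^ 'n2) \<Rightarrow>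
   (real ^ 'n1 \<Rightarrow> real ^ 'n2 \<Rightarrow> real ^ 'n3 \<Rightarrow> real ^ 'n1) \<Rightarrow>
   (real ^ 'n1 \<Rightarrow> real ^ 'n2 \<Rightarrow> real ^ 'n3 \<Rightarrow> real ^ 'n2) \<Rightarrow>
   real \<Rightarrow> real \<Rightarrow> real \<Rightarrow>
   (nat \<Rightarrow> (real ^ 'n3) set) \<Rightarrow> (nat \<Rightarrow> real ^ 'n3 \<Rightarrow> real ^ 'n2) \<Rightarrow>
   (nat \<Rightarrow> real ^ 'n3 \<Rightarrow> complex ^ 'n1) \<Rightarrow> bool" where
  "cantor_data q a l iota r J N Om Par A lam om gI gphi c \<gamma> e PI OM LAM \<longleftrightarrow>
     (\<forall>\<nu>. closed (PI \<nu>) \<and> PI \<nu> \<subseteq> Par) \<and>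
     (\<forall>\<xi>\<in>PI 0. \<forall>\<eta>\<in>frontier Par. \<gamma> \<le> infnorm (\<xi> - \<eta>)) \<and>
     measure lebesgue (Par - PI 0) \<le> c * \<gamma> \<and>
     OM 0 = om \<and> LAM 0 = lam \<and>
     (\<forall>\<nu>\<ge>1.
        (\<forall>j\<in>N. Ck_bound_closed a Par (PI \<nu>) (\<lambda>\<xi>. OM \<nu> \<xi> $ j - om \<xi> $ j) (c * e powr q 6)) \<and>
        (\<forall>j\<in>- N. Ck_bound_closed a Par (PI \<nu>) (\<lambda>\<xi>. OM \<nu> \<xi> $ j - om \<xi> $ j) (c * e powr q 7)) \<and>
        (\<forall>i\<in>J. Ck_bound_closed a Par (PI \<nu>) (\<lambda>\<xi>. LAM \<nu> \<xi> $ i - lam \<xi> $ i) (c * e powr q 2)) \<and>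
        (\<forall>i\<in>- J. Ck_bound_closed a Par (PI \<nu>) (\<lambda>\<xi>. LAM \<nu> \<xi> $ i - lam \<xi> $ i) (c * e powr q 4))) \<and>
     (\<forall>\<nu>. PI (Suc \<nu>) = PI \<nu> -
        (\<Union>m\<in>admissible_m. \<Union>k\<in>{k. Kcut CARD('n2) a l r \<nu> < norm2 k \<and> norm2 k \<le> Kcut CARD('n2) a l r (Suc \<nu>)}.
           resonance_zone q J N iota \<gamma> e (PI \<nu>) (OM \<nu>) (LAM \<nu>) k m)) \<and>
     (\<forall>\<xi>\<in>(\<Inter>\<nu>. PI \<nu>). \<exists>Phi. quasi_periodic_torus Om
        (\<lambda>I \<phi>. rhs_I q J e (A \<xi>) (gI I \<phi> \<xi>) I) (\<lambda>I \<phi>. rhs_phi q N e (om \<xi>) (gphi I \<phi> \<xi>)) Phi)"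

text \<open>
  The data above for all \<open>0 < \<gamma> < \<gamma>\<^sub>0\<close> and \<open>0 < \<epsilon> \<le> \<epsilon>\<^sub>0\<^sup>*(\<gamma>)\<close>, with \<open>\<epsilon>\<^sub>0\<^sup>*(\<gamma>) = e0 \<gamma>\<close>. The constant
  \<open>c\<close> does not depend on \<open>\<nu>\<close>, \<open>\<epsilon>\<close>, \<open>\<gamma>\<close>.
\<close>

definition cantor_family ::
  "(nat \<Rightarrow> real) \<Rightarrow> nat \<Rightarrow> real \<Rightarrow> real \<Rightarrow> real \<Rightarrow> 'n1::finite set \<Rightarrow> 'n2::finite set \<Rightarrow>
   (real ^ 'n1) set \<Rightarrow> (real ^ 'n3) set \<Rightarrow> real \<Rightarrow>
   (real ^ 'n3 \<Rightarrow> real \<Rightarrow> real ^ 'n1 ^ 'n1) \<Rightarrow> (real ^ 'n3 \<Rightarrow> real \<Rightarrow> complex ^ 'n1) \<Rightarrow>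
   (real ^ 'n3 \<Rightarrow> real \<Rightarrow> real ^ 'n2) \<Rightarrow>
   (real ^ 'n1 \<Rightarrow> real ^ 'n2 \<Rightarrow> real ^ 'n3 \<Rightarrow> real \<Rightarrow> real ^ 'n1) \<Rightarrow>
   (real ^ 'n1 \<Rightarrow> real ^ 'n2 \<Rightarrow> real ^ 'n3 \<Rightarrow> real \<Rightarrow> real ^ 'n2) \<Rightarrow>
   real \<Rightarrow> (real \<Rightarrow> real) \<Rightarrow>
   (real \<Rightarrow> real \<Rightarrow> nat \<Rightarrow> (real ^ 'n3) set) \<Rightarrow> (real \<Rightarrow> real \<Rightarrow> nat \<Rightarrow> real ^ 'n3 \<Rightarrow> real ^ 'n2) \<Rightarrow>
   (real \<Rightarrow> real \<Rightarrow> nat \<Rightarrow> real ^ 'n3 \<Rightarrow> complex ^ 'n1) \<Rightarrow> bool" where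
  "cantor_family q a l iota r J N Om Par estar A lam om gI gphi \<gamma>0 e0 PI OM LAM \<longleftrightarrow>
     0 < \<gamma>0 \<and>
     (\<forall>\<gamma>\<in>{0<..<\<gamma>0}. 0 < e0 \<gamma> \<and> e0 \<gamma> \<le> estar) \<and>
     e0 \<in> o[at_right 0](\<lambda>\<gamma>. \<gamma> powr ((real a + 1) / q 2)) \<and>
     (\<exists>c. \<forall>\<gamma>\<in>{0<..<\<gamma>0}. \<forall>e\<in>{0<..e0 \<gamma>}.
        cantor_data q a l iota r J N Om Par (\<lambda>\<xi>. A \<xi> e) (\<lambda>\<xi>. lam \<xi> e) (\<lambda>\<xi>. om \<xi> e)
          (\<lambda>I \<phi> \<xi>. gI I \<phi> \<xi> e) (\<lambda>I \<phi> \<xi>. gphi I \<phi> \<xi> e)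
          c \<gamma> e (PI \<gamma> e) (OM \<gamma> e) (LAM \<gamma> e))"

definition cantor_set :: "(real \<Rightarrow> real \<Rightarrow> nat \<Rightarrow> (real ^ 'n3) set) \<Rightarrow> real \<Rightarrow> real \<Rightarrow> (real ^ 'n3) set" where
  "cantor_set PI \<gamma> e = (\<Inter>\<nu>. PI \<gamma> e \<nu>)"

end

theory Submission
  imports Defs
begin

text \<open>
  Fix a compact \<open>C \<subseteq> \<Pi>\<close> exhausting \<open>\<Pi>\<close> up to small measure. Divided by \<open>\<epsilon>\<^bsup>q\<^sub>5\<^esup> |k|\<^sub>2\<close>, the
  imaginary part of a small divisor is \<open>C\<^bsup>\<alpha>\<^esup>\<close>-close, up to an additive constant, to
  \<open>\<langle>k/|k|\<^sub>2, om_tilde\<rangle>\<close>, provided that \<open>|k|\<^sub>2\<close> is large or that the eigenvalue part is negligible.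
  By the rank condition and compactness, some directional derivative of order at most \<open>\<alpha>\<close>
  of the latter is bounded away from zero near every point of \<open>C\<close>, uniformly in \<open>k\<close>.
  Hence the resonance zone of \<open>k\<close> has measure \<open>O((\<gamma> |k|\<^sub>2\<^bsup>-\<iota>-1\<^esup>)\<^bsup>1/\<alpha>\<^esup>)\<close> in \<open>C\<close>, which is summable
  over \<open>k\<close> because \<open>\<iota> > \<alpha> n\<^sub>2 - 1\<close>. The finitely many remaining pairs \<open>(k, m)\<close> occur only for
  \<open>q\<^sub>3 = q\<^sub>5\<close>. For these the divisor either is large for small \<open>\<epsilon>\<close> or converges uniformly on
  \<open>C\<close> to a limit whose zero set is null by hypothesis (ii).
\<close>

subsection \<open>Calculus of iterated partial derivatives\<close>

text \<open>Away from the exceptional pairs only the imaginary part of a divisor is estimated: it is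
  real valued and dominated by the modulus. The obstacle is its additive constant. For
  \<open>N \<noteq> UNIV\<close> the contribution of \<open>om20\<close>, divided by \<epsilon>^q5,
  may be unbounded as \<epsilon> tends to 0, so only derivatives of positive order can be used; the
  rank condition of that case accordingly omits order zero. A flag \<open>P\<close> carries this
  alternative through the general lemmas. The rank conditions concern mixed partial derivatives,
  whereas sublevel estimates along a line need a pure power of one directional derivative; finite
  differences connect the two. The vectors of step \<nu> are controlled only on \<Pi>_\<nu>, in
  Whitney's sense. Every estimate is therefore proved uniformly over all functions \<open>w\<close>,
  \<open>v\<close> on \<Pi> with the prescribed bounds, and one threshold in \<epsilon> serves all
  steps.\<close>

lemma has_vector_derivative_shift:
  fixes f :: "real \<Rightarrow> 'b::real_normed_vector"
  assumes "((\<lambda>s. f (t + s)) has_vector_derivative D) (at 0)"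
  shows "(f has_vector_derivative D) (at t)"
proof -
  have "((\<lambda>s. f (t + s)) \<circ> (\<lambda>s. s - t) has_vector_derivative 1 *\<^sub>R D) (at t)"
    by (rule vector_diff_chain_at) (use assms in \<open>auto intro!: derivative_eq_intros\<close>)
  then show ?thesis
    by (simp add: o_def)
qed

lemma has_partial_at_0:
  assumes "partial_exists v f x"
  shows "((\<lambda>t. f (x + t *\<^sub>R v)) has_vector_derivative partial v f x) (at 0)"
  using assms unfolding partial_exists_def partial_def vector_derivative_works .

lemma partialI:
  assumes "((\<lambda>t. f (x + t *\<^sub>R v)) has_vector_derivative D) (at 0)"
  shows "partial_exists v f x" "partial v f x = D"
  unfolding partial_exists_def partial_def
  using differentiableI_vector[OF assms] vector_derivative_at[OF assms] by auto

lemma has_partial: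
  assumes "partial_exists v f (x + t *\<^sub>R v)"
  shows "((\<lambda>t. f (x + t *\<^sub>R v)) has_vector_derivative partial v f (x + t *\<^sub>R v)) (at t)"
  using has_vector_derivative_shift[of "\<lambda>t. f (x + t *\<^sub>R v)" t] has_partial_at_0[OF assms]
  by (simp add: algebra_simps)

lemma partial_cong:
  assumes "open S" "x \<in> S" "\<And>y. y \<in> S \<Longrightarrow> f y = g y"
  shows "partial v f x = partial v g x" "partial_exists v f x \<longleftrightarrow> partial_exists v g x"
proof -
  have "continuous (at 0) (\<lambda>t::real. x + t *\<^sub>R v)"
    by (intro continuous_intros)
  then have "\<forall>\<^sub>F t in at 0. x + t *\<^sub>R v \<in> S"
    using assms(1,2) by (auto simp: continuous_within intro: topological_tendstoD)
  then have ev: "\<forall>\<^sub>F t::real in nhds 0. f (x + t *\<^sub>R v) = g (x + t *\<^sub>R v)"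
    using assms(2,3) by (auto simp: eventually_at_filter elim!: eventually_mono)
  have hvd: "((\<lambda>t. f (x + t *\<^sub>R v)) has_vector_derivative D) (at 0) \<longleftrightarrow>
      ((\<lambda>t. g (x + t *\<^sub>R v)) has_vector_derivative D) (at 0)" for D
    using ev assms(2,3) by (intro has_vector_derivative_cong_ev) auto
  then show "partial v f x = partial v g x"
    by (simp add: partial_def vector_derivative_def)
  show "partial_exists v f x \<longleftrightarrow> partial_exists v g x"
    using hvd partialI has_partial_at_0 by blast
qed

lemma iter_partial_simps [simp]:
  "iter_partial [] f = f"
  "iter_partial (v # vs) f = partial v (iter_partial vs f)"
  "iter_partial (vs @ [v]) f = iter_partial vs (partial v f)"
  by (simp_all add: iter_partial_def)

lemma multi_Cons: "v # vs \<in> multi a \<longleftrightarrow> v \<in> Basis \<and> vs \<in> multi a \<and> length vs < a"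
  by (auto simp: multi_def)

lemma Nil_in_multi [simp]: "[] \<in> multi a"
  by (simp add: multi_def)

lemma Ck_onD:
  assumes "Ck_on a f S" "vs \<in> multi a"
  shows "continuous_on S (iter_partial vs f)"
    and "length vs < a \<Longrightarrow> v \<in> Basis \<Longrightarrow> x \<in> S \<Longrightarrow> partial_exists v (iter_partial vs f) x"
  using assms by (auto simp: Ck_on_def)

lemma Ck_on_continuous: "Ck_on a f S \<Longrightarrow> continuous_on S f"
  using Ck_onD(1)[of a f S "[]"] by simp

lemma Ck_on_partial_exists: "Ck_on (Suc a) f S \<Longrightarrow> b \<in> Basis \<Longrightarrow> x \<in> S \<Longrightarrow> partial_exists b f x"
  using Ck_onD(2)[of "Suc a" f S "[]"] by simp

text \<open>\<open>iter_partial\<close> applies the last entry of a list first, so the derivatives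
  of \<open>partial b f\<close> are the derivatives of \<open>f\<close> along lists ending in
  \<open>b\<close>.\<close>

lemma Ck_on_partial:
  assumes "Ck_on (Suc a) f S" "b \<in> Basis"
  shows "Ck_on a (partial b f) S"
proof -
  have "vs @ [b] \<in> multi (Suc a)" if "vs \<in> multi a" for vs
    using that assms(2) by (auto simp: multi_def)
  then show ?thesis
    using Ck_onD[OF assms(1), of "_ @ [b]"] unfolding Ck_on_def by auto
qed

lemma Ck_bound_partial:
  assumes "Ck_bound (Suc a) S f M" "b \<in> Basis"
  shows "Ck_bound a S (partial b f) M"
proof -
  have "norm (iter_partial vs (partial b f) x) \<le> M" if "vs \<in> multi a" "x \<in> S" for vs x
  proof -
    have "vs @ [b] \<in> multi (Suc a)"
      using that assms(2) by (auto simp: multi_def)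
    then show ?thesis
      using assms(1) that(2) unfolding Ck_bound_def by fastforce
  qed
  then show ?thesis
    using assms Ck_on_partial unfolding Ck_bound_def by blast
qed

lemma Ck_on_mono: "Ck_on a f S \<Longrightarrow> b \<le> a \<Longrightarrow> Ck_on b f S"
  unfolding Ck_on_def multi_def by auto

lemma Ck_bound_mono: "Ck_bound a S f M \<Longrightarrow> M \<le> M' \<Longrightarrow> Ck_bound a S f M'"
  unfolding Ck_bound_def by force

lemma Ck_boundD: "Ck_bound a S f M \<Longrightarrow> x \<in> S \<Longrightarrow> norm (f x) \<le> M"
  using Nil_in_multi[of a] iter_partial_simps(1)[of f] unfolding Ck_bound_def by metis

lemma iter_partial_cong:
  assumes "open S" "\<And>y. y \<in> S \<Longrightarrow> f y = g y" "x \<in> S"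
  shows "iter_partial vs f x = iter_partial vs g x"
  using assms(3)
proof (induction vs arbitrary: x)
  case (Cons v vs)
  then show ?case
    using partial_cong(1)[OF assms(1), of x "iter_partial vs f" "iter_partial vs g"] by simp
qed (use assms in auto)

lemma Ck_on_cong:
  assumes "open S" "\<And>y. y \<in> S \<Longrightarrow> f y = g y" "Ck_on a f S"
  shows "Ck_on a g S"
proof -
  have eq: "iter_partial vs f y = iter_partial vs g y" if "y \<in> S" for vs y
    using assms that by (intro iter_partial_cong)
  have "continuous_on S (iter_partial vs g)" if "vs \<in> multi a" for vs
    using Ck_onD(1)[OF assms(3) that] by (subst (asm) continuous_on_cong[OF refl eq])
  moreover have "partial_exists v (iter_partial vs g) x"
    if "vs \<in> multi a" "length vs < a" "v \<in> Basis" "x \<in> S" for vs v x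
    using Ck_onD(2)[OF assms(3) that] partial_cong(2)[OF assms(1) that(4), of "iter_partial vs f"] eq
    by blast
  ultimately show ?thesis
    by (auto simp: Ck_on_def)
qed

lemma Ck_bound_cong:
  assumes "open S" "\<And>y. y \<in> S \<Longrightarrow> f y = g y" "Ck_bound a S f M"
  shows "Ck_bound a S g M"
  using assms(3) Ck_on_cong[of S f g a] iter_partial_cong[of S f g] assms(1,2)
  by (auto simp: Ck_bound_def)

section \<open>Linear combinations of C^a functions\<close>

text \<open>Bounded linear maps \<open>L i\<close> as coefficients make sums, scalar multiples,
  vector coefficients and imaginary parts instances of one statement, here and in the lemmas built
  on it.\<close>

lemma partial_linear_combination:
  assumes "finite I" "\<And>i. i \<in> I \<Longrightarrow> bounded_linear (L i)"
    and "\<And>i. i \<in> I \<Longrightarrow> partial_exists v (f i) x"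
  shows "partial_exists v (\<lambda>x. \<Sum>i\<in>I. L i (f i x)) x"
    and "partial v (\<lambda>x. \<Sum>i\<in>I. L i (f i x)) x = (\<Sum>i\<in>I. L i (partial v (f i) x))"
proof -
  have "((\<lambda>t. \<Sum>i\<in>I. L i (f i (x + t *\<^sub>R v))) has_vector_derivative
      (\<Sum>i\<in>I. L i (partial v (f i) x))) (at 0)"
    by (intro has_vector_derivative_sum bounded_linear.has_vector_derivative[OF assms(2)]
        has_partial_at_0 assms)
  from partialI[OF this]
  show "partial_exists v (\<lambda>x. \<Sum>i\<in>I. L i (f i x)) x"
    and "partial v (\<lambda>x. \<Sum>i\<in>I. L i (f i x)) x = (\<Sum>i\<in>I. L i (partial v (f i) x))"
    by auto
qed

lemma iter_partial_linear_combination: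
  assumes "open S" "finite I" "\<And>i. i \<in> I \<Longrightarrow> bounded_linear (L i)"
    and "\<And>i. i \<in> I \<Longrightarrow> Ck_on a (f i) S"
    and "vs \<in> multi a" "x \<in> S"
  shows "iter_partial vs (\<lambda>x. \<Sum>i\<in>I. L i (f i x)) x = (\<Sum>i\<in>I. L i (iter_partial vs (f i) x))"
  using assms(5,6)
proof (induction vs arbitrary: x)
  case (Cons v vs)
  have "partial v (iter_partial vs (\<lambda>x. \<Sum>i\<in>I. L i (f i x))) x =
      partial v (\<lambda>x. \<Sum>i\<in>I. L i (iter_partial vs (f i) x)) x"
    using Cons by (intro partial_cong(1)[OF assms(1)]) (auto simp: multi_Cons)
  also have "\<dots> = (\<Sum>i\<in>I. L i (partial v (iter_partial vs (f i)) x))"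
    using Cons.prems by (intro partial_linear_combination assms Ck_onD(2)[OF assms(4)])
      (auto simp: multi_Cons)
  finally show ?case
    by simp
qed simp

lemma Ck_on_linear_combination:
  assumes "open S" "finite I" "\<And>i. i \<in> I \<Longrightarrow> bounded_linear (L i)"
    and "\<And>i. i \<in> I \<Longrightarrow> Ck_on a (f i) S"
  shows "Ck_on a (\<lambda>x. \<Sum>i\<in>I. L i (f i x)) S"
proof -
  have eq: "iter_partial vs (\<lambda>x. \<Sum>i\<in>I. L i (f i x)) x = (\<Sum>i\<in>I. L i (iter_partial vs (f i) x))"
    if "vs \<in> multi a" "x \<in> S" for vs x
    using assms that by (intro iter_partial_linear_combination)
  have "continuous_on S (iter_partial vs (\<lambda>x. \<Sum>i\<in>I. L i (f i x)))" if vs: "vs \<in> multi a" for vs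
  proof -
    have "continuous_on S (\<lambda>x. \<Sum>i\<in>I. L i (iter_partial vs (f i) x))"
      by (rule continuous_on_sum, rule bounded_linear.continuous_on[OF assms(3)])
        (auto intro: Ck_onD(1)[OF assms(4) vs])
    then show ?thesis
      by (subst continuous_on_cong[OF refl eq[OF vs]]) auto
  qed
  moreover have "partial_exists v (iter_partial vs (\<lambda>x. \<Sum>i\<in>I. L i (f i x))) x"
    if "vs \<in> multi a" "length vs < a" "v \<in> Basis" "x \<in> S" for vs v x
    by (subst partial_cong(2)[OF assms(1) that(4) eq[OF that(1)]])
      (use assms Ck_onD(2)[OF assms(4) that] in \<open>auto intro: partial_linear_combination(1)\<close>)
  ultimately show ?thesis
    by (auto simp: Ck_on_def)
qed

lemma Ck_bound_linear_combination:
  assumes "open S" "finite I" "\<And>i. i \<in> I \<Longrightarrow> bounded_linear (L i)"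
    and "\<And>i. i \<in> I \<Longrightarrow> Ck_bound a S (f i) (M i)"
    and "\<And>i z. i \<in> I \<Longrightarrow> norm (L i z) \<le> C i * norm z" "\<And>i. i \<in> I \<Longrightarrow> 0 \<le> C i"
  shows "Ck_bound a S (\<lambda>x. \<Sum>i\<in>I. L i (f i x)) (\<Sum>i\<in>I. C i * M i)"
proof -
  have Ck: "Ck_on a (f i) S" if "i \<in> I" for i
    using assms(4)[OF that] by (simp add: Ck_bound_def)
  have "norm (\<Sum>i\<in>I. L i (iter_partial vs (f i) x)) \<le> (\<Sum>i\<in>I. C i * M i)"
    if "vs \<in> multi a" "x \<in> S" for vs x
  proof (rule sum_norm_le)
    fix i assume i: "i \<in> I"
    have "norm (L i (iter_partial vs (f i) x)) \<le> C i * norm (iter_partial vs (f i) x)"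
      by (rule assms(5)[OF i])
    also have "\<dots> \<le> C i * M i"
      using assms(4,6) i that by (intro mult_left_mono) (auto simp: Ck_bound_def)
    finally show "norm (L i (iter_partial vs (f i) x)) \<le> C i * M i" .
  qed
  moreover have "iter_partial vs (\<lambda>x. \<Sum>i\<in>I. L i (f i x)) x = (\<Sum>i\<in>I. L i (iter_partial vs (f i) x))"
    if "vs \<in> multi a" "x \<in> S" for vs x
    using assms Ck that by (intro iter_partial_linear_combination)
  moreover have "Ck_on a (\<lambda>x. \<Sum>i\<in>I. L i (f i x)) S"
    using assms Ck by (intro Ck_on_linear_combination)
  ultimately show ?thesis
    by (simp add: Ck_bound_def)
qed

lemma Ck_bound_linear:
  assumes "open S" "bounded_linear L" "Ck_bound a S f M" "\<And>z. norm (L z) \<le> C * norm z" "0 \<le> C"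
  shows "Ck_bound a S (\<lambda>x. L (f x)) (C * M)"
  using Ck_bound_linear_combination[of S "{()}" "\<lambda>_. L" a "\<lambda>_. f" "\<lambda>_. M" "\<lambda>_. C"] assms by simp

lemma Ck_bound_add:
  assumes "open S" "Ck_bound a S f M" "Ck_bound a S g M'"
  shows "Ck_bound a S (\<lambda>x. f x + g x) (M + M')"
proof -
  have "Ck_bound a S (\<lambda>x. \<Sum>i\<in>{True,False}. id (if i then f x else g x))
      (\<Sum>i\<in>{True,False}. 1 * (if i then M else M'))"
    using Ck_bound_linear_combination[of S "{True,False}" "\<lambda>_. id" a "\<lambda>i. if i then f else g"
        "\<lambda>i. if i then M else M'" "\<lambda>_. 1"] assms
    by (simp add: bounded_linear_ident[unfolded id_def[symmetric]] if_distrib cong: if_cong)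
  then show ?thesis
    by simp
qed

lemma Ck_bound_scale:
  fixes f :: "'a::euclidean_space \<Rightarrow> real"
  assumes "open S" "Ck_bound a S f M"
  shows "Ck_bound a S (\<lambda>x. c * f x) (\<bar>c\<bar> * M)"
  by (rule Ck_bound_linear) (use assms in \<open>auto simp: bounded_linear_mult_right abs_mult\<close>)

lemma Ck_bound_sum:
  assumes "open S" "finite I" "\<And>i. i \<in> I \<Longrightarrow> Ck_bound a S (f i) (M i)"
  shows "Ck_bound a S (\<lambda>x. \<Sum>i\<in>I. f i x) (\<Sum>i\<in>I. M i)"
  using Ck_bound_linear_combination[of S I "\<lambda>_ x. x" a f M "\<lambda>_. 1"] assms
  by (simp add: bounded_linear_ident)

lemma partial_const [simp]: "partial v (\<lambda>_. c) = (\<lambda>_. 0)"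
  by (rule ext, rule partialI(2)) simp

lemma partial_exists_const [simp]: "partial_exists v (\<lambda>_. c) x"
  by (simp add: partial_exists_def)

lemma iter_partial_const: "iter_partial vs (\<lambda>_. c) = (\<lambda>_. if vs = [] then c else 0)"
proof (induction vs)
  case (Cons v vs)
  then show ?case
    by (cases vs) auto
qed simp

lemma Ck_on_const: "Ck_on a (\<lambda>_. c) S"
  by (auto simp: Ck_on_def iter_partial_const)

lemma Ck_bound_zero: "0 \<le> M \<Longrightarrow> Ck_bound a S (\<lambda>_. 0) M"
  by (auto simp: Ck_bound_def Ck_on_const iter_partial_const)

section \<open>Total differentiability and powers of directional derivatives\<close>

text \<open>One coordinate is changed at a time, and the mean value inequality bounds each increment
  by the oscillation of one partial derivative. Total differentiability is what gives derivatives
  along lines in arbitrary directions.\<close>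

lemma has_derivative_of_partials:
  fixes f :: "'a::euclidean_space \<Rightarrow> 'b::real_normed_vector"
  assumes "open S" "Ck_on (Suc 0) f S" "x \<in> S"
  shows "(f has_derivative (\<lambda>h. \<Sum>b\<in>Basis. (h \<bullet> b) *\<^sub>R partial b f x)) (at x)"
proof -
  have cont: "continuous_on S (partial b f)" if "b \<in> Basis" for b
    using Ck_on_continuous Ck_on_partial[OF assms(2) that] by blast
  \<comment> \<open>The error is measured by the sum of the absolute coordinates because this bound
    is additive when one coordinate joins \<open>B\<close>.\<close>
  have claim: "\<exists>\<delta>>0. \<forall>c. (\<forall>b\<in>B. \<bar>c b\<bar> < \<delta>) \<longrightarrow>
      norm (f (x + (\<Sum>b\<in>B. c b *\<^sub>R b)) - f x - (\<Sum>b\<in>B. c b *\<^sub>R partial b f x)) \<le> e * (\<Sum>b\<in>B. \<bar>c b\<bar>)"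
    if "finite B" "B \<subseteq> Basis" "e > 0" for B e
    using that
  proof (induction B)
    case empty
    then show ?case
      by (auto intro!: exI[of _ 1])
  next
    case (insert b B)
    then obtain \<delta>1 where \<delta>1: "\<delta>1 > 0" and IH: "\<And>c. (\<And>b. b \<in> B \<Longrightarrow> \<bar>c b\<bar> < \<delta>1) \<Longrightarrow>
      norm (f (x + (\<Sum>b\<in>B. c b *\<^sub>R b)) - f x - (\<Sum>b\<in>B. c b *\<^sub>R partial b f x)) \<le> e * (\<Sum>b\<in>B. \<bar>c b\<bar>)"
      by auto
    have b: "b \<in> Basis"
      using insert by auto
    obtain R where R: "R > 0" "ball x R \<subseteq> S"
      using assms by (meson openE)
    have "\<forall>\<^sub>F y in at x within S. dist (partial b f y) (partial b f x) < e"
      using cont[OF b] assms(3) \<open>e > 0\<close> by (auto simp: continuous_on_def intro: tendstoD)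
    then obtain R' where R': "R' > 0"
      "\<And>y. y \<in> S \<Longrightarrow> dist y x < R' \<Longrightarrow> dist (partial b f y) (partial b f x) \<le> e"
      using \<open>e > 0\<close> unfolding eventually_at
      by (metis dist_eq_0_iff less_eq_real_def)
    define \<rho> where "\<rho> = min R R'"
    have \<rho>: "\<rho> > 0" "\<And>y. dist y x < \<rho> \<Longrightarrow> y \<in> S \<and> norm (partial b f y - partial b f x) \<le> e"
      using R R' by (auto simp: \<rho>_def dist_norm[symmetric] dist_commute subset_iff)
    define n where "n = real (card (insert b B))"
    have n: "n > 0"
      using insert by (simp add: n_def)
    \<comment> \<open>At most \<open>n\<close> coordinates move by less than \<open>\<delta>\<close>
      each, so the path stays within \<open>\<rho>\<close> of \<open>x\<close>.\<close>
    define \<delta> where "\<delta> = min \<delta>1 (\<rho> / n)"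
    have \<delta>: "\<delta> > 0" "\<delta> \<le> \<delta>1" "n * \<delta> \<le> \<rho>"
      using \<delta>1 \<rho>(1) n by (auto simp: \<delta>_def min_def field_simps)
    show ?case
    proof (intro exI conjI allI impI)
      fix c :: "'a \<Rightarrow> real" assume c: "\<forall>b\<in>insert b B. \<bar>c b\<bar> < \<delta>"
      define z where "z = x + (\<Sum>b\<in>B. c b *\<^sub>R b)"
      have near: "dist (z + t *\<^sub>R b) x < \<rho>" if "t \<in> closed_segment 0 (c b)" for t
      proof -
        have t: "\<bar>t\<bar> \<le> \<bar>c b\<bar>"
          using that by (auto simp: closed_segment_eq_real_ivl split: if_splits)
        have "norm (z + t *\<^sub>R b - x) \<le> norm (\<Sum>b\<in>B. c b *\<^sub>R b) + norm (t *\<^sub>R b)"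
          unfolding z_def by (simp add: norm_triangle_le)
        also have "\<dots> \<le> (\<Sum>b\<in>B. \<bar>c b\<bar>) + \<bar>c b\<bar>"
          using insert.prems t b by (intro add_mono sum_norm_le) (auto simp: subset_iff)
        also have "\<dots> = (\<Sum>b\<in>insert b B. \<bar>c b\<bar>)"
          using insert by simp
        also have "\<dots> < (\<Sum>b\<in>insert b B. \<delta>)"
          using insert c by (intro sum_strict_mono) auto
        also have "\<dots> = n * \<delta>"
          by (simp add: n_def)
        finally show ?thesis
          using \<delta> by (simp add: dist_norm)
      qed
      have "norm (f (z + c b *\<^sub>R b) - f (z + 0 *\<^sub>R b) - (c b - 0) *\<^sub>R partial b f x)
          \<le> norm (c b - 0) * e"
      proof -
        \<comment> \<open>Subtracting the linear part leaves a derivative of size at most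
          \<open>e\<close> on the segment.\<close>
        have der: "((\<lambda>t. f (z + t *\<^sub>R b) - t *\<^sub>R partial b f x) has_derivative
            (\<lambda>h. h *\<^sub>R (partial b f (z + t *\<^sub>R b) - partial b f x))) (at t within closed_segment 0 (c b))"
          if "t \<in> closed_segment 0 (c b)" for t
        proof -
          have "((\<lambda>t. f (z + t *\<^sub>R b)) has_vector_derivative partial b f (z + t *\<^sub>R b))
              (at t within closed_segment 0 (c b))"
            by (rule has_vector_derivative_at_within, rule has_partial, rule Ck_on_partial_exists[OF assms(2)])
              (use \<rho>(2)[OF near[OF that]] b in auto)
          then have "((\<lambda>t. f (z + t *\<^sub>R b) - t *\<^sub>R partial b f x) has_derivative
            (\<lambda>h. h *\<^sub>R partial b f (z + t *\<^sub>R b) - h *\<^sub>R partial b f x)) (at t within closed_segment 0 (c b))"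
            unfolding has_vector_derivative_def
            by (rule has_derivative_diff[OF _ has_derivative_scaleR_left[OF has_derivative_ident]])
          then show ?thesis
            by (simp add: scaleR_right_diff_distrib)
        qed
        have "norm ((f (z + c b *\<^sub>R b) - c b *\<^sub>R partial b f x) - (f (z + 0 *\<^sub>R b) - 0 *\<^sub>R partial b f x))
            \<le> e * norm (c b - 0)"
        proof (rule differentiable_bound[OF _ der])
          fix t assume "t \<in> closed_segment 0 (c b)"
          from \<rho>(2)[OF near[OF this]]
          show "onorm (\<lambda>h. h *\<^sub>R (partial b f (z + t *\<^sub>R b) - partial b f x)) \<le> e"
            by (simp add: onorm_scaleR_left onorm_id)
        qed auto
        then show ?thesis
          by (simp add: algebra_simps)
      qed
      then have 1: "norm (f (z + c b *\<^sub>R b) - f z - c b *\<^sub>R partial b f x) \<le> e * \<bar>c b\<bar>"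
        by (simp add: mult.commute)
      have 2: "norm (f z - f x - (\<Sum>b\<in>B. c b *\<^sub>R partial b f x)) \<le> e * (\<Sum>b\<in>B. \<bar>c b\<bar>)"
        unfolding z_def using c \<delta>(2) by (intro IH) force
      have zz: "x + (\<Sum>b\<in>insert b B. c b *\<^sub>R b) = z + c b *\<^sub>R b"
        using insert by (simp add: z_def algebra_simps)
      have "f (x + (\<Sum>b\<in>insert b B. c b *\<^sub>R b)) - f x - (\<Sum>b\<in>insert b B. c b *\<^sub>R partial b f x)
        = (f (z + c b *\<^sub>R b) - f z - c b *\<^sub>R partial b f x) + (f z - f x - (\<Sum>b\<in>B. c b *\<^sub>R partial b f x))"
        unfolding zz using insert by simp
      then have "norm (f (x + (\<Sum>b\<in>insert b B. c b *\<^sub>R b)) - f x - (\<Sum>b\<in>insert b B. c b *\<^sub>R partial b f x))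
        \<le> e * \<bar>c b\<bar> + e * (\<Sum>b\<in>B. \<bar>c b\<bar>)"
        using norm_triangle_mono[OF 1 2] by metis
      also have "\<dots> = e * (\<Sum>b\<in>insert b B. \<bar>c b\<bar>)"
        using insert by (simp add: algebra_simps)
      finally show "norm (f (x + (\<Sum>b\<in>insert b B. c b *\<^sub>R b)) - f x - (\<Sum>b\<in>insert b B. c b *\<^sub>R partial b f x))
        \<le> e * (\<Sum>b\<in>insert b B. \<bar>c b\<bar>)" .
    qed (rule \<delta>(1))
  qed
  show ?thesis
    unfolding has_derivative_at_alt
  proof (intro conjI allI impI)
    show "bounded_linear (\<lambda>h. \<Sum>b\<in>Basis. (h \<bullet> b) *\<^sub>R partial b f x)"
      by (intro bounded_linear_sum bounded_linear_compose[OF bounded_linear_scaleR_left]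
          bounded_linear_inner_left)
    fix e :: real assume "e > 0"
    \<comment> \<open>The sum of the absolute coordinates is at most \<open>DIM('a)\<close> times
      the norm.\<close>
    define e' where "e' = e / DIM('a)"
    have "e' > 0"
      using \<open>e > 0\<close> by (simp add: e'_def)
    then obtain \<delta> where \<delta>: "\<delta> > 0" "\<And>c. (\<And>b. b \<in> Basis \<Longrightarrow> \<bar>c b\<bar> < \<delta>) \<Longrightarrow>
      norm (f (x + (\<Sum>b\<in>Basis. c b *\<^sub>R b)) - f x - (\<Sum>b\<in>Basis. c b *\<^sub>R partial b f x))
        \<le> e' * (\<Sum>b\<in>Basis. \<bar>c b\<bar>)"
      using claim[of Basis e'] by auto
    show "\<exists>d>0. \<forall>y. norm (y - x) < d \<longrightarrow>
      norm (f y - f x - (\<Sum>b\<in>Basis. ((y - x) \<bullet> b) *\<^sub>R partial b f x)) \<le> e * norm (y - x)"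
    proof (intro exI conjI allI impI)
      fix y assume y: "norm (y - x) < \<delta>"
      have le: "\<bar>(y - x) \<bullet> b\<bar> \<le> norm (y - x)" if "b \<in> Basis" for b
        using Basis_le_norm[OF that] .
      have "norm (f y - f x - (\<Sum>b\<in>Basis. ((y - x) \<bullet> b) *\<^sub>R partial b f x))
          \<le> e' * (\<Sum>b\<in>Basis. \<bar>(y - x) \<bullet> b\<bar>)"
        using \<delta>(2)[of "\<lambda>b. (y - x) \<bullet> b"] le y by (force simp: euclidean_representation)
      also have "\<dots> \<le> e' * (\<Sum>b\<in>(Basis::'a set). norm (y - x))"
        using \<open>e' > 0\<close> le by (intro mult_left_mono sum_mono) auto
      also have "\<dots> = e * norm (y - x)"
        by (simp add: e'_def)
      finally show "norm (f y - f x - (\<Sum>b\<in>Basis. ((y - x) \<bullet> b) *\<^sub>R partial b f x))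
          \<le> e * norm (y - x)" .
    qed (rule \<delta>(1))
  qed
qed

text \<open>Expressed by partial derivatives, so that regularity and linearity are inherited
  termwise; \<open>has_derivative_dirD_pow_line\<close> identifies it with differentiation along a
  line.\<close>

definition dirD :: "'a \<Rightarrow> ('a::euclidean_space \<Rightarrow> 'b::real_normed_vector) \<Rightarrow> 'a \<Rightarrow> 'b" where
  "dirD w f = (\<lambda>x. \<Sum>b\<in>Basis. (w \<bullet> b) *\<^sub>R partial b f x)"

lemma dirD_apply: "dirD w f x = (\<Sum>b\<in>Basis. (w \<bullet> b) *\<^sub>R partial b f x)"
  by (simp add: dirD_def)

lemma Ck_on_dirD:
  assumes "open S" "Ck_on (Suc a) f S"
  shows "Ck_on a (dirD w f) S"
  unfolding dirD_def
  by (rule Ck_on_linear_combination[where L = "\<lambda>b z. (w \<bullet> b) *\<^sub>R z" and f = "\<lambda>b. partial b f"])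
    (use assms in \<open>auto intro: Ck_on_partial bounded_linear_scaleR_right\<close>)

lemma Ck_bound_dirD:
  assumes "open S" "Ck_bound (Suc a) S f M"
  shows "Ck_bound a S (dirD w f) ((\<Sum>b\<in>Basis. \<bar>w \<bullet> b\<bar>) * M)"
  unfolding dirD_def sum_distrib_right
  by (rule Ck_bound_linear_combination[where L = "\<lambda>b z. (w \<bullet> b) *\<^sub>R z" and f = "\<lambda>b. partial b f"])
    (use assms in \<open>auto intro: Ck_bound_partial bounded_linear_scaleR_right\<close>)

lemma Ck_on_dirD_pow:
  assumes "open S" "Ck_on (p + a) f S"
  shows "Ck_on a ((dirD w ^^ p) f) S"
  using assms(2)
proof (induction p arbitrary: a)
  case (Suc p)
  then have "Ck_on (Suc a) ((dirD w ^^ p) f) S"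
    by (metis add_Suc_shift)
  then show ?case
    using Ck_on_dirD[OF assms(1)] by simp
qed simp

lemma Ck_bound_dirD_pow:
  assumes "open S" "Ck_bound (p + a) S f M"
  shows "Ck_bound a S ((dirD w ^^ p) f) ((\<Sum>b\<in>Basis. \<bar>w \<bullet> b\<bar>) ^ p * M)"
  using assms(2)
proof (induction p arbitrary: a)
  case (Suc p)
  then have "Ck_bound (Suc a) S ((dirD w ^^ p) f) ((\<Sum>b\<in>Basis. \<bar>w \<bullet> b\<bar>) ^ p * M)"
    by (metis add_Suc_shift)
  from Ck_bound_dirD[OF assms(1) this, of w] show ?case
    by (simp add: mult.assoc)
qed simp

lemma dirD_pow_linear_combination:
  assumes "open S" "finite I" "\<And>i. i \<in> I \<Longrightarrow> bounded_linear (L i)"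
    and "\<And>i. i \<in> I \<Longrightarrow> Ck_on p (f i) S" "x \<in> S"
  shows "(dirD w ^^ p) (\<lambda>x. \<Sum>i\<in>I. L i (f i x)) x = (\<Sum>i\<in>I. L i ((dirD w ^^ p) (f i) x))"
  using assms(4,5)
proof (induction p arbitrary: x)
  case (Suc p)
  have Ck: "Ck_on (Suc 0) ((dirD w ^^ p) (f i)) S" if "i \<in> I" for i
    by (rule Ck_on_dirD_pow[OF assms(1)]) (use Suc.prems(1)[OF that] in auto)
  have "partial b ((dirD w ^^ p) (\<lambda>x. \<Sum>i\<in>I. L i (f i x))) x =
      (\<Sum>i\<in>I. L i (partial b ((dirD w ^^ p) (f i)) x))" if b: "b \<in> Basis" for b
  proof -
    have "(dirD w ^^ p) (\<lambda>x. \<Sum>i\<in>I. L i (f i x)) y = (\<Sum>i\<in>I. L i ((dirD w ^^ p) (f i) y))"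
      if "y \<in> S" for y
      using that Ck_on_mono[OF Suc.prems(1), of _ p] by (intro Suc.IH) auto
    then have "partial b ((dirD w ^^ p) (\<lambda>x. \<Sum>i\<in>I. L i (f i x))) x =
        partial b (\<lambda>x. \<Sum>i\<in>I. L i ((dirD w ^^ p) (f i) x)) x"
      using Suc.prems(2) by (intro partial_cong(1)[OF assms(1)])
    also have "\<dots> = (\<Sum>i\<in>I. L i (partial b ((dirD w ^^ p) (f i)) x))"
      using assms(2,3) Suc.prems(2) b Ck
      by (intro partial_linear_combination(2)) (auto intro: Ck_on_partial_exists)
    finally show ?thesis .
  qed
  then have "(dirD w ^^ Suc p) (\<lambda>x. \<Sum>i\<in>I. L i (f i x)) x =
      (\<Sum>b\<in>Basis. \<Sum>i\<in>I. (w \<bullet> b) *\<^sub>R L i (partial b ((dirD w ^^ p) (f i)) x))"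
    by (simp add: dirD_apply scaleR_sum_right)
  also have "\<dots> = (\<Sum>i\<in>I. \<Sum>b\<in>Basis. (w \<bullet> b) *\<^sub>R L i (partial b ((dirD w ^^ p) (f i)) x))"
    by (rule sum.swap)
  also have "\<dots> = (\<Sum>i\<in>I. L i ((dirD w ^^ Suc p) (f i) x))"
    using assms(3)
    by (auto intro!: sum.cong simp: dirD_apply linear_sum[OF bounded_linear.linear]
        linear_cmul[OF bounded_linear.linear])
  finally show ?case .
qed simp

text \<open>This is how an additive constant in a divisor, however large, disappears from all
  derivatives of positive order.\<close>

lemma dirD_pow_const: "1 \<le> p \<Longrightarrow> (dirD w ^^ p) (\<lambda>_. c) = (\<lambda>_. 0)"
proof (induction p rule: dec_induct)
  case base
  show ?case by (simp add: dirD_def)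
next
  case (step p)
  then show ?case by (simp add: dirD_def[of w "\<lambda>_. 0"])
qed

lemma has_derivative_dirD_pow_line:
  assumes "open S" "Ck_on (Suc p) f S" "x + t *\<^sub>R w \<in> S"
  shows "((\<lambda>t. (dirD w ^^ p) f (x + t *\<^sub>R w)) has_vector_derivative (dirD w ^^ Suc p) f (x + t *\<^sub>R w)) (at t)"
proof -
  have "Ck_on (Suc 0) ((dirD w ^^ p) f) S"
    by (rule Ck_on_dirD_pow[OF assms(1)]) (use assms(2) in auto)
  from has_derivative_of_partials[OF assms(1) this assms(3)]
  have "((dirD w ^^ p) f has_derivative
      (\<lambda>h. \<Sum>b\<in>Basis. (h \<bullet> b) *\<^sub>R partial b ((dirD w ^^ p) f) (x + t *\<^sub>R w))) (at (x + t *\<^sub>R w))" .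
  moreover have "((\<lambda>t. x + t *\<^sub>R w) has_derivative (\<lambda>h. h *\<^sub>R w)) (at t)"
    by (auto intro!: derivative_eq_intros)
  ultimately have "((\<lambda>t. (dirD w ^^ p) f (x + t *\<^sub>R w)) has_derivative
      (\<lambda>h. \<Sum>b\<in>Basis. ((h *\<^sub>R w) \<bullet> b) *\<^sub>R partial b ((dirD w ^^ p) f) (x + t *\<^sub>R w))) (at t)"
    by (rule has_derivative_compose[rotated])
  then show ?thesis
    by (simp add: has_vector_derivative_def dirD_apply scaleR_sum_right)
qed

section \<open>Finite differences and mixed derivatives\<close>

primrec fdiff :: "'a list \<Rightarrow> real \<Rightarrow> ('a::real_normed_vector \<Rightarrow> real) \<Rightarrow> 'a \<Rightarrow> real" where
  "fdiff [] t f x = f x"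
| "fdiff (v # vs) t f x = fdiff vs t f (x + t *\<^sub>R v) - fdiff vs t f x"

lemma cball_shift_subset:
  assumes "norm v \<le> 1" "0 \<le> s" "s \<le> t"
  shows "cball (x + s *\<^sub>R v) (t * n) \<subseteq> cball x (t * (1 + n))"
proof
  fix y assume "y \<in> cball (x + s *\<^sub>R v) (t * n)"
  moreover have "dist x (x + s *\<^sub>R v) \<le> t"
    using assms mult_left_le[of "norm v" s] by (simp add: dist_norm)
  ultimately show "y \<in> cball x (t * (1 + n))"
    using dist_triangle[of x y "x + s *\<^sub>R v"] by (simp add: algebra_simps)
qed

text \<open>\<open>fdiff vs t f\<close> combines translates of \<open>f\<close> by at most
  \<open>length vs\<close> steps of length \<open>t\<close>, which explains the radius of the ball;
  differentiation commutes with translation.\<close>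

lemma has_derivative_fdiff:
  fixes t :: real
  assumes "\<And>y. y \<in> cball (x + s *\<^sub>R v) (t * length vs) \<Longrightarrow> partial_exists v f y"
    and "set vs \<subseteq> Basis" "0 \<le> t"
  shows "((\<lambda>s. fdiff vs t f (x + s *\<^sub>R v)) has_vector_derivative
    fdiff vs t (partial v f) (x + s *\<^sub>R v)) (at s)"
  using assms
proof (induction vs arbitrary: x)
  case Nil
  then show ?case
    by (auto intro: has_partial)
next
  case (Cons u us)
  have "cball (x + s *\<^sub>R v) (t * length us) \<subseteq> cball (x + s *\<^sub>R v) (t * length (u # us))"
    using Cons.prems by (intro subset_cball) (auto simp: algebra_simps)
  then have 1: "((\<lambda>s. fdiff us t f (x + s *\<^sub>R v)) has_vector_derivative
      fdiff us t (partial v f) (x + s *\<^sub>R v)) (at s)"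
    using Cons.prems by (intro Cons.IH) auto
  have "cball (x + s *\<^sub>R v + t *\<^sub>R u) (t * length us) \<subseteq> cball (x + s *\<^sub>R v) (t * length (u # us))"
    using Cons.prems cball_shift_subset[of u t t "x + s *\<^sub>R v" "length us"] by simp
  then have 2: "((\<lambda>s. fdiff us t f ((x + t *\<^sub>R u) + s *\<^sub>R v)) has_vector_derivative
      fdiff us t (partial v f) ((x + t *\<^sub>R u) + s *\<^sub>R v)) (at s)"
    using Cons.prems by (intro Cons.IH) (auto simp: add_ac)
  show ?case
    using has_vector_derivative_diff[OF 2 1] by (simp add: add_ac)
qed

text \<open>The mean value theorem trades the outermost difference for a derivative, which then acts
  on \<open>f\<close> before all the others. Hence the list is reversed.\<close>

lemma fdiff_mean_value:
  fixes t :: real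
  assumes "Ck_on (length vs) f S" "cball x (t * length vs) \<subseteq> S" "set vs \<subseteq> Basis" "0 < t"
  shows "\<exists>y\<in>cball x (t * length vs). fdiff vs t f x = t ^ length vs * iter_partial (rev vs) f y"
  using assms(1-3)
proof (induction vs arbitrary: f x)
  case (Cons v vs)
  have shift: "cball (x + s *\<^sub>R v) (t * length vs) \<subseteq> cball x (t * length (v # vs))"
    if "0 \<le> s" "s \<le> t" for s
    using cball_shift_subset[of v s t x "length vs"] that Cons.prems by simp
  have "\<exists>s>0. s < t \<and> fdiff vs t f (x + t *\<^sub>R v) - fdiff vs t f (x + 0 *\<^sub>R v)
      = (t - 0) * fdiff vs t (partial v f) (x + s *\<^sub>R v)"
  proof (rule MVT2[OF assms(4)])
    fix s assume s: "0 \<le> s" "s \<le> t"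
    have "((\<lambda>s. fdiff vs t f (x + s *\<^sub>R v)) has_vector_derivative
        fdiff vs t (partial v f) (x + s *\<^sub>R v)) (at s)"
    proof (rule has_derivative_fdiff)
      fix y assume "y \<in> cball (x + s *\<^sub>R v) (t * length vs)"
      then have "y \<in> S"
        using shift[OF s] Cons.prems(2) by blast
      then show "partial_exists v f y"
        using Cons.prems Ck_on_partial_exists[of "length vs" f S v] by simp
    qed (use Cons.prems assms(4) in auto)
    then show "((\<lambda>s. fdiff vs t f (x + s *\<^sub>R v)) has_real_derivative
        fdiff vs t (partial v f) (x + s *\<^sub>R v)) (at s)"
      by (simp add: has_real_derivative_iff_has_vector_derivative)
  qed
  then obtain s where s: "0 < s" "s < t"
    "fdiff (v # vs) t f x = t * fdiff vs t (partial v f) (x + s *\<^sub>R v)"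
    by auto
  have "\<exists>y\<in>cball (x + s *\<^sub>R v) (t * length vs).
      fdiff vs t (partial v f) (x + s *\<^sub>R v) = t ^ length vs * iter_partial (rev vs) (partial v f) y"
    using Cons.prems shift[of s] s by (intro Cons.IH) (auto intro: Ck_on_partial)
  then show ?case
    using s shift[of s] by auto
qed (use assms in auto)

text \<open>A difference is a signed sum of values \<open>f (x + t *\<^sub>R u)\<close> whose
  coefficients add up to zero once the list is nonempty. The induction needs all \<open>u\<close>,
  since each difference shifts the base point.\<close>

lemma fdiff_small:
  assumes "\<And>u. ((\<lambda>t. (f (x + t *\<^sub>R u) - f x) / t ^ n) \<longlongrightarrow> 0) (at_right 0)"
  shows "((\<lambda>t. (fdiff vs t f (x + t *\<^sub>R u) - (if vs = [] then f x else 0)) / t ^ n) \<longlongrightarrow> 0) (at_right 0)"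
proof (induction vs arbitrary: u)
  case (Cons v vs)
  from tendsto_diff[OF Cons.IH[of "u + v"] Cons.IH[of u]]
  show ?case
    by (simp add: algebra_simps diff_divide_distrib[symmetric])
qed (use assms in simp)

text \<open>Finite differences recover the mixed derivatives from the directional ones, without
  appealing to the symmetry of mixed derivatives.\<close>

lemma iter_partial_zero_of_dirD_zero:
  fixes f :: "'a::euclidean_space \<Rightarrow> real"
  assumes "open S" "x \<in> S" "Ck_on a f S"
    and dir: "\<And>w p. 1 \<le> p \<Longrightarrow> p \<le> a \<Longrightarrow> (dirD w ^^ p) f x = 0"
    and vs: "vs \<in> multi a" "vs \<noteq> []"
  shows "iter_partial vs f x = 0"
proof (rule ccontr)
  define n where "n = length vs"
  define L where "L = iter_partial vs f x"
  assume "iter_partial vs f x \<noteq> 0"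
  then have L: "\<bar>L\<bar> > 0"
    by (simp add: L_def)
  have n: "1 \<le> n" "n \<le> a"
    using vs by (auto simp: n_def multi_def Suc_le_eq)
  obtain R where R: "R > 0" "cball x R \<subseteq> S"
    using assms(1,2) open_contains_cball by blast
  \<comment> \<open>Taylor's formula: the directional derivatives of orders 1 to \<open>n\<close>
    vanish at \<open>x\<close>, so along each line \<open>f\<close> differs from \<open>f x\<close>
    by o(t^n).\<close>
  have small: "((\<lambda>t. (f (x + t *\<^sub>R u) - f x) / t ^ n) \<longlongrightarrow> 0) (at_right 0)" for u
  proof (rule tendstoI)
    fix e :: real assume e: "e > 0"
    have "continuous_on S ((dirD u ^^ n) f)"
      by (rule Ck_on_continuous, rule Ck_on_dirD_pow[OF assms(1), where a = "a - n"])
        (use assms(3) n in auto)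
    then have "isCont ((dirD u ^^ n) f) x"
      using assms(1,2) continuous_on_eq_continuous_at by blast
    moreover have "((\<lambda>t::real. x + t *\<^sub>R u) \<longlongrightarrow> x + 0 *\<^sub>R u) (at 0)"
      by (intro tendsto_intros)
    ultimately have "((\<lambda>t. (dirD u ^^ n) f (x + t *\<^sub>R u)) \<longlongrightarrow> (dirD u ^^ n) f x) (at 0)"
      by (intro isCont_tendsto_compose[of x "(dirD u ^^ n) f"]) auto
    then have "\<forall>\<^sub>F t in at 0. dist ((dirD u ^^ n) f (x + t *\<^sub>R u)) 0 < e"
      using tendstoD[OF _ e] dir[OF n] by fastforce
    then obtain d where d: "d > 0"
      "\<And>t. t \<noteq> 0 \<Longrightarrow> \<bar>t\<bar> < d \<Longrightarrow> \<bar>(dirD u ^^ n) f (x + t *\<^sub>R u)\<bar> < e"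
      unfolding eventually_at by (auto simp: dist_real_def)
    \<comment> \<open>Keeps the segment from \<open>x\<close> to \<open>x + t *\<^sub>R u\<close>
      inside \<open>cball x R\<close>; the summand 1 covers \<open>u = 0\<close>.\<close>
    define d' where "d' = min d (R / (norm u + 1))"
    have d': "d' > 0"
      using d R by (simp add: d'_def add_nonneg_pos)
    have main: "dist ((f (x + t *\<^sub>R u) - f x) / t ^ n) 0 < e" if t: "0 < t" "t < d'" for t
    proof -
      define D where "D = (\<lambda>m t. (dirD u ^^ m) f (x + t *\<^sub>R u))"
      have "x + s *\<^sub>R u \<in> S" if s: "0 \<le> s" "s \<le> t" for s
      proof -
        have "s * norm u \<le> d' * (norm u + 1)"
          using s t d' by (intro mult_mono) auto
        also have "\<dots> \<le> R"
          unfolding d'_def by (metis add_nonneg_pos less_eq_real_def min.cobounded2 norm_ge_zero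
              pos_le_divide_eq zero_less_one)
        finally show ?thesis
          using R s by (auto simp: dist_norm)
      qed
      then have der: "\<forall>m s. m < n \<and> 0 \<le> s \<and> s \<le> t \<longrightarrow> DERIV (D m) s :> D (Suc m) s"
        unfolding D_def has_real_derivative_iff_has_vector_derivative
        using has_derivative_dirD_pow_line[OF assms(1) Ck_on_mono[OF assms(3)]] n by auto
      obtain s where s: "0 < s" "s < t" "f (x + t *\<^sub>R u) =
          (\<Sum>m<n. D m 0 / fact m * t ^ m) + D n s / fact n * t ^ n"
        using Maclaurin[OF t(1) _ _ der, of "\<lambda>t. f (x + t *\<^sub>R u)"] n by (auto simp: D_def)
      have "(\<Sum>m<n. D m 0 / fact m * t ^ m) = (\<Sum>m<n. if m = 0 then f x else 0)"
        using dir n by (intro sum.cong) (auto simp: D_def)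
      also have "\<dots> = f x"
        using n by (simp add: sum.delta)
      finally have "(f (x + t *\<^sub>R u) - f x) / t ^ n = D n s / fact n"
        using s t by simp
      moreover have "\<bar>D n s / fact n\<bar> \<le> \<bar>D n s\<bar>"
        using fact_ge_1[of n, where 'a = real] by (simp add: divide_le_eq mult_left_le_one_le
            mult_le_cancel_left1 mult_left_le)
      moreover have "\<bar>D n s\<bar> < e"
        unfolding D_def using s t by (intro d) (auto simp: d'_def)
      ultimately show ?thesis
        by (simp add: dist_real_def)
    qed
    then show "\<forall>\<^sub>F t in at_right 0. dist ((f (x + t *\<^sub>R u) - f x) / t ^ n) 0 < e"
      using d' unfolding eventually_at_right_field by blast
  qed
  have "((\<lambda>t. fdiff (rev vs) t f x / t ^ n) \<longlongrightarrow> 0) (at_right 0)"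
    using fdiff_small[OF small, of "rev vs" 0] vs by simp
  then have "\<forall>\<^sub>F t in at_right 0. dist (fdiff (rev vs) t f x / t ^ n) 0 < \<bar>L\<bar> / 2"
    using L by (intro tendstoD) auto
  then obtain d1 where d1: "d1 > 0" "\<And>t. 0 < t \<Longrightarrow> t < d1 \<Longrightarrow> \<bar>fdiff (rev vs) t f x / t ^ n\<bar> < \<bar>L\<bar> / 2"
    unfolding eventually_at_right_field by (auto simp: dist_real_def)
  have "continuous_on S (iter_partial vs f)"
    using Ck_onD(1)[OF assms(3) vs(1)] .
  then have "isCont (iter_partial vs f) x"
    using assms(1,2) continuous_on_eq_continuous_at by blast
  then obtain d2 where d2: "d2 > 0" "\<And>y. dist y x < d2 \<Longrightarrow> dist (iter_partial vs f y) L < \<bar>L\<bar> / 2"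
    using L unfolding continuous_at_eps_delta L_def by (metis half_gt_zero)
  \<comment> \<open>\<open>t < d1\<close> makes the difference quotient smaller than half of
    \<open>\<bar>L\<bar>\<close>. The bound on \<open>t * n\<close> keeps the mean value point
    \<open>y\<close> in \<open>S\<close> and so near to \<open>x\<close> that the mixed derivative
    at \<open>y\<close> is within half of \<open>\<bar>L\<bar>\<close> of \<open>L\<close>. Both
    cannot hold.\<close>
  define t where "t = min (d1 / 2) (min R (d2 / 2) / n)"
  have t: "0 < t" "t < d1" "t * n \<le> R" "t * n < d2"
  proof -
    show "0 < t" "t < d1"
      using d1 d2 R n by (auto simp: t_def)
    have "t \<le> min R (d2 / 2) / n"
      by (simp add: t_def)
    then have "t * n \<le> min R (d2 / 2)"
      using n by (subst (asm) pos_le_divide_eq) auto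
    then show "t * n \<le> R" "t * n < d2"
      using d2 by auto
  qed
  have "\<exists>y\<in>cball x (t * length (rev vs)). fdiff (rev vs) t f x = t ^ length (rev vs) * iter_partial (rev (rev vs)) f y"
    by (rule fdiff_mean_value[where S = S])
      (use Ck_on_mono[OF assms(3)] n t R vs subset_cball[of "t * n" R x] in \<open>auto simp: n_def multi_def\<close>)
  then obtain y where y: "dist x y \<le> t * n" "fdiff (rev vs) t f x = t ^ n * iter_partial vs f y"
    by (auto simp: n_def)
  have "\<bar>iter_partial vs f y\<bar> < \<bar>L\<bar> / 2"
    using d1(2)[OF t(1,2)] y(2) t(1) by simp
  moreover have "\<bar>iter_partial vs f y - L\<bar> < \<bar>L\<bar> / 2"
  proof -
    have "dist y x < d2"
      using y(1) t(4) by (metis dist_commute le_less_trans)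
    then show ?thesis
      using d2(2)[of y] by (simp add: dist_real_def)
  qed
  ultimately show False
    by linarith
qed

subsection \<open>Sublevel sets of nondegenerate functions\<close>

text \<open>A form of Pyartli's lemma, by induction on the order. Where the next lower derivative is
  at least \<open>c * \<tau>\<close> in absolute value, the induction hypothesis applies with that
  constant; the remaining middle piece has length at most \<open>2 * \<tau>\<close>, because there
  that derivative increases with slope at least \<open>c\<close> through a band of width
  \<open>2 * c * \<tau>\<close>.\<close>

lemma sublevel_line:
  fixes \<phi> :: "nat \<Rightarrow> real \<Rightarrow> real"
  assumes "convex I" "\<And>i t. i < p \<Longrightarrow> t \<in> I \<Longrightarrow> (\<phi> i has_real_derivative \<phi> (Suc i) t) (at t)"
    and "\<And>t. t \<in> I \<Longrightarrow> c \<le> \<phi> p t" "0 < c" "0 < \<tau>" "h \<le> c * \<tau> ^ p"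
  shows "\<exists>T. finite T \<and> card T \<le> 3 ^ p \<and> {t\<in>I. \<bar>\<phi> 0 t\<bar> < h} \<subseteq> (\<Union>s\<in>T. {s..s + 2 * \<tau>})"
  using assms
proof (induction p arbitrary: \<phi> I c)
  case 0
  then show ?case
    by (intro exI[of _ "{}"]) force
next
  case (Suc p)
  define s where "s = c * \<tau>"
  have s: "s > 0" "h \<le> s * \<tau> ^ p"
    using Suc.prems by (auto simp: s_def mult.assoc)
  have inc: "c * (t2 - t1) \<le> \<phi> p t2 - \<phi> p t1" if t: "t1 \<in> I" "t2 \<in> I" "t1 \<le> t2" for t1 t2
  proof (cases "t1 = t2")
    case False
    have "\<exists>z>t1. z < t2 \<and> \<phi> p t2 - \<phi> p t1 = (t2 - t1) * \<phi> (Suc p) z"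
    proof (rule MVT2)
      fix z assume z: "t1 \<le> z" "z \<le> t2"
      then have "z \<in> I"
        using t Suc.prems(1) by (meson convex_contains_segment is_interval_1 is_interval_convex_1)
      then show "(\<phi> p has_real_derivative \<phi> (Suc p) z) (at z)"
        using Suc.prems(2) by blast
    qed (use False t in auto)
    then obtain z where z: "t1 < z" "z < t2" "\<phi> p t2 - \<phi> p t1 = (t2 - t1) * \<phi> (Suc p) z"
      by blast
    have "z \<in> I"
      using t z Suc.prems(1) by (meson less_imp_le is_interval_1 is_interval_convex_1)
    then show ?thesis
      using Suc.prems(3) t z(3) by (simp add: mult.commute[of c] mult_left_mono)
  qed auto
  have mono: "\<phi> p t1 \<le> \<phi> p t2" if "t1 \<in> I" "t2 \<in> I" "t1 \<le> t2" for t1 t2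
    using inc[OF that] Suc.prems(4) that mult_nonneg_nonneg[of c "t2 - t1"] by linarith
  define I1 where "I1 = {t\<in>I. s \<le> \<phi> p t}"
  define I2 where "I2 = {t\<in>I. s \<le> - \<phi> p t}"
  define M where "M = {t\<in>I. \<bar>\<phi> p t\<bar> < s}"
  have Ico: "t \<in> I" if "t1 \<in> I" "t2 \<in> I" "t1 \<le> t" "t \<le> t2" for t t1 t2
    using that Suc.prems(1) by (meson is_interval_1 is_interval_convex_1)
  have "convex I1"
    unfolding is_interval_convex_1[symmetric] is_interval_1 I1_def
  proof (intro ballI allI impI)
    fix t1 t2 t assume "t1 \<in> {t\<in>I. s \<le> \<phi> p t}" "t2 \<in> {t\<in>I. s \<le> \<phi> p t}" "t1 \<le> t \<and> t \<le> t2"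
    then show "t \<in> {t\<in>I. s \<le> \<phi> p t}"
      using Ico[of t1 t2 t] mono[of t1 t] by auto
  qed
  then have "\<exists>T. finite T \<and> card T \<le> 3 ^ p \<and> {t\<in>I1. \<bar>\<phi> 0 t\<bar> < h} \<subseteq> (\<Union>s\<in>T. {s..s + 2 * \<tau>})"
    using Suc.prems s by (intro Suc.IH[of I1 \<phi> s]) (auto simp: I1_def)
  then obtain T1 where T1: "finite T1" "card T1 \<le> 3 ^ p" "{t\<in>I1. \<bar>\<phi> 0 t\<bar> < h} \<subseteq> (\<Union>s\<in>T1. {s..s + 2 * \<tau>})"
    by blast
  have "convex I2"
    unfolding is_interval_convex_1[symmetric] is_interval_1 I2_def
  proof (intro ballI allI impI)
    fix t1 t2 t assume "t1 \<in> {t\<in>I. s \<le> - \<phi> p t}" "t2 \<in> {t\<in>I. s \<le> - \<phi> p t}" "t1 \<le> t \<and> t \<le> t2"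
    then show "t \<in> {t\<in>I. s \<le> - \<phi> p t}"
      using Ico[of t1 t2 t] mono[of t t2] by auto
  qed
  then have "\<exists>T. finite T \<and> card T \<le> 3 ^ p \<and> {t\<in>I2. \<bar>- \<phi> 0 t\<bar> < h} \<subseteq> (\<Union>s\<in>T. {s..s + 2 * \<tau>})"
    using Suc.prems s by (intro Suc.IH[of I2 "\<lambda>i t. - \<phi> i t" s]) (auto simp: I2_def intro: DERIV_minus)
  then obtain T2 where T2: "finite T2" "card T2 \<le> 3 ^ p" "{t\<in>I2. \<bar>\<phi> 0 t\<bar> < h} \<subseteq> (\<Union>s\<in>T2. {s..s + 2 * \<tau>})"
    by auto
  have gap: "t2 - 2 * \<tau> \<le> t1" if "t1 \<in> M" "t2 \<in> M" for t1 t2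
  proof (cases "t1 \<le> t2")
    case True
    have "c * (t2 - t1) < c * (2 * \<tau>)"
      using inc[of t1 t2] that True by (auto simp: M_def s_def)
    then show ?thesis
      using Suc.prems(4) by (simp add: mult_less_cancel_left_pos)
  qed (use Suc.prems in auto)
  have M: "M \<subseteq> {Inf M..Inf M + 2 * \<tau>}"
  proof
    fix t assume t: "t \<in> M"
    have "bdd_below M"
      using gap[OF _ t] by (intro bdd_belowI)
    moreover have "t - 2 * \<tau> \<le> Inf M"
      using t gap by (intro cInf_greatest) auto
    ultimately show "t \<in> {Inf M..Inf M + 2 * \<tau>}"
      using t cInf_lower by force
  qed
  \<comment> \<open>Two outer pieces and one middle interval: 2 * 3^p + 1 is at most
    3^(p+1).\<close>
  have "card (insert (Inf M) (T1 \<union> T2)) \<le> 3 ^ Suc p"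
  proof -
    have "card (insert (Inf M) (T1 \<union> T2)) \<le> Suc (card T1 + card T2)"
      using card_Un_le[of T1 T2] T1(1) T2(1) by (auto simp: card_insert_if)
    moreover have "1 \<le> (3::nat) ^ p"
      by simp
    ultimately show ?thesis
      unfolding power_Suc using T1(2) T2(2) by linarith
  qed
  moreover have "{t\<in>I. \<bar>\<phi> 0 t\<bar> < h} \<subseteq> {t\<in>I1. \<bar>\<phi> 0 t\<bar> < h} \<union> {t\<in>I2. \<bar>\<phi> 0 t\<bar> < h} \<union> M"
    by (auto simp: I1_def I2_def M_def)
  then have "{t\<in>I. \<bar>\<phi> 0 t\<bar> < h} \<subseteq> (\<Union>s\<in>insert (Inf M) (T1 \<union> T2). {s..s + 2 * \<tau>})"
    using T1(3) T2(3) M by blast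
  moreover have "finite (insert (Inf M) (T1 \<union> T2))"
    using T1(1) T2(1) by simp
  ultimately show ?case
    by (intro exI[of _ "insert (Inf M) (T1 \<union> T2)"] conjI)
qed

text \<open>Averaging the measure of \<open>T\<close> over its translates along \<open>w\<close> replaces a change of coordinates
  that turns \<open>w\<close> into a coordinate direction.\<close>

lemma emeasure_le_of_slices:
  fixes T :: "'a::euclidean_space set"
  assumes T: "T \<in> sets borel" "T \<subseteq> ball x0 R"
    and slice: "\<And>x. emeasure lborel {s\<in>{0..1}. x + s *\<^sub>R w \<in> T} \<le> ennreal D"
  shows "emeasure lborel T \<le> ennreal D * emeasure lborel (ball x0 (R + norm w))"
proof -
  define f :: "'a \<times> real \<Rightarrow> ennreal" where
    "f = (\<lambda>(x, s). indicator {0..1} s * indicator T (x + s *\<^sub>R w))"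
  have [measurable]: "f \<in> borel_measurable (lborel \<Otimes>\<^sub>M lborel)"
    using T(1) unfolding f_def by measurable
  have "emeasure lborel T = (\<integral>\<^sup>+s. indicator {0..1::real} s * emeasure lborel T \<partial>lborel)"
    by (simp add: nn_integral_multc)
  also have "\<dots> = (\<integral>\<^sup>+s. \<integral>\<^sup>+x. f (x, s) \<partial>lborel \<partial>lborel)"
  proof (rule nn_integral_cong)
    fix s :: real
    have "emeasure lborel T = emeasure (distr lborel borel ((+) (s *\<^sub>R w))) T"
      by (simp add: lborel_distr_plus)
    also have "\<dots> = emeasure lborel ((\<lambda>x. x + s *\<^sub>R w) -` T)"
      using T(1) by (subst emeasure_distr) (auto simp: vimage_def add.commute)
    also have "\<dots> = (\<integral>\<^sup>+x. indicator T (x + s *\<^sub>R w) \<partial>lborel)"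
    proof -
      have "(\<lambda>x. x + s *\<^sub>R w) -` T \<in> sets borel"
        using measurable_sets[of "\<lambda>x. x + s *\<^sub>R w" borel borel T] T(1) by simp
      moreover have "indicator T (x + s *\<^sub>R w) = (indicator ((\<lambda>x. x + s *\<^sub>R w) -` T) x :: ennreal)" for x
        by (simp add: indicator_def)
      ultimately show ?thesis
        by simp
    qed
    finally show "indicator {0..1::real} s * emeasure lborel T = (\<integral>\<^sup>+x. f (x, s) \<partial>lborel)"
      using T(1) by (simp add: f_def nn_integral_cmult)
  qed
  also have "\<dots> = (\<integral>\<^sup>+x. \<integral>\<^sup>+s. f (x, s) \<partial>lborel \<partial>lborel)"
    by (rule lborel_pair.Fubini') measurable
  also have "\<dots> \<le> (\<integral>\<^sup>+x. ennreal D * indicator (ball x0 (R + norm w)) x \<partial>lborel)"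
  proof (rule nn_integral_mono)
    fix x :: 'a
    have sl: "(\<integral>\<^sup>+s. f (x, s) \<partial>lborel) = emeasure lborel {s\<in>{0..1}. x + s *\<^sub>R w \<in> T}"
    proof -
      have "{s\<in>{0..1}. x + s *\<^sub>R w \<in> T} = {0..1} \<inter> (\<lambda>s. x + s *\<^sub>R w) -` T"
        by auto
      moreover have "(\<lambda>s::real. x + s *\<^sub>R w) -` T \<in> sets borel"
        using measurable_sets[of "\<lambda>s::real. x + s *\<^sub>R w" borel borel T] T(1) by simp
      ultimately have "{s\<in>{0..1}. x + s *\<^sub>R w \<in> T} \<in> sets lborel"
        by simp
      then have "emeasure lborel {s\<in>{0..1}. x + s *\<^sub>R w \<in> T} =
          (\<integral>\<^sup>+s. indicator {s\<in>{0..1}. x + s *\<^sub>R w \<in> T} s \<partial>lborel)"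
        by simp
      also have "\<dots> = (\<integral>\<^sup>+s. f (x, s) \<partial>lborel)"
        by (intro nn_integral_cong) (auto simp: f_def indicator_def)
      finally show ?thesis
        by simp
    qed
    show "(\<integral>\<^sup>+s. f (x, s) \<partial>lborel) \<le> ennreal D * indicator (ball x0 (R + norm w)) x"
    \<comment> \<open>From a point outside this ball no shift by \<open>s *\<^sub>R w\<close> with
      \<open>s\<close> in [0,1] reaches \<open>T\<close>, so the slice bound is integrated over a
      bounded set only.\<close>
    proof (cases "x \<in> ball x0 (R + norm w)")
      case True
      then show ?thesis
        using sl slice[of x] by simp
    next
      case False
      have "x + s *\<^sub>R w \<notin> T" if "s \<in> {0..1}" for s
      proof
        assume "x + s *\<^sub>R w \<in> T"
        then have "dist x0 (x + s *\<^sub>R w) < R"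
          using T(2) by auto
        moreover have "dist (x + s *\<^sub>R w) x \<le> norm w"
          using that by (simp add: dist_norm mult_left_le_one_le)
        ultimately show False
          using False dist_triangle[of x0 x "x + s *\<^sub>R w"] by simp
      qed
      then have "{s\<in>{0..1}. x + s *\<^sub>R w \<in> T} = {}"
        by blast
      then show ?thesis
        unfolding sl by (simp only: emeasure_empty zero_le)
    qed
  qed
  also have "\<dots> = ennreal D * emeasure lborel (ball x0 (R + norm w))"
    by (rule nn_integral_cmult_indicator) simp
  finally show ?thesis .
qed

lemma emeasure_finite_union_intervals:
  assumes "finite T" "card T \<le> n" "0 \<le> \<tau>"
  shows "emeasure lborel (\<Union>s\<in>T. {s..s + \<tau>::real}) \<le> ennreal (n * \<tau>)"
proof -
  have "emeasure lborel (\<Union>s\<in>T. {s..s + \<tau>}) \<le> (\<Sum>s\<in>T. emeasure lborel {s..s + \<tau>})"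
    using assms by (intro emeasure_subadditive_finite) auto
  also have "\<dots> = ennreal (card T * \<tau>)"
    using assms by (simp add: ennreal_mult ennreal_of_nat_eq_real_of_nat)
  also have "\<dots> \<le> ennreal (n * \<tau>)"
    using assms by (intro ennreal_leI mult_right_mono) auto
  finally show ?thesis .
qed

lemma open_sublevel:
  fixes u :: "'a::euclidean_space \<Rightarrow> real"
  assumes "open U" "continuous_on U u"
  shows "open {x\<in>U. \<bar>u x\<bar> < h}"
proof -
  have "{x\<in>U. \<bar>u x\<bar> < h} = U \<inter> u -` {-h<..<h}"
    by auto
  then show ?thesis
    using continuous_open_preimage[OF assms(2,1)] by simp
qed

text \<open>The ball cuts an interval out of every line in direction \<open>w\<close>, and
  \<open>sublevel_line\<close> applies there; the sign \<open>\<sigma>\<close> admits a negative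
  derivative. Averaging over the slices costs the enlargement of the ball by
  \<open>norm w\<close>.\<close>

lemma sublevel_ball:
  fixes u :: "'a::euclidean_space \<Rightarrow> real"
  assumes "open S" "ball x0 R \<subseteq> S" "Ck_on p u S" "\<bar>\<sigma>\<bar> = 1"
    and "\<And>x. x \<in> ball x0 R \<Longrightarrow> c \<le> \<sigma> * (dirD w ^^ p) u x" "0 < c" "0 < \<tau>" "h \<le> c * \<tau> ^ p"
  shows "measure lborel {x\<in>ball x0 R. \<bar>u x\<bar> < h}
    \<le> 3 ^ p * (2 * \<tau>) * measure lborel (ball x0 (R + norm w))"
proof -
  let ?T = "{x\<in>ball x0 R. \<bar>u x\<bar> < h}"
  have "open ?T"
    using assms(2) Ck_on_continuous[OF assms(3)] continuous_on_subset by (intro open_sublevel) auto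
  then have T: "?T \<in> sets borel"
    by simp
  have slice: "emeasure lborel {s\<in>{0..1}. x + s *\<^sub>R w \<in> ?T} \<le> ennreal (3 ^ p * (2 * \<tau>))" for x
  proof -
    define I where "I = {s. x + s *\<^sub>R w \<in> ball x0 R}"
    define \<phi> where "\<phi> = (\<lambda>i s. \<sigma> * (dirD w ^^ i) u (x + s *\<^sub>R w))"
    have "convex I"
    proof (rule convexI)
      fix s t a b :: real assume st: "s \<in> I" "t \<in> I" and ab: "0 \<le> a" "0 \<le> b" "a + b = 1"
      have "a *\<^sub>R (x + s *\<^sub>R w) + b *\<^sub>R (x + t *\<^sub>R w) \<in> ball x0 R"
        using st ab by (intro convexD[OF convex_ball]) (auto simp: I_def)
      also have "a *\<^sub>R (x + s *\<^sub>R w) + b *\<^sub>R (x + t *\<^sub>R w) = (a + b) *\<^sub>R x + (a *\<^sub>R s + b *\<^sub>R t) *\<^sub>R w"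
        by (simp add: algebra_simps)
      finally show "a *\<^sub>R s + b *\<^sub>R t \<in> I"
        using ab by (simp add: I_def)
    qed
    moreover have "(\<phi> i has_real_derivative \<phi> (Suc i) s) (at s)" if "i < p" "s \<in> I" for i s
      unfolding \<phi>_def
      by (rule DERIV_cmult, unfold has_real_derivative_iff_has_vector_derivative,
          rule has_derivative_dirD_pow_line[OF assms(1)])
        (use that assms(2) Ck_on_mono[OF assms(3), of "Suc i"] in \<open>auto simp: I_def\<close>)
    moreover have "c \<le> \<phi> p s" if "s \<in> I" for s
      using that assms(5) by (simp add: I_def \<phi>_def)
    ultimately obtain Z where Z: "finite Z" "card Z \<le> 3 ^ p"
      "{s\<in>I. \<bar>\<phi> 0 s\<bar> < h} \<subseteq> (\<Union>s\<in>Z. {s..s + 2 * \<tau>})"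
      using sublevel_line[of I p \<phi> c \<tau> h] assms(6-8) by blast
    have "{s\<in>{0..1}. x + s *\<^sub>R w \<in> ?T} \<subseteq> (\<Union>s\<in>Z. {s..s + 2 * \<tau>})"
      using Z(3) assms(4) by (auto simp: I_def \<phi>_def abs_mult)
    then have "emeasure lborel {s\<in>{0..1}. x + s *\<^sub>R w \<in> ?T} \<le> emeasure lborel (\<Union>s\<in>Z. {s..s + 2 * \<tau>})"
      using Z(1) by (intro emeasure_mono) auto
    also have "\<dots> \<le> ennreal (3 ^ p * (2 * \<tau>))"
      using emeasure_finite_union_intervals[OF Z(1,2), of "2 * \<tau>"] assms(7) by simp
    finally show ?thesis .
  qed
  have "emeasure lborel ?T \<le> ennreal (3 ^ p * (2 * \<tau>)) * emeasure lborel (ball x0 (R + norm w))"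
    by (rule emeasure_le_of_slices[OF T _ slice]) auto
  also have "emeasure lborel (ball x0 (R + norm w)) = ennreal (measure lborel (ball x0 (R + norm w)))"
    using emeasure_eq_ennreal_measure[of lborel "ball x0 (R + norm w)"]
      emeasure_bounded_finite[of "ball x0 (R + norm w)"] by (simp add: less_top)
  finally have "emeasure lborel ?T \<le> ennreal (3 ^ p * (2 * \<tau>) * measure lborel (ball x0 (R + norm w)))"
    using assms(7) by (simp add: ennreal_mult)
  then show ?thesis
    using assms(7) unfolding measure_def by (intro enn2real_leI) auto
qed

lemma dirD_pow_add:
  assumes "open S" "Ck_on p f S" "Ck_on p g S" "x \<in> S"
  shows "(dirD w ^^ p) (\<lambda>x. f x + g x) x = (dirD w ^^ p) f x + (dirD w ^^ p) g x"
proof -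
  have "(dirD w ^^ p) (\<lambda>x. \<Sum>i\<in>{True, False}. (if i then f else g) x) x =
      (\<Sum>i\<in>{True, False}. (dirD w ^^ p) (if i then f else g) x)"
    by (rule dirD_pow_linear_combination[where L = "\<lambda>_ x. x"])
      (use assms bounded_linear_ident in auto)
  then show ?thesis
    by simp
qed

section \<open>Sublevel estimates uniform in the direction and under perturbation\<close>

text \<open>A nonzero directional derivative at \<open>x0\<close> for \<open>\<kappa>0\<close>
  persists for nearby \<open>x\<close> and \<open>\<kappa>\<close> and survives a perturbation that
  is small in C^a. The flag \<open>P\<close> forbids an additive constant \<open>z\<close>; only
  then may order zero witness the nondegeneracy.\<close>

lemma uniform_sublevel_local:
  fixes g :: "'a::euclidean_space \<Rightarrow> real ^ 'n"
  assumes "open S" "x0 \<in> S" "\<And>j. Ck_on a (\<lambda>x. g x $ j) S"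
    and nondeg: "\<exists>vs\<in>multi a. (vs \<noteq> [] \<or> P) \<and> iter_partial vs (\<lambda>x. \<Sum>j\<in>UNIV. \<kappa>0 $ j * g x $ j) x0 \<noteq> 0"
  shows "\<exists>\<rho>>0. \<exists>c>0. \<exists>\<eta>>0. \<exists>K\<ge>0. ball x0 \<rho> \<subseteq> S \<and>
    (\<forall>\<kappa>\<in>ball \<kappa>0 \<rho>. \<forall>u z \<tau> h. (P \<longrightarrow> z = 0) \<longrightarrow> Ck_on a u S \<longrightarrow>
      Ck_bound a S (\<lambda>x. u x - (\<Sum>j\<in>UNIV. \<kappa> $ j * g x $ j) - z) \<eta> \<longrightarrow>
      0 < \<tau> \<longrightarrow> \<tau> \<le> 1 \<longrightarrow> h \<le> c * \<tau> ^ a \<longrightarrow> measure lborel {x\<in>ball x0 \<rho>. \<bar>u x\<bar> < h} \<le> K * \<tau>)"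
proof -
  have Ckg: "Ck_on a (\<lambda>x. \<Sum>j\<in>UNIV. \<kappa> $ j * g x $ j) S" for \<kappa> :: "real ^ 'n"
    by (rule Ck_on_linear_combination[where L = "\<lambda>j y. \<kappa> $ j * y"])
      (use assms in \<open>auto intro: bounded_linear_mult_right\<close>)
  \<comment> \<open>Passes from the mixed derivative in the hypothesis to a pure power of one
    directional derivative.\<close>
  have "\<exists>w p. p \<le> a \<and> (p \<noteq> 0 \<or> P) \<and> (dirD w ^^ p) (\<lambda>x. \<Sum>j\<in>UNIV. \<kappa>0 $ j * g x $ j) x0 \<noteq> 0"
  proof (rule ccontr)
    assume no: "\<not> ?thesis"
    obtain vs where vs: "vs \<in> multi a" "vs \<noteq> [] \<or> P"
      "iter_partial vs (\<lambda>x. \<Sum>j\<in>UNIV. \<kappa>0 $ j * g x $ j) x0 \<noteq> 0"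
      using nondeg by blast
    show False
    proof (cases "vs = []")
      case True
      then show ?thesis
        using vs no[simplified, rule_format, of 0 undefined] by simp
    next
      case False
      have "iter_partial vs (\<lambda>x. \<Sum>j\<in>UNIV. \<kappa>0 $ j * g x $ j) x0 = 0"
        using no vs False by (intro iter_partial_zero_of_dirD_zero[OF assms(1,2) Ckg]) auto
      then show ?thesis
        using vs by simp
    qed
  qed
  then obtain w p where p: "p \<le> a" "p \<noteq> 0 \<or> P"
    and nz: "(dirD w ^^ p) (\<lambda>x. \<Sum>j\<in>UNIV. \<kappa>0 $ j * g x $ j) x0 \<noteq> 0"
    by blast
  define G where "G = (\<lambda>(\<kappa> :: real ^ 'n, x). \<Sum>j\<in>UNIV. \<kappa> $ j * (dirD w ^^ p) (\<lambda>x. g x $ j) x)"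
  have G: "(dirD w ^^ p) (\<lambda>x. \<Sum>j\<in>UNIV. \<kappa> $ j * g x $ j) x = G (\<kappa>, x)" if "x \<in> S" for \<kappa> x
    unfolding G_def prod.case
    by (rule dirD_pow_linear_combination[where L = "\<lambda>j y. \<kappa> $ j * y"])
      (use assms that Ck_on_mono[OF assms(3) p(1)] in \<open>auto intro: bounded_linear_mult_right\<close>)
  \<comment> \<open>The derivative has modulus \<open>4 * c\<close> at the centre, more than
    \<open>2 * c\<close> on the neighbourhood, and at least \<open>c\<close> after the
    perturbation.\<close>
  define c where "c = \<bar>G (\<kappa>0, x0)\<bar> / 4"
  define \<sigma> where "\<sigma> = sgn (G (\<kappa>0, x0))"
  have G0: "G (\<kappa>0, x0) \<noteq> 0"
    using nz G[OF assms(2)] by simp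
  have c: "c > 0" and \<sigma>: "\<bar>\<sigma>\<bar> = 1" "\<sigma> * G (\<kappa>0, x0) = 4 * c"
    using G0 by (auto simp: c_def \<sigma>_def abs_sgn_eq sgn_if)
  have "continuous_on S ((dirD w ^^ p) (\<lambda>x. g x $ j))" for j
    by (rule Ck_on_continuous, rule Ck_on_dirD_pow[OF assms(1), where a = "a - p"])
      (use assms(3) p(1) in auto)
  then have "continuous_on (UNIV \<times> S) (\<lambda>y. (dirD w ^^ p) (\<lambda>x. g x $ j) (snd y))" for j
    by (rule continuous_on_compose2[OF _ continuous_on_snd[OF continuous_on_id]]) auto
  then have "continuous_on (UNIV \<times> S) G"
    unfolding G_def split_beta by (intro continuous_intros)
  then have "isCont G (\<kappa>0, x0)"
    using assms(1,2) by (subst (asm) continuous_on_eq_continuous_at) (auto intro: open_Times)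
  then obtain d where d: "d > 0" "\<And>y. dist y (\<kappa>0, x0) < d \<Longrightarrow> dist (G y) (G (\<kappa>0, x0)) < 2 * c"
    using c unfolding continuous_at_eps_delta by (metis mult_pos_pos zero_less_numeral)
  obtain R where R: "R > 0" "ball x0 R \<subseteq> S"
    using assms(1,2) by (meson openE)
  define \<rho> where "\<rho> = min R (d / 2)"
  have \<rho>: "\<rho> > 0" "ball x0 \<rho> \<subseteq> S"
    using R d by (auto simp: \<rho>_def)
  define l1 where "l1 = (\<Sum>b\<in>Basis. \<bar>w \<bullet> b\<bar>) ^ p"
  have l1: "l1 \<ge> 0"
    by (simp add: l1_def sum_nonneg)
  \<comment> \<open>\<open>l1\<close> is the factor by which \<open>dirD w ^^ p\<close> can enlarge
    a bound on the derivatives; the summand 1 avoids division by zero.\<close>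
  define \<eta> where "\<eta> = c / (l1 + 1)"
  have \<eta>: "\<eta> > 0" "l1 * \<eta> \<le> c"
    using c l1 by (auto simp: \<eta>_def field_simps)
  define K where "K = 3 ^ p * 2 * measure lborel (ball x0 (\<rho> + norm w))"
  show ?thesis
  proof (rule exI[of _ \<rho>], intro conjI \<rho>(1), rule exI[of _ c], intro conjI c,
      rule exI[of _ \<eta>], intro conjI \<eta>(1), rule exI[of _ K], intro conjI \<rho>(2) ballI allI impI)
    show "0 \<le> K"
      by (simp add: K_def)
    fix \<kappa> u z and \<tau> h :: real
    assume \<kappa>: "\<kappa> \<in> ball \<kappa>0 \<rho>" and z: "P \<longrightarrow> z = 0" and u: "Ck_on a u S"
      and bd: "Ck_bound a S (\<lambda>x. u x - (\<Sum>j\<in>UNIV. \<kappa> $ j * g x $ j) - z) \<eta>"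
      and \<tau>: "0 < \<tau>" "\<tau> \<le> 1" "h \<le> c * \<tau> ^ a"
    define v where "v = (\<lambda>x. u x - (\<Sum>j\<in>UNIV. \<kappa> $ j * g x $ j) - z)"
    have Ckv: "Ck_on a v S"
      using bd by (simp add: Ck_bound_def v_def)
    have lower: "c \<le> \<sigma> * (dirD w ^^ p) u x" if x: "x \<in> ball x0 \<rho>" for x
    proof -
      have xS: "x \<in> S"
        using x \<rho> by blast
      have "dist (\<kappa>, x) (\<kappa>0, x0) \<le> dist \<kappa> \<kappa>0 + dist x x0"
        by (simp add: dist_Pair_Pair sqrt_sum_squares_le_sum)
      also have "\<dots> < d"
        using x \<kappa> by (auto simp: \<rho>_def dist_commute)
      finally have "\<bar>G (\<kappa>, x) - G (\<kappa>0, x0)\<bar> < 2 * c"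
        using d(2) by (simp add: dist_real_def)
      then have "\<bar>\<sigma> * (G (\<kappa>, x) - G (\<kappa>0, x0))\<bar> < 2 * c"
        using \<sigma>(1) by (simp add: abs_mult)
      then have 1: "2 * c < \<sigma> * G (\<kappa>, x)"
        using \<sigma>(2) by (simp add: algebra_simps)
      have "Ck_bound 0 S ((dirD w ^^ p) v) (l1 * \<eta>)"
        unfolding l1_def
      proof (rule Ck_bound_dirD_pow[OF assms(1)])
        show "Ck_bound (p + 0) S v \<eta>"
          using bd p(1) unfolding Ck_bound_def v_def[symmetric]
          by (auto simp: multi_def intro: Ck_on_mono)
      qed
      then have "\<bar>(dirD w ^^ p) v x\<bar> \<le> c"
        using Ck_boundD[OF _ xS, of 0 "(dirD w ^^ p) v"] \<eta>(2) by force
      then have "\<bar>\<sigma> * (dirD w ^^ p) v x\<bar> \<le> c"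
        using \<sigma>(1) by (simp add: abs_mult)
      moreover have "(dirD w ^^ p) u x = (dirD w ^^ p) v x + G (\<kappa>, x)"
      proof -
        have "u = (\<lambda>x. (v x + (\<Sum>j\<in>UNIV. \<kappa> $ j * g x $ j)) + z)"
          by (auto simp: v_def)
        moreover have "(dirD w ^^ p) (\<lambda>x. (v x + (\<Sum>j\<in>UNIV. \<kappa> $ j * g x $ j)) + z) x =
            (dirD w ^^ p) (\<lambda>x. v x + (\<Sum>j\<in>UNIV. \<kappa> $ j * g x $ j)) x + (dirD w ^^ p) (\<lambda>_. z) x"
        proof (rule dirD_pow_add[OF assms(1) _ Ck_on_const xS])
          have "Ck_on a (\<lambda>x. u x - z) S"
            using Ck_on_linear_combination[of S "{True, False}" "\<lambda>_ x. x" a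
                "\<lambda>i. if i then u else (\<lambda>_. - z)"] assms(1) u Ck_on_const[of a "- z" S]
            by (simp add: bounded_linear_ident)
          then have "Ck_on p (\<lambda>x. u x - z) S"
            using p(1) Ck_on_mono by blast
          then show "Ck_on p (\<lambda>x. v x + (\<Sum>j\<in>UNIV. \<kappa> $ j * g x $ j)) S"
            by (rule Ck_on_cong[OF assms(1), rotated]) (simp add: v_def)
        qed
        moreover have "(dirD w ^^ p) (\<lambda>x. v x + (\<Sum>j\<in>UNIV. \<kappa> $ j * g x $ j)) x =
            (dirD w ^^ p) v x + (dirD w ^^ p) (\<lambda>x. \<Sum>j\<in>UNIV. \<kappa> $ j * g x $ j) x"
          by (rule dirD_pow_add[OF assms(1) Ck_on_mono[OF Ckv p(1)] Ck_on_mono[OF Ckg p(1)] xS])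
        \<comment> \<open>Either \<open>p\<close> is positive and the constant is differentiated
          away, or \<open>P\<close> holds and \<open>z\<close> is zero.\<close>
        moreover have "(dirD w ^^ p) (\<lambda>_. z) x = 0"
          using z p(2) dirD_pow_const[of p w z] by (cases "p = 0") auto
        ultimately show ?thesis
          using G[OF xS] by simp
      qed
      ultimately show ?thesis
        using 1 by (simp add: algebra_simps)
    qed
    \<comment> \<open>The order \<open>p\<close> varies with the point and the direction;
      \<open>\<tau> \<le> 1\<close> allows the common exponent \<open>a\<close> in the
      statement.\<close>
    have "h \<le> c * \<tau> ^ p"
      using \<tau> c p(1) power_decreasing[OF p(1), of \<tau>] by (smt (verit) mult_left_mono)
    then have "measure lborel {x\<in>ball x0 \<rho>. \<bar>u x\<bar> < h}
        \<le> 3 ^ p * (2 * \<tau>) * measure lborel (ball x0 (\<rho> + norm w))"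
      using sublevel_ball[OF assms(1) \<rho>(2) Ck_on_mono[OF u p(1)] \<sigma>(1) lower c \<tau>(1)] by blast
    then show "measure lborel {x\<in>ball x0 \<rho>. \<bar>u x\<bar> < h} \<le> K * \<tau>"
      by (simp add: K_def mult_ac)
  qed
qed

text \<open>Integer vectors will enter only through their unit directions. The unit sphere is
  compact, so finitely many local estimates serve all of them.\<close>

lemma uniform_sublevel:
  fixes g :: "'a::euclidean_space \<Rightarrow> real ^ 'n"
  assumes "open S" "compact C" "C \<subseteq> S" "\<And>j. Ck_on a (\<lambda>x. g x $ j) S"
    and nondeg: "\<And>x \<kappa>. x \<in> S \<Longrightarrow> \<kappa> \<noteq> 0 \<Longrightarrow>
      \<exists>vs\<in>multi a. (vs \<noteq> [] \<or> P) \<and> iter_partial vs (\<lambda>x. \<Sum>j\<in>UNIV. \<kappa> $ j * g x $ j) x \<noteq> 0"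
  shows "\<exists>c>0. \<exists>\<eta>>0. \<exists>K\<ge>0. \<forall>\<kappa> u z \<tau> h. norm \<kappa> = 1 \<longrightarrow> (P \<longrightarrow> z = 0) \<longrightarrow> Ck_on a u S \<longrightarrow>
      Ck_bound a S (\<lambda>x. u x - (\<Sum>j\<in>UNIV. \<kappa> $ j * g x $ j) - z) \<eta> \<longrightarrow>
      0 < \<tau> \<longrightarrow> \<tau> \<le> 1 \<longrightarrow> h \<le> c * \<tau> ^ a \<longrightarrow> measure lborel {x\<in>C. \<bar>u x\<bar> < h} \<le> K * \<tau>"
proof -
  define Z where "Z = C \<times> sphere (0 :: real ^ 'n) 1"
  define Q where "Q = (\<lambda>(x0, \<kappa>0) \<rho> c \<eta> K. ball x0 \<rho> \<subseteq> S \<and>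
    (\<forall>\<kappa>\<in>ball \<kappa>0 \<rho>. \<forall>u z \<tau> h. (P \<longrightarrow> z = 0) \<longrightarrow> Ck_on a u S \<longrightarrow>
      Ck_bound a S (\<lambda>x. u x - (\<Sum>j\<in>UNIV. \<kappa> $ j * g x $ j) - z) \<eta> \<longrightarrow>
      0 < \<tau> \<longrightarrow> \<tau> \<le> 1 \<longrightarrow> h \<le> c * \<tau> ^ a \<longrightarrow> measure lborel {x\<in>ball x0 \<rho>. \<bar>u x\<bar> < h} \<le> K * \<tau>))"
  have "\<forall>y\<in>Z. \<exists>\<rho>>0. \<exists>c>0. \<exists>\<eta>>0. \<exists>K\<ge>0. Q y \<rho> c \<eta> K"
  proof (clarify)
    fix x0 and \<kappa>0 :: "real ^ 'n" assume "(x0, \<kappa>0) \<in> Z"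
    then have "x0 \<in> S" "\<kappa>0 \<noteq> 0"
      using assms(3) by (auto simp: Z_def)
    then show "\<exists>\<rho>>0. \<exists>c>0. \<exists>\<eta>>0. \<exists>K\<ge>0. Q (x0, \<kappa>0) \<rho> c \<eta> K"
      using uniform_sublevel_local[where P = P and g = g and a = a and S = S and ?x0.0 = x0 and ?\<kappa>0.0 = \<kappa>0]
        assms(1,4) nondeg unfolding Q_def prod.case by blast
  qed
  then obtain \<rho> c \<eta> K where Q: "\<And>y. y \<in> Z \<Longrightarrow> \<rho> y > 0" "\<And>y. y \<in> Z \<Longrightarrow> c y > (0::real)"
      "\<And>y. y \<in> Z \<Longrightarrow> \<eta> y > (0::real)" "\<And>y. y \<in> Z \<Longrightarrow> K y \<ge> (0::real)"
      "\<And>y. y \<in> Z \<Longrightarrow> Q y (\<rho> y) (c y) (\<eta> y) (K y)"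
    by metis
  have "compact Z"
    unfolding Z_def using assms(2) by (intro compact_Times compact_sphere)
  moreover have "open (ball (fst y) (\<rho> y) \<times> ball (snd y) (\<rho> y))" for y
    by (intro open_Times open_ball)
  moreover have "Z \<subseteq> (\<Union>y\<in>Z. ball (fst y) (\<rho> y) \<times> ball (snd y) (\<rho> y))"
    using Q(1) by fastforce
  ultimately obtain F where F: "F \<subseteq> Z" "finite F" "Z \<subseteq> (\<Union>y\<in>F. ball (fst y) (\<rho> y) \<times> ball (snd y) (\<rho> y))"
    by (rule compactE_image) blast
  \<comment> \<open>The element 1 keeps the minima meaningful when the finite subcover is
    empty.\<close>
  define c0 where "c0 = Min (insert 1 (c ` F))"
  define \<eta>0 where "\<eta>0 = Min (insert 1 (\<eta> ` F))"
  have pos: "c0 > 0" "\<eta>0 > 0"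
    using F Q(2,3) by (auto simp: c0_def \<eta>0_def)
  have le: "c0 \<le> c y" "\<eta>0 \<le> \<eta> y" if "y \<in> F" for y
    using F(2) that by (auto simp: c0_def \<eta>0_def)
  show ?thesis
  proof (rule exI[of _ c0], intro conjI pos(1), rule exI[of _ \<eta>0], intro conjI pos(2),
      rule exI[of _ "sum K F"], intro conjI allI impI)
    show "0 \<le> sum K F"
      using F(1) Q(4) by (intro sum_nonneg) blast
    fix \<kappa> :: "real ^ 'n" and u z and \<tau> h :: real
    assume \<kappa>: "norm \<kappa> = 1" and z: "P \<longrightarrow> z = 0" and u: "Ck_on a u S"
      and bd: "Ck_bound a S (\<lambda>x. u x - (\<Sum>j\<in>UNIV. \<kappa> $ j * g x $ j) - z) \<eta>0"
      and \<tau>: "0 < \<tau>" "\<tau> \<le> 1" "h \<le> c0 * \<tau> ^ a"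
    \<comment> \<open>Only neighbourhoods whose direction ball contains \<open>\<kappa>\<close> give
      an estimate for this \<open>\<kappa>\<close>; their point balls already cover
      \<open>C\<close>.\<close>
    define F' where "F' = {y\<in>F. \<kappa> \<in> ball (snd y) (\<rho> y)}"
    define T where "T = (\<lambda>y. {x\<in>ball (fst y) (\<rho> y). \<bar>u x\<bar> < h})"
    have F': "finite F'" "F' \<subseteq> F"
      using F by (auto simp: F'_def)
    have bound: "measure lborel (T y) \<le> K y * \<tau>" if "y \<in> F'" for y
    proof -
      have y: "y \<in> F" "\<kappa> \<in> ball (snd y) (\<rho> y)"
        using that by (auto simp: F'_def)
      have "Q y (\<rho> y) (c y) (\<eta> y) (K y)"
        using y F(1) Q(5) by blast
      moreover have "h \<le> c y * \<tau> ^ a"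
        using \<tau> le(1)[OF y(1)] by (meson mult_right_mono order_trans zero_le_power less_imp_le)
      ultimately show ?thesis
        using z u Ck_bound_mono[OF bd le(2)[OF y(1)]] \<tau> y(2)
        unfolding Q_def T_def split_beta by blast
    qed
    have openT: "open (T y)" if "y \<in> F'" for y
    proof -
      have "ball (fst y) (\<rho> y) \<subseteq> S"
        using Q(5)[of y] that F' F(1) unfolding Q_def split_beta by blast
      then show ?thesis
        unfolding T_def using Ck_on_continuous[OF u] continuous_on_subset by (intro open_sublevel) auto
    qed
    have fin: "T y \<in> fmeasurable lborel" if "y \<in> F'" for y
    proof (rule fmeasurableI)
      have "bounded (T y)"
        by (rule bounded_subset[OF bounded_ball]) (auto simp: T_def)
      then show "emeasure lborel (T y) < \<infinity>"
        by (rule emeasure_bounded_finite)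
    qed (use openT[OF that] in simp)
    have "{x\<in>C. \<bar>u x\<bar> < h} \<subseteq> (\<Union>y\<in>F'. T y)"
    proof
      fix x assume x: "x \<in> {x\<in>C. \<bar>u x\<bar> < h}"
      then have "(x, \<kappa>) \<in> Z"
        using \<kappa> by (simp add: Z_def)
      then show "x \<in> (\<Union>y\<in>F'. T y)"
        using F(3) x by (fastforce simp: F'_def T_def)
    qed
    moreover have "{x\<in>C. \<bar>u x\<bar> < h} \<in> sets lborel"
    proof -
      have "{x\<in>C. \<bar>u x\<bar> < h} = C \<inter> {x\<in>S. \<bar>u x\<bar> < h}"
        using assms(3) by auto
      then show ?thesis
        using open_sublevel[OF assms(1) Ck_on_continuous[OF u], of h] assms(2)
        by (simp add: compact_imp_closed)
    qed
    ultimately have "measure lborel {x\<in>C. \<bar>u x\<bar> < h} \<le> measure lborel (\<Union>y\<in>F'. T y)"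
      using F' fin by (intro measure_mono_fmeasurable fmeasurable.finite_UN) auto
    also have "\<dots> \<le> (\<Sum>y\<in>F'. measure lborel (T y))"
      using F'(1) fmeasurableD[OF fin] by (intro measure_UNION_le)
    also have "\<dots> \<le> (\<Sum>y\<in>F'. K y * \<tau>)"
      by (intro sum_mono bound)
    also have "\<dots> \<le> (\<Sum>y\<in>F. K y * \<tau>)"
      using F F' Q(4) \<tau>(1) by (intro sum_mono2) auto
    finally show "measure lborel {x\<in>C. \<bar>u x\<bar> < h} \<le> sum K F * \<tau>"
      by (simp add: sum_distrib_right)
  qed
qed

subsection \<open>Lattice sums and uniform limits\<close>

lemma finite_int_vec_box: "finite {k :: int ^ 'n. \<forall>j. \<bar>k $ j\<bar> \<le> M}"
proof -
  have "{k :: int ^ 'n. \<forall>j. \<bar>k $ j\<bar> \<le> M} \<subseteq> vec_lambda ` (\<Pi>\<^sub>E j\<in>UNIV. {- M..M})"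
  proof
    fix k :: "int ^ 'n" assume "k \<in> {k. \<forall>j. \<bar>k $ j\<bar> \<le> M}"
    then have "vec_nth k \<in> (\<Pi>\<^sub>E j\<in>UNIV. {- M..M})"
      by (auto simp: abs_le_iff minus_le_iff)
    then show "k \<in> vec_lambda ` (\<Pi>\<^sub>E j\<in>UNIV. {- M..M})"
      by (metis image_eqI vec_nth_inverse)
  qed
  then show ?thesis
    by (rule finite_subset) (auto intro!: finite_imageI finite_PiE)
qed

lemma abs_component_le_norm2: "\<bar>real_of_int (k $ j)\<bar> \<le> norm2 k"
proof -
  have "(real_of_int (k $ j))\<^sup>2 \<le> (\<Sum>j\<in>UNIV. (real_of_int (k $ j))\<^sup>2)"
    by (rule member_le_sum) auto
  then show ?thesis
    unfolding norm2_def by (metis real_sqrt_abs real_sqrt_le_iff)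
qed

lemma norm2_ge_1:
  assumes "k \<noteq> 0"
  shows "1 \<le> norm2 k"
proof -
  obtain j where "k $ j \<noteq> 0"
    using assms by (auto simp: vec_eq_iff)
  then have "1 \<le> \<bar>real_of_int (k $ j)\<bar>"
    by linarith
  then show ?thesis
    using abs_component_le_norm2[of k j] by linarith
qed

lemma norm2_zero [simp]: "norm2 0 = 0"
  by (simp add: norm2_def)

lemma finite_norm2_le: "finite {k :: int ^ 'n. norm2 k \<le> B}"
proof (rule finite_subset[OF _ finite_int_vec_box[of "\<lceil>B\<rceil>"]], safe)
  fix k :: "int ^ 'n" and j assume "norm2 k \<le> B"
  then have "real_of_int \<bar>k $ j\<bar> \<le> B"
    using abs_component_le_norm2[of k j] by simp
  then show "\<bar>k $ j\<bar> \<le> \<lceil>B\<rceil>"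
    by linarith
qed

lemma finite_norm1_le: "finite {m :: int ^ 'n. norm1 m \<le> B}"
proof (rule finite_subset[OF _ finite_int_vec_box[of B]], safe)
  fix m :: "int ^ 'n" and j assume "norm1 m \<le> B"
  moreover have "\<bar>m $ j\<bar> \<le> norm1 m"
    unfolding norm1_def by (rule member_le_sum) auto
  ultimately show "\<bar>m $ j\<bar> \<le> B"
    by linarith
qed

text \<open>Comparison with the product \<open>\<Prod>\<^sub>j max 1 |k\<^sub>j|\<close> to the power \<open>-s/n\<close>, whose sum factorises.\<close>

lemma lattice_sum_bounded:
  assumes "s > real CARD('n)"
  shows "\<exists>B\<ge>0. \<forall>F. finite F \<and> (0 :: int ^ 'n) \<notin> F \<longrightarrow> (\<Sum>k\<in>F. norm2 k powr (- s)) \<le> B"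
proof -
  define n where "n = real CARD('n)"
  define \<sigma> where "\<sigma> = s / n"
  have n: "n > 0"
    by (simp add: n_def)
  have \<sigma>: "\<sigma> > 1"
    using assms n by (simp add: \<sigma>_def n_def)
  define f where "f = (\<lambda>i::nat. max 1 (real i) powr (- \<sigma>))"
  define b where "b = (\<lambda>i::int. max 1 \<bar>real_of_int i\<bar> powr (- \<sigma>))"
  have "summable (\<lambda>i. real i powr (- \<sigma>))"
    using \<sigma> by (simp add: summable_real_powr_iff)
  moreover have "\<forall>\<^sub>F i in sequentially. f i = real i powr (- \<sigma>)"
    using eventually_ge_at_top[of 1] by eventually_elim (simp add: f_def max_def)
  ultimately have "summable f"
    by (simp add: summable_cong)
  then have f: "(\<Sum>i\<le>M. f i) \<le> suminf f" for M
    by (intro sum_le_suminf) (auto simp: f_def)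
  have f0: "suminf f \<ge> 0"
    using \<open>summable f\<close> by (intro suminf_nonneg) (auto simp: f_def)
  have b: "(\<Sum>i\<in>{- int M..int M}. b i) \<le> 2 * suminf f" for M
  proof -
    \<comment> \<open>Zero is counted in both halves, which only enlarges the bound.\<close>
    have "{- int M..int M} \<subseteq> int ` {..M} \<union> (\<lambda>i. - int i) ` {..M}"
    proof
      fix i assume i: "i \<in> {- int M..int M}"
      show "i \<in> int ` {..M} \<union> (\<lambda>i. - int i) ` {..M}"
      proof (cases "0 \<le> i")
        case True
        then have "i = int (nat i)" "nat i \<in> {..M}"
          using i by auto
        then show ?thesis
          by blast
      next
        case False
        then have "i = - int (nat (- i))" "nat (- i) \<in> {..M}"
          using i by auto
        then show ?thesis
          by blast
      qed
    qed
    then have "(\<Sum>i\<in>{- int M..int M}. b i) \<le> (\<Sum>i\<in>int ` {..M} \<union> (\<lambda>i. - int i) ` {..M}. b i)"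
      by (intro sum_mono2) (auto simp: b_def)
    also have "\<dots> \<le> (\<Sum>i\<in>int ` {..M}. b i) + (\<Sum>i\<in>(\<lambda>i. - int i) ` {..M}. b i)"
      by (subst sum_Un) (auto simp: b_def intro!: sum_nonneg)
    also have "\<dots> = (\<Sum>i\<le>M. f i) + (\<Sum>i\<le>M. f i)"
      by (simp add: sum.reindex inj_on_def b_def f_def)
    also have "\<dots> \<le> 2 * suminf f"
      using f[of M] by simp
    finally show ?thesis .
  qed
  have "(\<Sum>k\<in>F. norm2 k powr (- s)) \<le> (2 * suminf f) ^ CARD('n)"
    if F: "finite F" "(0 :: int ^ 'n) \<notin> F" for F
  proof -
    define P :: "('n \<Rightarrow> int) \<Rightarrow> real" where "P = (\<lambda>g. \<Prod>j\<in>UNIV. b (g j))"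
    \<comment> \<open>As \<open>k\<close> is nonzero, \<open>max 1 \<bar>k $ j\<bar>\<close> is at
      most \<open>norm2 k\<close> for every \<open>j\<close>, and the exponent is negative.\<close>
    have kP: "norm2 k powr (- s) \<le> P (vec_nth k)" if "k \<in> F" for k
    proof -
      have k: "1 \<le> norm2 k"
        using that F norm2_ge_1 by metis
      have "norm2 k powr (- s) = (norm2 k powr (- \<sigma>)) ^ CARD('n)"
        using k n by (simp add: powr_realpow[symmetric] powr_powr \<sigma>_def n_def)
      also have "\<dots> = (\<Prod>j\<in>(UNIV :: 'n set). norm2 k powr (- \<sigma>))"
        by simp
      also have "\<dots> \<le> P (vec_nth k)"
        unfolding P_def b_def using k \<sigma> abs_component_le_norm2[of k]
        by (intro prod_mono conjI powr_mono2') auto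
      finally show ?thesis .
    qed
    have "finite (\<Union>k\<in>F. range (\<lambda>j. nat \<bar>k $ j\<bar>))"
      using F(1) by auto
    then obtain M where "\<forall>i\<in>\<Union>k\<in>F. range (\<lambda>j. nat \<bar>k $ j\<bar>). i \<le> M"
      unfolding finite_nat_set_iff_bounded_le by blast
    then have M: "nat \<bar>k $ j\<bar> \<le> M" if "k \<in> F" for k j
      using that by blast
    have sub: "vec_nth ` F \<subseteq> (\<Pi>\<^sub>E j\<in>UNIV. {- int M..int M})"
    proof
      fix g assume "g \<in> vec_nth ` F"
      then obtain k where k: "k \<in> F" "g = vec_nth k"
        by blast
      have "k $ j \<in> {- int M..int M}" for j
        using M[OF k(1), of j] by auto
      then show "g \<in> (\<Pi>\<^sub>E j\<in>UNIV. {- int M..int M})"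
        by (simp add: k(2) PiE_def)
    qed
    have "(\<Sum>k\<in>F. norm2 k powr (- s)) \<le> (\<Sum>k\<in>F. P (vec_nth k))"
      by (intro sum_mono kP)
    also have "\<dots> = (\<Sum>g\<in>vec_nth ` F. P g)"
      by (simp add: sum.reindex inj_on_def vec_nth_inject)
    also have "\<dots> \<le> (\<Sum>g\<in>(\<Pi>\<^sub>E j\<in>UNIV. {- int M..int M}). P g)"
      using sub by (intro sum_mono2) (auto simp: P_def b_def intro!: finite_PiE prod_nonneg)
    also have "\<dots> = (\<Prod>j\<in>(UNIV :: 'n set). \<Sum>i\<in>{- int M..int M}. b i)"
      unfolding P_def by (subst prod_sum_PiE) auto
    also have "\<dots> \<le> (\<Prod>j\<in>(UNIV :: 'n set). 2 * suminf f)"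
      by (intro prod_mono conjI b sum_nonneg) (auto simp: b_def)
    finally show ?thesis
      by simp
  qed
  moreover have "0 \<le> (2 * suminf f) ^ CARD('n)"
    using f0 by simp
  ultimately show ?thesis
    by blast
qed

lemma Kcut_zero [simp]: "Kcut n a l r 0 = 0"
  by (simp add: Kcut_def)

text \<open>Monotone cutoffs make the shells of integer vectors disjoint. The bracket in
  \<open>Kcut\<close> is nonnegative because \<open>a \<le> l\<close> and because e^n \<le> 24 n!
  n^n makes the logarithm of the last constant nonnegative.\<close>

lemma Kcut_mono:
  assumes "0 < r" "real a \<le> l" "1 \<le> n"
  shows "Kcut n a l r \<nu> \<le> Kcut n a l r (Suc \<nu>)"
proof -
  have "exp (real n) \<le> 24 * fact n * real n ^ n"
  proof -
    have e3: "exp (real n) \<le> 3 ^ n"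
      using power_mono[OF exp_le, of n] by (simp add: exp_of_nat_mult[symmetric])
    \<comment> \<open>From \<open>n = 3\<close> on, e^n \<le> 3^n \<le> n^n; the factor 24 settles
      the two smaller cases.\<close>
    consider "n = 1" | "n = 2" | "3 \<le> n"
      using assms(3) by linarith
    then show ?thesis
    proof cases
      case 3
      have "(3::real) ^ n \<le> real n ^ n"
        using 3 by (intro power_mono) auto
      also have "\<dots> \<le> 24 * fact n * real n ^ n"
      proof -
        have "1 \<le> 24 * (fact n :: real)"
          using fact_ge_1[of n, where 'a = real] by linarith
        from mult_right_mono[OF this, of "real n ^ n"] show ?thesis
          by simp
      qed
      finally show ?thesis
        using e3 by linarith
    qed (use e3 in \<open>auto simp: fact_numeral\<close>)
  qed
  then have "1 \<le> 24 * fact n * real n ^ n * exp (- real n)"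
    by (simp add: exp_minus field_simps)
  then have ln0: "0 \<le> ln (24 * fact n * real n ^ n * exp (- real n))"
    by (rule ln_ge_zero)
  define x where "x = (\<lambda>\<nu>. (1 / r) * 3 ^ (\<nu> + 1) *
     ((l + (real n + 1) * (real \<nu> + 1) - real a) * ln 3 + (real n + 1) * \<bar>ln r\<bar>
      + ln (24 * fact n * real n ^ n * exp (- real n))))"
  have inner: "0 \<le> (l + (real n + 1) * (real \<nu> + 1) - real a) * ln 3 + (real n + 1) * \<bar>ln r\<bar>
      + ln (24 * fact n * real n ^ n * exp (- real n))" for \<nu>
  proof -
    have "0 \<le> (real n + 1) * (real \<nu> + 1)"
      by simp
    then have "0 \<le> l + (real n + 1) * (real \<nu> + 1) - real a"
      using assms(2) by linarith
    then show ?thesis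
      using ln0 by (intro add_nonneg_nonneg mult_nonneg_nonneg) auto
  qed
  have x0: "0 \<le> x \<nu>" for \<nu>
    unfolding x_def using inner[of \<nu>] assms(1) by (intro mult_nonneg_nonneg) auto
  have "x \<nu> \<le> x (Suc \<nu>)"
    unfolding x_def using inner assms(1)
    by (intro mult_mono add_mono mult_left_mono mult_right_mono diff_mono power_increasing) auto
  then have "\<lfloor>x \<nu>\<rfloor> \<le> \<lfloor>x (Suc \<nu>)\<rfloor>"
    by (rule floor_mono)
  moreover have "0 \<le> \<lfloor>x (Suc \<nu>)\<rfloor>"
    using x0 by simp
  moreover have "Kcut n a l r \<nu> = (if \<nu> = 0 then 0 else real_of_int \<lfloor>x \<nu>\<rfloor> + 1)" for \<nu>
    by (simp only: Kcut_def x_def)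
  ultimately show ?thesis
    by (cases \<nu>) auto
qed

section \<open>Lipschitz bounds and uniform convergence\<close>

text \<open>The derivative is a sum of \<open>DIM('a)\<close> terms bounded by \<open>M\<close>, and
  convexity turns its bound into a Lipschitz constant. For the eigenvalues this gives equicontinuity
  uniformly in \<epsilon>.\<close>

lemma Ck_bound_Lipschitz:
  fixes f :: "'a::euclidean_space \<Rightarrow> 'b::real_normed_vector"
  assumes "open S" "convex S" "Ck_bound a S f M" "0 < a" "x \<in> S" "y \<in> S"
  shows "norm (f x - f y) \<le> real DIM('a) * M * norm (x - y)"
proof (rule differentiable_bound[OF assms(2) _ _ assms(5,6)])
  fix z assume z: "z \<in> S"
  have Ck: "Ck_on (Suc 0) f S"
    using assms(3,4) Ck_on_mono by (fastforce simp: Ck_bound_def)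
  show "(f has_derivative (\<lambda>h. \<Sum>b\<in>Basis. (h \<bullet> b) *\<^sub>R partial b f z)) (at z within S)"
    by (rule has_derivative_at_withinI, rule has_derivative_of_partials[OF assms(1) Ck z])
  show "onorm (\<lambda>h. \<Sum>b\<in>Basis. (h \<bullet> b) *\<^sub>R partial b f z) \<le> real DIM('a) * M"
  proof (rule onorm_le)
    fix h :: 'a
    have "norm (\<Sum>b\<in>Basis. (h \<bullet> b) *\<^sub>R partial b f z) \<le> (\<Sum>b\<in>(Basis :: 'a set). norm h * M)"
    proof (rule sum_norm_le)
      fix b :: 'a assume b: "b \<in> Basis"
      obtain a' where "a = Suc a'"
        using assms(4) by (cases a) auto
      then have "norm (partial b f z) \<le> M"
        using Ck_boundD[OF Ck_bound_partial[of a' S f M b] z] assms(3) b by blast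
      then show "norm ((h \<bullet> b) *\<^sub>R partial b f z) \<le> norm h * M"
        using Basis_le_norm[OF b, of h] by (simp add: mult_mono)
    qed
    then show "norm (\<Sum>b\<in>Basis. (h \<bullet> b) *\<^sub>R partial b f z) \<le> real DIM('a) * M * norm h"
      by (simp add: mult_ac)
  qed
qed

text \<open>The limit inherits the Lipschitz constant, so convergence at the points of a finite net
  controls all of \<open>C\<close>.\<close>

lemma uniform_limit_of_Lipschitz:
  fixes F :: "real \<Rightarrow> 'a::metric_space \<Rightarrow> 'b::real_normed_vector"
  assumes "compact C" "0 \<le> L"
    and Lip: "\<forall>\<^sub>F e in at_right 0. \<forall>x\<in>C. \<forall>y\<in>C. norm (F e x - F e y) \<le> L * dist x y"
    and lim: "\<And>x. x \<in> C \<Longrightarrow> ((\<lambda>e. F e x) \<longlongrightarrow> F0 x) (at_right 0)"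
  shows "continuous_on C F0"
    and "0 < \<delta> \<Longrightarrow> \<forall>\<^sub>F e in at_right 0. \<forall>x\<in>C. norm (F e x - F0 x) \<le> \<delta>"
proof -
  have Lip0: "norm (F0 x - F0 y) \<le> L * dist x y" if "x \<in> C" "y \<in> C" for x y
  proof (rule tendsto_upperbound)
    show "((\<lambda>e. norm (F e x - F e y)) \<longlongrightarrow> norm (F0 x - F0 y)) (at_right 0)"
      using lim that by (intro tendsto_intros)
    show "\<forall>\<^sub>F e in at_right 0. norm (F e x - F e y) \<le> L * dist x y"
      using Lip by eventually_elim (use that in auto)
  qed simp
  have "L-lipschitz_on C F0"
    using Lip0 assms(2) by (auto simp: lipschitz_on_def dist_norm)
  then show "continuous_on C F0"
    by (rule lipschitz_on_continuous_on)
  assume \<delta>: "0 < \<delta>"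
  \<comment> \<open>Moving to a net point costs at most a third of \<open>\<delta>\<close>;
    \<open>L + 1\<close> in place of \<open>L\<close> covers \<open>L = 0\<close>.\<close>
  define \<rho> where "\<rho> = \<delta> / (3 * (L + 1))"
  have \<rho>: "\<rho> > 0" "L * \<rho> \<le> \<delta> / 3"
    using \<delta> assms(2) by (auto simp: \<rho>_def field_simps)
  have "C \<subseteq> (\<Union>x\<in>C. ball x \<rho>)"
    using \<rho>(1) by auto
  then obtain Z where Z: "Z \<subseteq> C" "finite Z" "C \<subseteq> (\<Union>x\<in>Z. ball x \<rho>)"
    using compactE_image[OF assms(1), of C "\<lambda>x. ball x \<rho>"] by auto
  have "\<forall>\<^sub>F e in at_right 0. \<forall>z\<in>Z. dist (F e z) (F0 z) < \<delta> / 3"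
    using Z \<delta> lim by (intro eventually_ball_finite ballI tendstoD) auto
  then show "\<forall>\<^sub>F e in at_right 0. \<forall>x\<in>C. norm (F e x - F0 x) \<le> \<delta>"
    using Lip
  proof eventually_elim
    case (elim e)
    show ?case
    proof
      fix x assume x: "x \<in> C"
      then obtain z where z: "z \<in> Z" "dist z x < \<rho>"
        using Z(3) by auto
      have "L * dist x z \<le> \<delta> / 3"
        using \<rho>(2) z(2) assms(2) mult_left_mono[of "dist x z" \<rho> L] by (simp add: dist_commute)
      then have 1: "norm (F e x - F e z) \<le> \<delta> / 3" "norm (F0 z - F0 x) \<le> \<delta> / 3"
        using elim(2) Lip0[of z x] x z Z(1) by (force simp: dist_commute)+
      have 2: "norm (F e z - F0 z) \<le> \<delta> / 3"
        using elim(1) z(1) by (force simp: dist_norm)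
      have "F e x - F0 x = (F e x - F e z) + (F e z - F0 z) + (F0 z - F0 x)"
        by simp
      then show "norm (F e x - F0 x) \<le> \<delta>"
        using norm_triangle_mono[OF norm_triangle_mono[OF 1(1) 2] 1(2)] by simp
    qed
  qed
qed

subsection \<open>Small divisors\<close>

lemma eventually_powr_small:
  fixes M :: real
  assumes "0 < p" "0 < \<delta>"
  shows "\<forall>\<^sub>F e in at_right 0. M * e powr p \<le> \<delta>"
proof -
  have "((\<lambda>e::real. e powr p) \<longlongrightarrow> 0) (at_right 0)"
    using assms by (intro tendsto_zero_powrI[where b = p] tendsto_const tendsto_ident_at)
      (auto simp: eventually_at_filter)
  then have "((\<lambda>e. M * e powr p) \<longlongrightarrow> M * 0) (at_right 0)"
    by (intro tendsto_intros)
  then have "\<forall>\<^sub>F e in at_right 0. M * e powr p < \<delta>"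
    using assms(2) by (intro order_tendstoD(2)) auto
  then show ?thesis
    by eventually_elim simp
qed

lemma eventually_in_unit: "0 < b \<Longrightarrow> \<forall>\<^sub>F e::real in at_right 0. 0 < e \<and> e \<le> 1 \<and> e \<le> b"
  unfolding eventually_at_right_field by (intro exI[of _ "min 1 b"]) auto

lemma Im_pairing: "Im (pairing k m w v) =
    (\<Sum>j\<in>UNIV. of_int (k $ j) * w $ j) + (\<Sum>i\<in>UNIV. of_int (m $ i) * Im (v $ i))"
  by (simp add: pairing_def)

lemma pairing_divide:
  "pairing k m w v / complex_of_real E = pairing k m ((1 / E) *\<^sub>R w) (\<chi> i. v $ i / complex_of_real E)"
  by (simp add: pairing_def add_divide_distrib sum_divide_distrib sum_distrib_left mult.assoc)

lemma pairing_diff: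
  "pairing k m w v - pairing k m w' v' = pairing k m (w - w') (v - v')"
  by (simp add: pairing_def algebra_simps sum_subtractf)

lemma pairing_uminus: "pairing (- k) (- m) w v = - pairing k m w v"
  by (simp add: pairing_def sum_negf)

lemma cmod_pairing_le:
  assumes "\<And>j. \<bar>w $ j\<bar> \<le> \<delta>" "\<And>i. cmod (v $ i) \<le> \<delta>"
  shows "cmod (pairing k m w v) \<le> real_of_int (norm1 k + norm1 m) * \<delta>"
proof -
  have "cmod (pairing k m w v) \<le> \<bar>\<Sum>j\<in>UNIV. of_int (k $ j) * w $ j\<bar> + cmod (\<Sum>i\<in>UNIV. of_int (m $ i) * v $ i)"
    unfolding pairing_def by (rule order_trans[OF norm_triangle_ineq]) (simp add: norm_mult del: of_real_sum)
  also have "\<dots> \<le> (\<Sum>j\<in>UNIV. \<bar>real_of_int (k $ j)\<bar> * \<delta>) + (\<Sum>i\<in>UNIV. \<bar>real_of_int (m $ i)\<bar> * \<delta>)"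
    using assms by (intro add_mono order_trans[OF sum_abs] sum_norm_le sum_mono)
      (auto simp: abs_mult norm_mult intro!: mult_left_mono)
  also have "\<dots> = real_of_int (norm1 k + norm1 m) * \<delta>"
    by (simp add: norm1_def sum_distrib_right distrib_right)
  finally show ?thesis .
qed

text \<open>The functions \<open>w\<close>, \<open>v\<close> stand for \<open>\<omega>\<^sup>\<nu> - \<omega>\<close>, \<open>\<Lambda>\<^sup>\<nu> - \<Lambda>\<close>, extended from \<open>\<Pi>\<^sub>\<nu>\<close> to \<open>\<Pi>\<close>.\<close>

definition perturbation ::
  "(nat \<Rightarrow> real) \<Rightarrow> nat \<Rightarrow> 'n1::finite set \<Rightarrow> 'n2::finite set \<Rightarrow> (real ^ 'n3) set \<Rightarrow> real \<Rightarrow> real \<Rightarrow>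
   (real ^ 'n3 \<Rightarrow> real ^ 'n2) \<Rightarrow> (real ^ 'n3 \<Rightarrow> complex ^ 'n1) \<Rightarrow> bool" where
  "perturbation q a J N Par c e w v \<longleftrightarrow>
     (\<forall>j\<in>N. Ck_bound a Par (\<lambda>\<xi>. w \<xi> $ j) (c * e powr q 6)) \<and>
     (\<forall>j\<in>- N. Ck_bound a Par (\<lambda>\<xi>. w \<xi> $ j) (c * e powr q 7)) \<and>
     (\<forall>i\<in>J. Ck_bound a Par (\<lambda>\<xi>. v \<xi> $ i) (c * e powr q 2)) \<and>
     (\<forall>i\<in>- J. Ck_bound a Par (\<lambda>\<xi>. v \<xi> $ i) (c * e powr q 4))"

section \<open>Deviation of frequencies and divisors from the limiting data\<close>

text \<open>Divided by \<epsilon>^q5, the perturbation is of order \<epsilon>^q6 for indices in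
  \<open>N\<close> and of order \<epsilon>^(q7 - q5) for the others; (H1) makes both at most
  \<epsilon>^q2. The possibly unbounded term with \<open>om20\<close> is constant in \<xi> and is
  subtracted instead of estimated.\<close>

lemma freq_deviation:
  assumes "open Par" "H1 q" "limiting_data q a J N Par lam om om20 om21" "0 \<le> c" "0 < \<delta>"
  shows "\<forall>\<^sub>F e in at_right 0. \<forall>w v. perturbation q a J N Par c e w v \<longrightarrow>
    (\<forall>j. Ck_bound a Par (\<lambda>\<xi>. scale_freq q N e (om \<xi> e + w \<xi>) $ j / e powr q 5
       - om_tilde N om om21 \<xi> $ j - om_tilde0 N om20 $ j / e powr q 5) \<delta>)"
proof -
  have q: "0 < q 2" "q 2 \<le> q 6" "q 2 + q 5 \<le> q 7"
    using assms(2) by (auto simp: H1_def)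
  have "\<forall>\<^sub>F e in at_right 0. \<forall>j\<in>N. Ck_bound a Par (\<lambda>\<xi>. om \<xi> e $ j - om \<xi> 0 $ j) (\<delta> / 2)"
    using assms(3,5) by (intro eventually_ball_finite) (auto simp: limiting_data_def)
  moreover have "\<forall>\<^sub>F e in at_right 0. \<forall>j\<in>- N.
      Ck_bound a Par (\<lambda>\<xi>. om \<xi> e $ j - om20 $ j - e powr q 5 * om21 \<xi> $ j) (\<delta> / 2 * e powr q 5)"
  proof (intro eventually_ball_finite ballI)
    fix j assume j: "j \<in> - N"
    have "\<forall>j\<in>- N. \<forall>\<delta>>0. \<forall>\<^sub>F e in at_right 0.
        Ck_bound a Par (\<lambda>\<xi>. om \<xi> e $ j - om20 $ j - e powr q 5 * om21 \<xi> $ j) (\<delta> * e powr q 5)"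
      using assms(3) unfolding limiting_data_def by blast
    from this[rule_format, OF j half_gt_zero[OF assms(5)]]
    show "\<forall>\<^sub>F e in at_right 0.
        Ck_bound a Par (\<lambda>\<xi>. om \<xi> e $ j - om20 $ j - e powr q 5 * om21 \<xi> $ j) (\<delta> / 2 * e powr q 5)" .
  qed simp
  moreover have "\<forall>\<^sub>F e in at_right 0. c * e powr q 2 \<le> \<delta> / 2"
    using q assms(5) by (intro eventually_powr_small) auto
  moreover note eventually_in_unit[OF zero_less_one]
  ultimately show ?thesis
  proof eventually_elim
    case (elim e)
    then have e: "0 < e" "e \<le> 1"
      by auto
    show ?case
    proof (intro allI impI)
      fix w v j assume "perturbation q a J N Par c e w v"
      then have w: "j \<in> N \<Longrightarrow> Ck_bound a Par (\<lambda>\<xi>. w \<xi> $ j) (c * e powr q 6)"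
        "j \<notin> N \<Longrightarrow> Ck_bound a Par (\<lambda>\<xi>. w \<xi> $ j) (c * e powr q 7)"
        by (auto simp: perturbation_def)
      show "Ck_bound a Par (\<lambda>\<xi>. scale_freq q N e (om \<xi> e + w \<xi>) $ j / e powr q 5
         - om_tilde N om om21 \<xi> $ j - om_tilde0 N om20 $ j / e powr q 5) \<delta>"
      proof (cases "j \<in> N")
        case True
        have "c * e powr q 6 \<le> c * e powr q 2"
          using e q assms(4) by (intro mult_left_mono powr_mono') auto
        then have "\<delta> / 2 + c * e powr q 6 \<le> \<delta>"
          using elim by linarith
        moreover have "Ck_bound a Par (\<lambda>\<xi>. (om \<xi> e $ j - om \<xi> 0 $ j) + w \<xi> $ j) (\<delta> / 2 + c * e powr q 6)"
          using elim w True by (intro Ck_bound_add[OF assms(1)]) auto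
        ultimately have "Ck_bound a Par (\<lambda>\<xi>. (om \<xi> e $ j - om \<xi> 0 $ j) + w \<xi> $ j) \<delta>"
          by (rule Ck_bound_mono[rotated])
        then show ?thesis
          by (rule Ck_bound_cong[OF assms(1), rotated])
            (use True e in \<open>simp add: scale_freq_def om_tilde_def om_tilde0_def\<close>)
      next
        case False
        have E: "e powr q 5 > 0"
          using e by simp
        have "e powr q 7 / e powr q 5 = e powr (q 7 - q 5)"
          by (simp add: powr_diff)
        also have "\<dots> \<le> e powr q 2"
          using e q by (intro powr_mono') auto
        finally have "c * (e powr q 7 / e powr q 5) \<le> c * e powr q 2"
          using assms(4) by (intro mult_left_mono)
        then have "\<bar>1 / e powr q 5\<bar> * (\<delta> / 2 * e powr q 5) + \<bar>1 / e powr q 5\<bar> * (c * e powr q 7) \<le> \<delta>"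
          using elim E by simp
        moreover have "Ck_bound a Par (\<lambda>\<xi>. 1 / e powr q 5 * (om \<xi> e $ j - om20 $ j - e powr q 5 * om21 \<xi> $ j)
            + 1 / e powr q 5 * w \<xi> $ j)
          (\<bar>1 / e powr q 5\<bar> * (\<delta> / 2 * e powr q 5) + \<bar>1 / e powr q 5\<bar> * (c * e powr q 7))"
          using elim w False by (intro Ck_bound_add[OF assms(1)] Ck_bound_scale[OF assms(1)]) auto
        ultimately have "Ck_bound a Par (\<lambda>\<xi>. 1 / e powr q 5 * (om \<xi> e $ j - om20 $ j - e powr q 5 * om21 \<xi> $ j)
            + 1 / e powr q 5 * w \<xi> $ j) \<delta>"
          by (rule Ck_bound_mono[rotated])
        then show ?thesis
          by (rule Ck_bound_cong[OF assms(1), rotated])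
            (use False E in \<open>simp add: scale_freq_def om_tilde_def om_tilde0_def field_simps\<close>)
      qed
    qed
  qed
qed

lemma Ck_bound_eig:
  assumes "open Par" "H1 q" "H2 q a J N Par estar c0 c1 A B lam om" "0 \<le> c"
    and "0 < e" "e \<le> 1" "e \<le> estar" "perturbation q a J N Par c e w v"
  shows "Ck_bound a Par (\<lambda>\<xi>. lam \<xi> e $ i + v \<xi> $ i) (c1 + c)"
proof -
  have "Ck_bound a Par (\<lambda>\<xi>. lam \<xi> e $ i) c1"
    using assms(3,5,7) by (auto simp: H2_def)
  moreover have "Ck_bound a Par (\<lambda>\<xi>. v \<xi> $ i) c"
  proof -
    have "0 \<le> q 2" "0 \<le> q 4"
      using assms(2) by (auto simp: H1_def)
    then have "e powr q 2 \<le> 1" "e powr q 4 \<le> 1"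
      using assms(5,6) by (auto intro: powr_le1)
    then have "c * e powr q 2 \<le> c" "c * e powr q 4 \<le> c"
      using assms(4) by (auto intro: mult_left_le)
    then show ?thesis
      using assms(8) Ck_bound_mono unfolding perturbation_def by (cases "i \<in> J") blast+
  qed
  ultimately show ?thesis
    by (rule Ck_bound_add[OF assms(1)])
qed

text \<open>After division, the eigenvalue of index \<open>i\<close> carries the factor t_i / |k|,
  where t_i is \<epsilon>^(q1 - q5) or \<epsilon>^(q3 - q5). This is small if |k| is large or if the
  exponent of \<epsilon> is positive, as it always is for \<open>i\<close> in \<open>J\<close>. Each
  of the three alternatives ensures smallness for every \<open>i\<close> with
  \<open>m $ i \<noteq> 0\<close>.\<close>

lemma divisor_deviation:
  fixes lam :: "real ^ 'n3 \<Rightarrow> real \<Rightarrow> complex ^ 'n1" and om :: "real ^ 'n3 \<Rightarrow> real \<Rightarrow> real ^ 'n2"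
  assumes "open Par" "H1 q" "H2 q a J N Par estar c0 c1 A B lam om"
    and "limiting_data q a J N Par lam om om20 om21" "0 \<le> c" "0 < \<eta>"
  shows "\<forall>\<^sub>F e in at_right 0. \<forall>w v k m. perturbation q a J N Par c e w v \<longrightarrow> k \<noteq> 0 \<longrightarrow>
    norm1 m \<le> 2 \<longrightarrow> 4 * (c1 + c) / \<eta> \<le> norm2 k \<or> q 5 < q 3 \<or> (\<forall>i\<in>- J. m $ i = 0) \<longrightarrow>
    (\<exists>z. (N = UNIV \<longrightarrow> z = 0) \<and>
      Ck_bound a Par (\<lambda>\<xi>. Im (pairing k m (scale_freq q N e (om \<xi> e + w \<xi>)) (scale_eig q J e (lam \<xi> e + v \<xi>)))
          / (e powr q 5 * norm2 k)
        - (\<Sum>j\<in>UNIV. (\<chi> j. of_int (k $ j) / norm2 k) $ j * om_tilde N om om21 \<xi> $ j) - z) \<eta>)"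
proof -
  have q: "q 5 < q 1" "q 5 \<le> q 3"
    using assms(2) by (auto simp: H1_def)
  have c1: "0 < c1" "0 < estar"
    using assms(3) by (auto simp: H2_def)
  \<comment> \<open>Target for t_i / |k|: since |m|_1 \<le> 2 and the eigenvalues are bounded by
    \<open>c1 + c\<close>, the eigenvalue part is then at most half of \<open>\<eta>\<close>. The
    inverse of \<open>\<beta>\<close> is the lower bound for |k| in the statement.\<close>
  define \<beta> where "\<beta> = \<eta> / (4 * (c1 + c))"
  have \<beta>: "0 < \<beta>" "2 * \<beta> * (c1 + c) = \<eta> / 2"
    using c1 assms(5,6) by (auto simp: \<beta>_def field_simps)
  \<comment> \<open>The coefficients \<open>k $ j / norm2 k\<close> have modulus at most 1, so the
    \<open>CARD('n2)\<close> frequency terms contribute the other half.\<close>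
  define \<delta> where "\<delta> = \<eta> / (2 * real CARD('n2))"
  have \<delta>: "0 < \<delta>" "real CARD('n2) * \<delta> = \<eta> / 2"
    using assms(6) by (auto simp: \<delta>_def)
  have "\<forall>\<^sub>F e in at_right 0. 1 * e powr (q 1 - q 5) \<le> \<beta>"
    using q \<beta> by (intro eventually_powr_small) auto
  moreover have "\<forall>\<^sub>F e in at_right 0. q 5 < q 3 \<longrightarrow> 1 * e powr (q 3 - q 5) \<le> \<beta>"
    using \<beta> by (cases "q 5 < q 3") (auto intro: eventually_powr_small[where M = 1, simplified])
  moreover note freq_deviation[OF assms(1,2,4,5) \<delta>(1)] eventually_in_unit[OF c1(2)]
  ultimately show ?thesis
  proof eventually_elim
    case (elim e)
    then have e: "0 < e" "e \<le> 1" "e \<le> estar"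
      by auto
    show ?case
    proof (intro allI impI)
      fix w v and k :: "int ^ 'n2" and m :: "int ^ 'n1"
      assume pert: "perturbation q a J N Par c e w v" and k: "k \<noteq> 0" and m: "norm1 m \<le> 2"
        and good: "4 * (c1 + c) / \<eta> \<le> norm2 k \<or> q 5 < q 3 \<or> (\<forall>i\<in>- J. m $ i = 0)"
      have k1: "1 \<le> norm2 k"
        using norm2_ge_1[OF k] .
      define E where "E = e powr q 5"
      have E: "E > 0"
        using e by (simp add: E_def)
      define t where "t = (\<lambda>i. if i \<in> J then e powr (q 1 - q 5) else e powr (q 3 - q 5))"
      define W where "W = (\<lambda>\<xi>. scale_freq q N e (om \<xi> e + w \<xi>))"
      define V where "V = (\<lambda>\<xi>. scale_eig q J e (lam \<xi> e + v \<xi>))"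
      define D where "D = (\<lambda>\<xi> j. W \<xi> $ j / E - om_tilde N om om21 \<xi> $ j - om_tilde0 N om20 $ j / E)"
      \<comment> \<open>Independent of \<xi>, and zero for \<open>N = UNIV\<close>, where
        \<open>om_tilde0\<close> vanishes.\<close>
      define z where "z = (\<Sum>j\<in>UNIV. of_int (k $ j) / norm2 k * (om_tilde0 N om20 $ j / E))"
      have t0: "0 \<le> t i" for i
        by (simp add: t_def)
      have t: "t i / norm2 k \<le> \<beta>" if "m $ i \<noteq> 0" for i
      proof (cases "4 * (c1 + c) / \<eta> \<le> norm2 k")
        case True
        have "t i \<le> 1"
          using e q by (auto simp: t_def intro: powr_le1)
        then have "t i / norm2 k \<le> 1 / norm2 k"
          using k1 by (simp add: divide_right_mono)
        also have "\<dots> \<le> \<beta>"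
          using True c1(1) assms(5,6) k1 by (simp add: \<beta>_def field_simps)
        finally show ?thesis .
      next
        case False
        then have "t i \<le> \<beta>"
          using elim good that by (auto simp: t_def)
        moreover have "t i / norm2 k \<le> t i"
          using k1 t0[of i] by (simp add: divide_le_eq mult_left_mono[of 1, simplified] mult_le_cancel_left1)
        ultimately show ?thesis
          by linarith
      qed
      have DC: "Ck_bound a Par (\<lambda>\<xi>. \<Sum>j\<in>UNIV. of_int (k $ j) / norm2 k * D \<xi> j)
          (\<Sum>j\<in>UNIV. \<bar>of_int (k $ j) / norm2 k\<bar> * \<delta>)"
        using elim pert unfolding D_def W_def E_def
        by (intro Ck_bound_sum[OF assms(1)] Ck_bound_scale[OF assms(1)]) auto
      have VC: "Ck_bound a Par (\<lambda>\<xi>. \<Sum>i\<in>UNIV. of_int (m $ i) / norm2 k * (Im (V \<xi> $ i) / E))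
          (\<Sum>i\<in>UNIV. \<bar>of_int (m $ i) / norm2 k\<bar> * (t i * (c1 + c)))"
      proof (intro Ck_bound_sum[OF assms(1)] Ck_bound_scale[OF assms(1)])
        fix i
        have "Ck_bound a Par (\<lambda>\<xi>. t i * Im (lam \<xi> e $ i + v \<xi> $ i)) (t i * (c1 + c))"
          by (rule Ck_bound_linear[OF assms(1) _ Ck_bound_eig[OF assms(1,2,3,5) e pert]])
            (use t0 in \<open>auto intro!: bounded_linear_const_mult bounded_linear_Im mult_left_mono abs_Im_le_cmod
              simp: abs_mult simp del: plus_complex.sel\<close>)
        then show "Ck_bound a Par (\<lambda>\<xi>. Im (V \<xi> $ i) / E) (t i * (c1 + c))"
          by (rule Ck_bound_cong[OF assms(1), rotated])
            (simp add: V_def E_def scale_eig_def t_def powr_diff)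
      qed simp
      have "(\<Sum>j\<in>UNIV. \<bar>of_int (k $ j) / norm2 k\<bar> * \<delta>) \<le> (\<Sum>j\<in>(UNIV :: 'n2 set). 1 * \<delta>)"
        using k1 \<delta>(1) abs_component_le_norm2[of k]
        by (intro sum_mono mult_right_mono) (auto simp: divide_le_eq)
      then have 1: "(\<Sum>j\<in>UNIV. \<bar>of_int (k $ j) / norm2 k\<bar> * \<delta>) \<le> \<eta> / 2"
        using \<delta>(2) by simp
      have "(\<Sum>i\<in>UNIV. \<bar>of_int (m $ i) / norm2 k\<bar> * (t i * (c1 + c)))
          \<le> (\<Sum>i\<in>UNIV. \<bar>of_int (m $ i)\<bar> * (\<beta> * (c1 + c)))"
      proof (rule sum_mono)
        fix i
        show "\<bar>of_int (m $ i) / norm2 k\<bar> * (t i * (c1 + c)) \<le> \<bar>of_int (m $ i)\<bar> * (\<beta> * (c1 + c))"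
        proof (cases "m $ i = 0")
          case False
          have "\<bar>of_int (m $ i) / norm2 k\<bar> * (t i * (c1 + c))
              = \<bar>of_int (m $ i)\<bar> * (t i / norm2 k * (c1 + c))"
            using k1 by (simp add: abs_divide)
          also have "\<dots> \<le> \<bar>of_int (m $ i)\<bar> * (\<beta> * (c1 + c))"
            using t[OF False] c1(1) assms(5) by (intro mult_left_mono mult_right_mono) auto
          finally show ?thesis .
        qed simp
      qed
      also have "\<dots> = of_int (norm1 m) * (\<beta> * (c1 + c))"
        by (simp add: norm1_def sum_distrib_right)
      also have "\<dots> \<le> 2 * (\<beta> * (c1 + c))"
        using m \<beta>(1) c1(1) assms(5) by (intro mult_right_mono) auto
      finally have 2: "(\<Sum>i\<in>UNIV. \<bar>of_int (m $ i) / norm2 k\<bar> * (t i * (c1 + c))) \<le> \<eta> / 2"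
        using \<beta>(2) by simp
      have "Ck_bound a Par (\<lambda>\<xi>. (\<Sum>j\<in>UNIV. of_int (k $ j) / norm2 k * D \<xi> j)
          + (\<Sum>i\<in>UNIV. of_int (m $ i) / norm2 k * (Im (V \<xi> $ i) / E))) \<eta>"
        by (rule Ck_bound_mono[OF Ck_bound_add[OF assms(1) DC VC]]) (use 1 2 in linarith)
      then have "Ck_bound a Par (\<lambda>\<xi>. Im (pairing k m (W \<xi>) (V \<xi>)) / (E * norm2 k)
        - (\<Sum>j\<in>UNIV. (\<chi> j. of_int (k $ j) / norm2 k) $ j * om_tilde N om om21 \<xi> $ j) - z) \<eta>"
      proof (rule Ck_bound_cong[OF assms(1), rotated])
        fix \<xi>
        have "(\<Sum>j\<in>UNIV. of_int (k $ j) / norm2 k * D \<xi> j) =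
            (\<Sum>j\<in>UNIV. of_int (k $ j) * W \<xi> $ j) / (E * norm2 k)
            - (\<Sum>j\<in>UNIV. of_int (k $ j) / norm2 k * om_tilde N om om21 \<xi> $ j) - z"
          by (simp add: D_def z_def sum_divide_distrib sum_subtractf[symmetric] right_diff_distrib mult.commute)
        moreover have "(\<Sum>i\<in>UNIV. of_int (m $ i) / norm2 k * (Im (V \<xi> $ i) / E)) =
            (\<Sum>i\<in>UNIV. of_int (m $ i) * Im (V \<xi> $ i)) / (E * norm2 k)"
          by (simp add: sum_divide_distrib mult.commute)
        ultimately show "(\<Sum>j\<in>UNIV. of_int (k $ j) / norm2 k * D \<xi> j)
            + (\<Sum>i\<in>UNIV. of_int (m $ i) / norm2 k * (Im (V \<xi> $ i) / E)) =
          Im (pairing k m (W \<xi>) (V \<xi>)) / (E * norm2 k)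
          - (\<Sum>j\<in>UNIV. (\<chi> j. of_int (k $ j) / norm2 k) $ j * om_tilde N om om21 \<xi> $ j) - z"
          by (simp add: Im_pairing add_divide_distrib)
      qed
      moreover have "N = UNIV \<longrightarrow> z = 0"
        by (simp add: z_def om_tilde0_def)
      ultimately show "\<exists>z. (N = UNIV \<longrightarrow> z = 0) \<and>
        Ck_bound a Par (\<lambda>\<xi>. Im (pairing k m (scale_freq q N e (om \<xi> e + w \<xi>)) (scale_eig q J e (lam \<xi> e + v \<xi>)))
          / (e powr q 5 * norm2 k)
        - (\<Sum>j\<in>UNIV. (\<chi> j. of_int (k $ j) / norm2 k) $ j * om_tilde N om om21 \<xi> $ j) - z) \<eta>"
        unfolding W_def V_def E_def by blast
    qed
  qed
qed

lemma Ck_on_om_tilde: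
  assumes "open Par" "limiting_data q a J N Par lam om om20 om21"
  shows "Ck_on a (\<lambda>\<xi>. om_tilde N om om21 \<xi> $ j) Par"
  using assms(2) by (cases "j \<in> N") (auto simp: limiting_data_def om_tilde_def)

section \<open>Limits of the divisors, the rank condition, and the exceptional pairs\<close>

text \<open>\<open>limiting_data\<close> gives only pointwise convergence of these eigenvalues; the
  uniform bound \<open>c1\<close> on their first derivatives makes it uniform on compact
  sets.\<close>

lemma eig_limit:
  fixes lam :: "real ^ 'n3 \<Rightarrow> real \<Rightarrow> complex ^ 'n1"
  assumes "open Par" "convex Par" "H2 q a J N Par estar c0 c1 A B lam om"
    and "limiting_data q a J N Par lam om om20 om21" "compact C" "C \<subseteq> Par" "i \<notin> J"
  shows "continuous_on C (\<lambda>\<xi>. lam \<xi> 0 $ i)"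
    and "0 < \<delta> \<Longrightarrow> \<forall>\<^sub>F e in at_right 0. \<forall>\<xi>\<in>C. cmod (lam \<xi> e $ i - lam \<xi> 0 $ i) \<le> \<delta>"
proof -
  have h: "0 < a" "0 < estar" "0 < c1"
    "\<And>e. 0 < e \<Longrightarrow> e \<le> estar \<Longrightarrow> Ck_bound a Par (\<lambda>\<xi>. lam \<xi> e $ i) c1"
    using assms(3) by (auto simp: H2_def)
  have Lip: "\<forall>\<^sub>F e in at_right 0. \<forall>x\<in>C. \<forall>y\<in>C.
      norm (lam x e $ i - lam y e $ i) \<le> real DIM(real ^ 'n3) * c1 * dist x y"
    using eventually_in_unit[OF h(2)]
  proof eventually_elim
    case (elim e)
    then show ?case
      using Ck_bound_Lipschitz[OF assms(1,2) h(4) h(1), of e] assms(6) by (auto simp: dist_norm subset_iff)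
  qed
  have lim: "((\<lambda>e. lam x e $ i) \<longlongrightarrow> lam x 0 $ i) (at_right 0)" if "x \<in> C" for x
    using assms(4,6,7) that by (auto simp: limiting_data_def)
  have L: "0 \<le> real DIM(real ^ 'n3) * c1"
    using h(3) by simp
  show "continuous_on C (\<lambda>\<xi>. lam \<xi> 0 $ i)"
    by (rule uniform_limit_of_Lipschitz(1)[OF assms(5) L Lip lim])
  show "0 < \<delta> \<Longrightarrow> \<forall>\<^sub>F e in at_right 0. \<forall>\<xi>\<in>C. cmod (lam \<xi> e $ i - lam \<xi> 0 $ i) \<le> \<delta>"
    by (rule uniform_limit_of_Lipschitz(2)[OF assms(5) L Lip lim])
qed

text \<open>For \<open>q 3 = q 5\<close> the eigenvalues outside \<open>J\<close> live on the same
  scale as the frequencies and survive in the limit, while those in \<open>J\<close> carry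
  \<epsilon>^(q1 - q5) and vanish. The term with \<open>om_tilde0\<close> is kept in the comparison
  since it need not converge.\<close>

lemma pairing_limit:
  fixes lam :: "real ^ 'n3 \<Rightarrow> real \<Rightarrow> complex ^ 'n1" and om :: "real ^ 'n3 \<Rightarrow> real \<Rightarrow> real ^ 'n2"
    and k :: "int ^ 'n2" and m :: "int ^ 'n1"
  assumes "open Par" "convex Par" "H1 q" "H2 q a J N Par estar c0 c1 A B lam om"
    and "limiting_data q a J N Par lam om om20 om21" "compact C" "C \<subseteq> Par" "0 \<le> c" "0 < \<rho>"
    and "q 3 = q 5"
  shows "\<forall>\<^sub>F e in at_right 0. \<forall>w v. perturbation q a J N Par c e w v \<longrightarrow> (\<forall>\<xi>\<in>C.
    cmod (pairing k m (scale_freq q N e (om \<xi> e + w \<xi>)) (scale_eig q J e (lam \<xi> e + v \<xi>)) / complex_of_real (e powr q 5)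
      - pairing k m ((1 / e powr q 5) *\<^sub>R om_tilde0 N om20 + om_tilde N om om21 \<xi>)
         (\<chi> i. if i \<in> J then 0 else lam \<xi> 0 $ i)) \<le> \<rho>)"
proof -
  have q: "q 5 < q 1" "0 < q 2" "q 2 \<le> q 4"
    using assms(3) by (auto simp: H1_def)
  have c1: "0 < c1" "0 < estar"
    using assms(4) by (auto simp: H2_def)
  define n where "n = real_of_int (norm1 k + norm1 m)"
  have n: "0 \<le> n"
    by (auto simp: n_def norm1_def intro!: sum_nonneg)
  \<comment> \<open>The tolerance depends on \<open>k\<close> and \<open>m\<close>, so a common
    threshold for \<epsilon> is available only for finitely many pairs.\<close>
  define \<delta> where "\<delta> = \<rho> / (n + 1)"
  have \<delta>: "0 < \<delta>" "n * \<delta> \<le> \<rho>"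
    using n assms(9) by (auto simp: \<delta>_def field_simps)
  have "\<forall>\<^sub>F e in at_right 0. \<forall>i\<in>- J. \<forall>\<xi>\<in>C. cmod (lam \<xi> e $ i - lam \<xi> 0 $ i) \<le> \<delta> / 2"
    using half_gt_zero[OF \<delta>(1)] by (intro eventually_ball_finite ballI eig_limit(2)[OF assms(1,2,4-7)]) auto
  moreover have "\<forall>\<^sub>F e in at_right 0. (c1 + c) * e powr (q 1 - q 5) \<le> \<delta>"
    using q \<delta> by (intro eventually_powr_small) auto
  moreover have "\<forall>\<^sub>F e in at_right 0. c * e powr q 2 \<le> \<delta> / 2"
    using q \<delta> by (intro eventually_powr_small) auto
  moreover note freq_deviation[OF assms(1,3,5,8) \<delta>(1)] eventually_in_unit[OF c1(2)]
  ultimately show ?thesis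
  proof eventually_elim
    case (elim e)
    then have e: "0 < e" "e \<le> 1" "e \<le> estar"
      by auto
    show ?case
    proof (intro allI impI ballI)
      fix w v \<xi> assume pert: "perturbation q a J N Par c e w v" and \<xi>: "\<xi> \<in> C"
      then have \<xi>P: "\<xi> \<in> Par"
        using assms(7) by blast
      define E where "E = e powr q 5"
      have E: "E > 0"
        using e by (simp add: E_def)
      define W where "W = scale_freq q N e (om \<xi> e + w \<xi>)"
      define V where "V = scale_eig q J e (lam \<xi> e + v \<xi>)"
      have "\<bar>((1 / E) *\<^sub>R W - ((1 / E) *\<^sub>R om_tilde0 N om20 + om_tilde N om om21 \<xi>)) $ j\<bar> \<le> \<delta>" for j
      proof -
        have "Ck_bound a Par (\<lambda>\<xi>. scale_freq q N e (om \<xi> e + w \<xi>) $ j / e powr q 5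
            - om_tilde N om om21 \<xi> $ j - om_tilde0 N om20 $ j / e powr q 5) \<delta>"
          using elim pert by blast
        from Ck_boundD[OF this \<xi>P] show ?thesis
          by (simp add: W_def E_def algebra_simps)
      qed
      moreover have "cmod (((\<chi> i. V $ i / complex_of_real E) - (\<chi> i. if i \<in> J then 0 else lam \<xi> 0 $ i)) $ i) \<le> \<delta>" for i
      proof (cases "i \<in> J")
        case True
        have "cmod (V $ i / complex_of_real E) = e powr (q 1 - q 5) * cmod (lam \<xi> e $ i + v \<xi> $ i)"
          using True E e by (simp add: V_def E_def scale_eig_def norm_mult norm_divide powr_diff)
        also have "\<dots> \<le> e powr (q 1 - q 5) * (c1 + c)"
          using Ck_boundD[OF Ck_bound_eig[OF assms(1,3,4,8) e pert, of i] \<xi>P] by (intro mult_left_mono) auto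
        finally show ?thesis
          using True elim by (simp add: mult.commute)
      next
        case False
        have "c * e powr q 4 \<le> c * e powr q 2"
          using e q assms(8) by (intro mult_left_mono powr_mono') auto
        moreover have "cmod (v \<xi> $ i) \<le> c * e powr q 4"
          using pert False Ck_boundD[OF _ \<xi>P, of a "\<lambda>\<xi>. v \<xi> $ i"] by (auto simp: perturbation_def)
        moreover have "cmod (lam \<xi> e $ i - lam \<xi> 0 $ i) \<le> \<delta> / 2"
          using elim False \<xi> by blast
        ultimately have "cmod ((lam \<xi> e $ i - lam \<xi> 0 $ i) + v \<xi> $ i) \<le> \<delta>"
          using elim norm_triangle_ineq[of "lam \<xi> e $ i - lam \<xi> 0 $ i" "v \<xi> $ i"] by linarith
        moreover have "V $ i / complex_of_real E = lam \<xi> e $ i + v \<xi> $ i"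
          using False E assms(10) by (simp add: V_def E_def scale_eig_def)
        ultimately show ?thesis
          using False by (simp add: algebra_simps)
      qed
      ultimately have "cmod (pairing k m W V / complex_of_real E
          - pairing k m ((1 / E) *\<^sub>R om_tilde0 N om20 + om_tilde N om om21 \<xi>)
             (\<chi> i. if i \<in> J then 0 else lam \<xi> 0 $ i)) \<le> n * \<delta>"
        unfolding pairing_divide pairing_diff n_def by (rule cmod_pairing_le)
      then show "cmod (pairing k m (scale_freq q N e (om \<xi> e + w \<xi>)) (scale_eig q J e (lam \<xi> e + v \<xi>))
          / complex_of_real (e powr q 5)
        - pairing k m ((1 / e powr q 5) *\<^sub>R om_tilde0 N om20 + om_tilde N om om21 \<xi>)
         (\<chi> i. if i \<in> J then 0 else lam \<xi> 0 $ i)) \<le> \<rho>"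
        using \<delta>(2) unfolding W_def V_def E_def by linarith
    qed
  qed
qed

lemma Ck_on_add:
  assumes "open S" "Ck_on a f S" "Ck_on a g S"
  shows "Ck_on a (\<lambda>x. f x + g x) S"
proof -
  have "Ck_on a (\<lambda>x. \<Sum>i\<in>{True, False}. (if i then f else g) x) S"
    by (rule Ck_on_linear_combination[where L = "\<lambda>_ x. x"])
      (use assms bounded_linear_ident in auto)
  then show ?thesis
    by simp
qed

text \<open>Otherwise all the derivative vectors would lie in the hyperplane orthogonal to
  \<open>\<kappa>\<close>, which has dimension one less than \<open>CARD('n)\<close>.\<close>

lemma nondegenerate_of_dim:
  fixes g :: "'a::euclidean_space \<Rightarrow> real ^ 'n"
  assumes "open S" "x \<in> S" "\<And>j. Ck_on a (\<lambda>x. g x $ j) S" "\<kappa> \<noteq> 0"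
    and "dim {iter_partial vs g x | vs. vs \<in> multi a \<and> Q vs} = CARD('n)"
  shows "\<exists>vs\<in>multi a. Q vs \<and> iter_partial vs (\<lambda>x. \<Sum>j\<in>UNIV. \<kappa> $ j * g x $ j) x \<noteq> 0"
proof (rule ccontr)
  assume no: "\<not> ?thesis"
  have "\<kappa> \<bullet> iter_partial vs g x = 0" if vs: "vs \<in> multi a" "Q vs" for vs
  proof -
    \<comment> \<open>Expansion in the standard basis shows that derivatives of the vector valued
      \<open>g\<close> are taken componentwise.\<close>
    have "iter_partial vs (\<lambda>x. \<Sum>j\<in>UNIV. g x $ j *\<^sub>R axis j (1::real)) x =
        (\<Sum>j\<in>UNIV. iter_partial vs (\<lambda>x. g x $ j) x *\<^sub>R axis j 1)"
      using assms(3) vs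
      by (intro iter_partial_linear_combination[OF assms(1) _ _ _ _ assms(2),
            where L = "\<lambda>j y. y *\<^sub>R axis j 1" and f = "\<lambda>j x. g x $ j"])
        (auto intro: bounded_linear_scaleR_left)
    moreover have "(\<lambda>x. \<Sum>j\<in>UNIV. g x $ j *\<^sub>R axis j (1::real)) = g"
    proof
      fix x show "(\<Sum>j\<in>UNIV. g x $ j *\<^sub>R axis j (1::real)) = g x"
        using basis_expansion[of "g x"] by (simp add: scalar_mult_eq_scaleR)
    qed
    ultimately have "iter_partial vs g x = (\<Sum>j\<in>UNIV. iter_partial vs (\<lambda>x. g x $ j) x *\<^sub>R axis j 1)"
      by simp
    then have "\<kappa> \<bullet> iter_partial vs g x = (\<Sum>j\<in>UNIV. \<kappa> $ j * iter_partial vs (\<lambda>x. g x $ j) x)"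
      by (simp add: inner_sum_right inner_axis mult.commute)
    also have "\<dots> = iter_partial vs (\<lambda>x. \<Sum>j\<in>UNIV. \<kappa> $ j * g x $ j) x"
      by (rule iter_partial_linear_combination[where L = "\<lambda>j y. \<kappa> $ j * y" and f = "\<lambda>j x. g x $ j", symmetric])
        (use assms vs in \<open>auto intro: bounded_linear_mult_right\<close>)
    finally show ?thesis
      using no vs by auto
  qed
  then have "{iter_partial vs g x | vs. vs \<in> multi a \<and> Q vs} \<subseteq> {y. \<kappa> \<bullet> y = 0}"
    by auto
  then have "dim {iter_partial vs g x | vs. vs \<in> multi a \<and> Q vs} \<le> dim {y. \<kappa> \<bullet> y = 0}"
    by (rule dim_subset)
  also have "\<dots> = DIM(real ^ 'n) - 1"
    by (rule dim_hyperplane[OF assms(4)])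
  finally have "CARD('n) \<le> DIM(real ^ 'n) - 1"
    unfolding assms(5) .
  moreover have "DIM(real ^ 'n) = CARD('n)" "0 < CARD('n)"
    by simp_all
  ultimately show False
    by linarith
qed

text \<open>The sublevel sets decrease to the zero set, and measure is continuous from above on sets
  of finite measure.\<close>

lemma measure_sublevel_small:
  fixes G :: "'a::euclidean_space \<Rightarrow> complex"
  assumes "compact C" "continuous_on C G" "{\<xi>\<in>C. G \<xi> = 0} \<in> null_sets lebesgue" "0 < \<delta>"
  shows "\<exists>s>0. {\<xi>\<in>C. cmod (G \<xi>) < s} \<in> lmeasurable \<and> measure lebesgue {\<xi>\<in>C. cmod (G \<xi>) < s} \<le> \<delta>"
proof -
  define S where "S = (\<lambda>n::nat. {\<xi>\<in>C. cmod (G \<xi>) < 1 / (real n + 1)})"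
  have meas: "{\<xi>\<in>C. cmod (G \<xi>) < s} \<in> lmeasurable" for s
  proof -
    have "closed (C \<inter> (\<lambda>\<xi>. cmod (G \<xi>)) -` {s..})"
      using assms(1,2) by (intro continuous_closed_preimage continuous_intros compact_imp_closed) auto
    then have "compact (C \<inter> (\<lambda>\<xi>. cmod (G \<xi>)) -` {s..})"
      using assms(1) bounded_subset[of C "C \<inter> (\<lambda>\<xi>. cmod (G \<xi>)) -` {s..}"]
      by (simp add: compact_eq_bounded_closed)
    then have "C - C \<inter> (\<lambda>\<xi>. cmod (G \<xi>)) -` {s..} \<in> lmeasurable"
      using assms(1) by (intro fmeasurable.Diff lmeasurable_compact)
    then show ?thesis
      by (rule back_subst[of "\<lambda>S. S \<in> lmeasurable"]) auto
  qed
  have "(\<lambda>n. measure lebesgue (S n)) \<longlonglongrightarrow> measure lebesgue (\<Inter>n. S n)"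
  proof (rule Lim_measure_decseq)
    show "range S \<subseteq> sets lebesgue"
      using meas by (auto simp: S_def)
    show "decseq S"
    proof (rule decseq_SucI, rule subsetI)
      fix n x assume "x \<in> S (Suc n)"
      moreover have "1 / (real (Suc n) + 1) \<le> 1 / (real n + 1)"
        by (intro divide_left_mono) auto
      ultimately show "x \<in> S n"
        by (auto simp: S_def)
    qed
    show "emeasure lebesgue (S i) \<noteq> \<infinity>" for i
      using fmeasurableD2[OF meas] by (simp add: S_def)
  qed
  moreover have "(\<Inter>n. S n) = {\<xi>\<in>C. G \<xi> = 0}"
  proof (intro set_eqI iffI)
    fix \<xi> assume x: "\<xi> \<in> (\<Inter>n. S n)"
    have "cmod (G \<xi>) = 0"
    proof (rule ccontr)
      assume "cmod (G \<xi>) \<noteq> 0"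
      then obtain n where "inverse (real (Suc n)) < cmod (G \<xi>)"
        using reals_Archimedean[of "cmod (G \<xi>)"] by auto
      moreover have "cmod (G \<xi>) < 1 / (real n + 1)"
        using x by (auto simp: S_def)
      ultimately show False
        by (simp add: inverse_eq_divide add.commute)
    qed
    then show "\<xi> \<in> {\<xi>\<in>C. G \<xi> = 0}"
      using x by (auto simp: S_def)
  qed (auto simp: S_def)
  ultimately have "(\<lambda>n. measure lebesgue (S n)) \<longlonglongrightarrow> 0"
    using measure_eq_0_null_sets[OF assms(3)] by simp
  then have "\<forall>\<^sub>F n in sequentially. measure lebesgue (S n) < \<delta>"
    using assms(4) by (rule order_tendstoD(2))
  then obtain n where "measure lebesgue (S n) < \<delta>"
    by (auto simp: eventually_sequentially)
  then show ?thesis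
    using meas by (intro exI[of _ "1 / (real n + 1)"]) (auto simp: S_def)
qed

text \<open>The scaled divisor is asymptotic to \<open>ko\<close> / \<epsilon>^q5 times the
  imaginary unit plus a bounded function. If \<open>ko \<noteq> 0\<close> and
  \<open>q 5 > 0\<close>, the first term blows up and there is no resonance at all. Otherwise it
  does not depend on \<epsilon>, and resonant points lie in a sublevel set of one fixed function.
  The covering set \<open>T\<close> serves all perturbations at once.\<close>

lemma finite_resonance_small:
  fixes lam :: "real ^ 'n3 \<Rightarrow> real \<Rightarrow> complex ^ 'n1" and om :: "real ^ 'n3 \<Rightarrow> real \<Rightarrow> real ^ 'n2"
    and k :: "int ^ 'n2" and m :: "int ^ 'n1"
  assumes "open Par" "convex Par" "H1 q" "H2 q a J N Par estar c0 c1 A B lam om"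
    and "limiting_data q a J N Par lam om om20 om21" "compact C" "C \<subseteq> Par" "0 \<le> c" "0 < \<delta>"
    and "q 3 = q 5" "k \<noteq> 0" "m \<in> admissible_m" "\<exists>i\<in>- J. m $ i \<noteq> 0"
    and null: "\<And>(k :: int ^ 'n2) (m :: int ^ 'n1) e.
           k \<noteq> 0 \<Longrightarrow> (\<forall>i\<in>J. m $ i = 0) \<Longrightarrow> 1 \<le> norm1 m \<Longrightarrow> norm1 m \<le> 2 \<Longrightarrow>
           (\<Sum>i\<in>UNIV. m $ i) = 0 \<or> (\<Sum>i\<in>UNIV. m $ i) = - 1 \<Longrightarrow>
           e \<in> {0<..estar} \<Longrightarrow>
           {\<xi>\<in>Par. pairing k m (om_tilde0 N om20 + (e powr q 5) *\<^sub>R om_tilde N om om21 \<xi>)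
                               ((e powr q 3) *\<^sub>R lam \<xi> 0) = 0} \<in> null_sets lebesgue"
  shows "\<exists>\<gamma>1>0. \<forall>\<^sub>F e in at_right 0. \<exists>T\<in>lmeasurable. measure lebesgue T \<le> \<delta> \<and>
    (\<forall>w v. perturbation q a J N Par c e w v \<longrightarrow>
      {\<xi>\<in>C. cmod (pairing k m (scale_freq q N e (om \<xi> e + w \<xi>)) (scale_eig q J e (lam \<xi> e + v \<xi>)))
        < \<gamma>1 * e powr q 5} \<subseteq> T)"
proof -
  have q5: "0 \<le> q 5"
    using assms(3) by (auto simp: H1_def)
  have estar: "0 < estar"
    using assms(4) by (auto simp: H2_def)
  define L0 where "L0 = (\<lambda>\<xi>. \<chi> i. if i \<in> J then 0 else lam \<xi> 0 $ i)"
  define P' where "P' = (\<lambda>\<xi>. pairing k m (om_tilde N om om21 \<xi>) (L0 \<xi>))"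
  define ko where "ko = (\<Sum>j\<in>UNIV. of_int (k $ j) * om_tilde0 N om20 $ j)"
  have P: "pairing k m ((1 / E) *\<^sub>R om_tilde0 N om20 + om_tilde N om om21 \<xi>) (L0 \<xi>)
      = \<i> * complex_of_real (ko / E) + P' \<xi>" for E \<xi>
    by (simp add: pairing_def P'_def ko_def sum_divide_distrib sum.distrib[symmetric] algebra_simps
        del: of_real_sum of_real_divide of_real_add of_real_mult)
      (simp add: sum.distrib add_divide_distrib sum_distrib_left algebra_simps)
  have "continuous_on C (\<lambda>\<xi>. om_tilde N om om21 \<xi> $ j)" for j
    using Ck_on_continuous[OF Ck_on_om_tilde[OF assms(1,5)]] assms(7) continuous_on_subset by blast
  note cont1 = this
  have cont2: "continuous_on C (\<lambda>\<xi>. L0 \<xi> $ i)" for i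
    using eig_limit(1)[OF assms(1,2,4-7)] by (cases "i \<in> J") (auto simp: L0_def)
  have contP: "continuous_on C P'"
    unfolding P'_def pairing_def
    by (intro continuous_on_add continuous_on_mult continuous_on_const continuous_on_of_real
        continuous_on_sum cont1 cont2)
  show ?thesis
  proof (cases "ko \<noteq> 0 \<and> 0 < q 5")
    case True
    have "bounded (P' ` C)"
      using compact_continuous_image[OF contP assms(6)] compact_imp_bounded by blast
    then obtain M where M: "\<And>\<xi>. \<xi> \<in> C \<Longrightarrow> cmod (P' \<xi>) \<le> M"
      by (auto simp: bounded_iff)
    \<comment> \<open>Of \<open>M + 2\<close>, the bounded part takes \<open>M\<close> and the
      approximation error 1, which leaves a scaled divisor of modulus at least 1.\<close>
    have "\<forall>\<^sub>F e in at_right 0. (M + 2) * e powr q 5 \<le> \<bar>ko\<bar>"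
      using True by (intro eventually_powr_small) auto
    moreover note pairing_limit[OF assms(1-8) zero_less_one assms(10), of k m] eventually_in_unit[OF estar]
    ultimately have "\<forall>\<^sub>F e in at_right 0. \<exists>T\<in>lmeasurable. measure lebesgue T \<le> \<delta> \<and>
      (\<forall>w v. perturbation q a J N Par c e w v \<longrightarrow>
      {\<xi>\<in>C. cmod (pairing k m (scale_freq q N e (om \<xi> e + w \<xi>)) (scale_eig q J e (lam \<xi> e + v \<xi>)))
        < 1 * e powr q 5} \<subseteq> T)"
    proof eventually_elim
      case (elim e)
      have "\<not> cmod (pairing k m (scale_freq q N e (om \<xi> e + w \<xi>)) (scale_eig q J e (lam \<xi> e + v \<xi>)))
          < e powr q 5" if pert: "perturbation q a J N Par c e w v" and \<xi>: "\<xi> \<in> C" for w v \<xi>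
      proof -
        define E where "E = e powr q 5"
        define Q where "Q = pairing k m (scale_freq q N e (om \<xi> e + w \<xi>)) (scale_eig q J e (lam \<xi> e + v \<xi>))"
        have E: "E > 0"
          using elim by (simp add: E_def)
        have "cmod (Q / complex_of_real E - (\<i> * complex_of_real (ko / E) + P' \<xi>)) \<le> 1"
          using elim(2) pert \<xi> unfolding P[symmetric] Q_def E_def L0_def by blast
        moreover have "M + 2 \<le> \<bar>ko\<bar> / E"
          using elim(1) E by (simp add: E_def pos_le_divide_eq)
        then have "M + 2 \<le> cmod (\<i> * complex_of_real (ko / E))"
          using E by (simp add: norm_mult norm_divide)
        moreover have "cmod (\<i> * complex_of_real (ko / E)) \<le> cmod (Q / complex_of_real E)
            + cmod (Q / complex_of_real E - (\<i> * complex_of_real (ko / E) + P' \<xi>)) + cmod (P' \<xi>)"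
          using norm_triangle_ineq4[of "Q / complex_of_real E"
              "Q / complex_of_real E - (\<i> * complex_of_real (ko / E) + P' \<xi>)"]
            norm_triangle_ineq4[of "\<i> * complex_of_real (ko / E) + P' \<xi>" "P' \<xi>"] by simp
        ultimately have "1 \<le> cmod (Q / complex_of_real E)"
          using M[OF \<xi>] by linarith
        then show ?thesis
          using E unfolding Q_def[symmetric] E_def[symmetric] by (simp add: norm_divide)
      qed
      then show ?case
        using assms(9) by (intro bexI[of _ "{}"]) auto
    qed
    then show ?thesis
      using zero_less_one by blast
  next
    case False
    \<comment> \<open>Here \<open>ko = 0\<close> or \<open>q 5 = 0\<close>, so every positive
      \<epsilon> gives the same function; \<open>estar\<close> is a value at which the null set
      hypothesis can be applied.\<close>
    define G where "G = (\<lambda>\<xi>. \<i> * complex_of_real (ko / estar powr q 5) + P' \<xi>)"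
    have G: "\<i> * complex_of_real (ko / e powr q 5) + P' \<xi> = G \<xi>" if "0 < e" for e \<xi>
      using False q5 that estar by (auto simp: G_def)
    \<comment> \<open>The limit \<open>L0\<close> has no components in \<open>J\<close>, and the
      null set hypothesis concerns vectors \<open>m\<close> supported outside
      \<open>J\<close>.\<close>
    define m' where "m' = (\<chi> i. if i \<in> J then 0 else m $ i)"
    have m: "norm1 m \<le> 2" "(\<Sum>i\<in>UNIV. m $ i) = 0 \<or> (\<Sum>i\<in>UNIV. m $ i) = - 1"
      using assms(12) by (auto simp: admissible_m_def)
    have split1: "norm1 m = norm1 m' + (\<Sum>i\<in>J. \<bar>m $ i\<bar>)"
    proof -
      have "norm1 m = (\<Sum>i\<in>UNIV. \<bar>m' $ i\<bar> + (if i \<in> J then \<bar>m $ i\<bar> else 0))"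
        unfolding norm1_def by (intro sum.cong) (auto simp: m'_def)
      then show ?thesis
        by (simp add: sum.distrib norm1_def sum.If_cases)
    qed
    have J0: "0 \<le> (\<Sum>i\<in>J. \<bar>m $ i\<bar>)"
      by (rule sum_nonneg) simp
    have m'1: "1 \<le> norm1 m'"
    proof -
      obtain i where i: "i \<notin> J" "m $ i \<noteq> 0"
        using assms(13) by auto
      have "\<bar>m' $ i\<bar> \<le> norm1 m'"
        unfolding norm1_def by (rule member_le_sum) auto
      then show ?thesis
        using i by (simp add: m'_def)
    qed
    have m'2: "norm1 m' \<le> 2"
      using split1 J0 m by linarith
    \<comment> \<open>If \<open>m'\<close> has norm 2, nothing was dropped and the sum is that of
      \<open>m\<close>; otherwise its norm is at most 1.\<close>
    have sums: "(\<Sum>i\<in>UNIV. m' $ i) \<in> {-1, 0, 1}"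
    proof (cases "norm1 m' = 2")
      case True
      then have "(\<Sum>i\<in>J. \<bar>m $ i\<bar>) = 0"
        using split1 m J0 by linarith
      then have "\<forall>i\<in>J. m $ i = 0"
        by (subst (asm) sum_nonneg_eq_0_iff) auto
      then have "m' = m"
        by (auto simp: m'_def vec_eq_iff)
      then show ?thesis
        using m by auto
    next
      case False
      then have "norm1 m' \<le> 1"
        using m'2 by linarith
      then have "\<bar>\<Sum>i\<in>UNIV. m' $ i\<bar> \<le> 1"
        using sum_abs[of "vec_nth m'" UNIV] unfolding norm1_def by linarith
      then show ?thesis
        by auto
    qed
    \<comment> \<open>By \<open>q 3 = q 5\<close>, the expression in the null set hypothesis at
      \<open>estar\<close> is a nonzero multiple of \<open>G\<close>.\<close>
    have zero: "pairing k m' (om_tilde0 N om20 + (estar powr q 5) *\<^sub>R om_tilde N om om21 \<xi>)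
        ((estar powr q 3) *\<^sub>R lam \<xi> 0) = complex_of_real (estar powr q 5) * G \<xi>" for \<xi>
    proof -
      define E where "E = estar powr q 5"
      have E: "E \<noteq> 0"
        using estar by (simp add: E_def)
      have "pairing k m' (om_tilde0 N om20 + E *\<^sub>R om_tilde N om om21 \<xi>) (E *\<^sub>R lam \<xi> 0)
          / complex_of_real E = pairing k m ((1 / E) *\<^sub>R om_tilde0 N om20 + om_tilde N om om21 \<xi>) (L0 \<xi>)"
      proof -
        have "(\<Sum>i\<in>UNIV. of_int (m' $ i) * (lam \<xi> 0 $ i)) = (\<Sum>i\<in>UNIV. of_int (m $ i) * (L0 \<xi> $ i))"
          by (intro sum.cong) (auto simp: m'_def L0_def)
        moreover have "(1 / E) *\<^sub>R (om_tilde0 N om20 + E *\<^sub>R om_tilde N om om21 \<xi>)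
            = (1 / E) *\<^sub>R om_tilde0 N om20 + om_tilde N om om21 \<xi>"
          using E by (simp add: scaleR_add_right)
        moreover have "(\<chi> i. (E *\<^sub>R lam \<xi> 0) $ i / complex_of_real E) = lam \<xi> 0"
          using E by (simp add: vec_eq_iff) (simp add: scaleR_conv_of_real)
        ultimately show ?thesis
          unfolding pairing_divide by (simp only: pairing_def)
      qed
      then show ?thesis
        using E assms(10) unfolding P G[OF estar, symmetric] E_def[symmetric] by (simp add: field_simps E_def)
    qed
    \<comment> \<open>Dropping the components in \<open>J\<close> may turn the sum of \<open>m\<close> into \<open>1\<close>, which hypothesis (ii) does not
      mention; the same zero set then belongs to \<open>(-k, -m')\<close>.\<close>
    have "{\<xi>\<in>Par. G \<xi> = 0} \<in> null_sets lebesgue"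
    proof (cases "(\<Sum>i\<in>UNIV. m' $ i) = 1")
      case True
      have "{\<xi>\<in>Par. pairing (- k) (- m') (om_tilde0 N om20 + (estar powr q 5) *\<^sub>R om_tilde N om om21 \<xi>)
          ((estar powr q 3) *\<^sub>R lam \<xi> 0) = 0} \<in> null_sets lebesgue"
        using assms(11) m'1 m'2 True estar
        by (intro null) (auto simp: norm1_def sum_negf m'_def[THEN arg_cong, of "\<lambda>m. m $ _"])
      then show ?thesis
        unfolding pairing_uminus zero using estar by simp
    next
      case False
      have "{\<xi>\<in>Par. pairing k m' (om_tilde0 N om20 + (estar powr q 5) *\<^sub>R om_tilde N om om21 \<xi>)
          ((estar powr q 3) *\<^sub>R lam \<xi> 0) = 0} \<in> null_sets lebesgue"
        using assms(11) m'1 m'2 False sums estar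
        by (intro null) (auto simp: m'_def[THEN arg_cong, of "\<lambda>m. m $ _"])
      then show ?thesis
        unfolding zero using estar by simp
    qed
    moreover have contG: "continuous_on C G"
      unfolding G_def by (intro continuous_intros contP)
    have "closed {\<xi>\<in>C. G \<xi> = 0}"
      using continuous_closed_preimage_constant[OF contG compact_imp_closed[OF assms(6)], of 0] .
    then have "{\<xi>\<in>C. G \<xi> = 0} \<in> sets lebesgue"
      by simp
    moreover have "{\<xi>\<in>C. G \<xi> = 0} \<subseteq> {\<xi>\<in>Par. G \<xi> = 0}"
      using assms(7) by auto
    ultimately have "{\<xi>\<in>C. G \<xi> = 0} \<in> null_sets lebesgue"
      by (rule null_sets_subset)
    from measure_sublevel_small[OF assms(6) contG this assms(9)]
    obtain s where s: "s > 0" "{\<xi>\<in>C. cmod (G \<xi>) < s} \<in> lmeasurable"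
      "measure lebesgue {\<xi>\<in>C. cmod (G \<xi>) < s} \<le> \<delta>"
      by blast
    \<comment> \<open>At a resonant point for \<open>s / 2\<close> the scaled divisor is below
      \<open>s / 2\<close>, and its distance to \<open>G\<close> is at most
      \<open>s / 2\<close>.\<close>
    have "\<forall>\<^sub>F e in at_right 0. \<exists>T\<in>lmeasurable. measure lebesgue T \<le> \<delta> \<and>
      (\<forall>w v. perturbation q a J N Par c e w v \<longrightarrow>
      {\<xi>\<in>C. cmod (pairing k m (scale_freq q N e (om \<xi> e + w \<xi>)) (scale_eig q J e (lam \<xi> e + v \<xi>)))
        < s / 2 * e powr q 5} \<subseteq> T)"
      using pairing_limit[OF assms(1-8) half_gt_zero[OF s(1)] assms(10), of k m] eventually_in_unit[OF estar]
    proof eventually_elim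
      case (elim e)
      have "cmod (G \<xi>) < s" if pert: "perturbation q a J N Par c e w v" and \<xi>: "\<xi> \<in> C"
        and lt: "cmod (pairing k m (scale_freq q N e (om \<xi> e + w \<xi>)) (scale_eig q J e (lam \<xi> e + v \<xi>)))
          < s / 2 * e powr q 5" for w v \<xi>
      proof -
        define E where "E = e powr q 5"
        define Q where "Q = pairing k m (scale_freq q N e (om \<xi> e + w \<xi>)) (scale_eig q J e (lam \<xi> e + v \<xi>))"
        have E: "E > 0" "0 < e"
          using elim by (auto simp: E_def)
        have "cmod (Q / complex_of_real E - (\<i> * complex_of_real (ko / E) + P' \<xi>)) \<le> s / 2"
          using elim(1) pert \<xi> unfolding P[symmetric] Q_def E_def L0_def by blast
        then have "cmod (Q / complex_of_real E - G \<xi>) \<le> s / 2"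
          unfolding E_def G[OF E(2)] .
        moreover have "cmod (Q / complex_of_real E) < s / 2"
          using lt E unfolding Q_def[symmetric] E_def[symmetric]
          by (simp add: norm_divide pos_divide_less_eq)
        moreover have "cmod (G \<xi>) \<le> cmod (Q / complex_of_real E) + cmod (Q / complex_of_real E - G \<xi>)"
          using norm_triangle_ineq4[of "Q / complex_of_real E" "Q / complex_of_real E - G \<xi>"] by simp
        ultimately show ?thesis
          by linarith
      qed
      then show ?case
        using s(2,3) by (intro bexI[of _ "{\<xi>\<in>C. cmod (G \<xi>) < s}"]) auto
    qed
    then show ?thesis
      using half_gt_zero[OF s(1)] by blast
  qed
qed

section \<open>Summation over the shells of integer vectors\<close>

text \<open>A nonzero \<open>k\<close> lies in at most one shell and is therefore charged once,
  whichever step treats it. For this the bound \<open>b k m\<close> must not depend on \<nu>,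
  although the covering set may. Covers are used because the zones themselves need not be
  measurable.\<close>

lemma shell_union_bound:
  fixes X :: "nat \<Rightarrow> 'a::euclidean_space set" and Z :: "nat \<Rightarrow> int ^ 'n \<Rightarrow> 'm \<Rightarrow> 'a set"
  assumes "compact C" "\<And>\<nu>. closed (X \<nu>)"
    and X: "\<And>\<nu>. X (Suc \<nu>) = X \<nu> -
      (\<Union>m\<in>A. \<Union>k\<in>{k. Kc \<nu> < norm2 k \<and> norm2 k \<le> Kc (Suc \<nu>)}. Z \<nu> k m)"
    and Kc: "Kc 0 = 0" "\<And>\<nu>. Kc \<nu> \<le> Kc (Suc \<nu>)"
    and A: "finite A"
    and cover: "\<And>\<nu> k m. k \<noteq> 0 \<Longrightarrow> m \<in> A \<Longrightarrow>
      \<exists>T\<in>lmeasurable. C \<inter> Z \<nu> k m \<subseteq> T \<and> measure lebesgue T \<le> b k m"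
    and total: "\<And>F. finite F \<Longrightarrow> 0 \<notin> F \<Longrightarrow> (\<Sum>k\<in>F. \<Sum>m\<in>A. b k m) \<le> M"
  shows "measure lebesgue (C \<inter> X 0 - (\<Inter>\<nu>. X \<nu>)) \<le> M"
proof -
  define T where "T = (\<lambda>\<nu> k m. SOME T. T \<in> lmeasurable \<and> C \<inter> Z \<nu> k m \<subseteq> T \<and> measure lebesgue T \<le> b k m)"
  have T: "T \<nu> k m \<in> lmeasurable" "C \<inter> Z \<nu> k m \<subseteq> T \<nu> k m" "measure lebesgue (T \<nu> k m) \<le> b k m"
    if "k \<noteq> 0" "m \<in> A" for \<nu> k m
  proof -
    have "\<exists>T. T \<in> lmeasurable \<and> C \<inter> Z \<nu> k m \<subseteq> T \<and> measure lebesgue T \<le> b k m"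
      using cover[OF that] by blast
    from someI_ex[OF this]
    show "T \<nu> k m \<in> lmeasurable" "C \<inter> Z \<nu> k m \<subseteq> T \<nu> k m" "measure lebesgue (T \<nu> k m) \<le> b k m"
      unfolding T_def by auto
  qed
  \<comment> \<open>The part of \<open>C\<close> removed in the first \<nu> steps. These sets
    increase to everything that is removed, so continuity from below yields the claim.\<close>
  define D where "D = (\<lambda>\<nu>. C \<inter> X 0 - X \<nu>)"
  \<comment> \<open>\<open>U \<nu>\<close> holds the vectors treated before step \<nu>,
    \<open>V \<nu>\<close> those of the next shell.\<close>
  define U where "U = (\<lambda>\<nu>. {k :: int ^ 'n. 0 < norm2 k \<and> norm2 k \<le> Kc \<nu>})"
  define V where "V = (\<lambda>\<nu>. {k :: int ^ 'n. Kc \<nu> < norm2 k \<and> norm2 k \<le> Kc (Suc \<nu>)})"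
  have Kc0: "0 \<le> Kc \<nu>" for \<nu>
    using lift_Suc_mono_le[of Kc 0 \<nu>] Kc by simp
  have fin: "finite (U \<nu>)" "finite (V \<nu>)" for \<nu>
    by (rule finite_subset[OF _ finite_norm2_le[of "Kc \<nu>"]], auto simp: U_def)
      (rule finite_subset[OF _ finite_norm2_le[of "Kc (Suc \<nu>)"]], auto simp: V_def)
  have nz: "0 \<notin> U \<nu>" "0 \<notin> V \<nu>" for \<nu>
    using Kc0[of \<nu>] by (auto simp: U_def V_def)
  have UV: "U (Suc \<nu>) = U \<nu> \<union> V \<nu>" "U \<nu> \<inter> V \<nu> = {}" for \<nu>
    using Kc(2)[of \<nu>] Kc0[of \<nu>] by (auto simp: U_def V_def)
  have DL: "D \<nu> \<in> lmeasurable" for \<nu>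
    unfolding D_def using assms(1,2)
    by (intro fmeasurable.Diff lmeasurable_compact compact_Int_closed fmeasurable_Diff) auto
  have le: "measure lebesgue (D \<nu>) \<le> (\<Sum>k\<in>U \<nu>. \<Sum>m\<in>A. b k m)" for \<nu>
  proof (induction \<nu>)
    case 0
    have "D 0 = {}" "U 0 = {}"
      by (auto simp: D_def U_def Kc(1))
    then show ?case
      by simp
  next
    case (Suc \<nu>)
    define R where "R = (\<Union>k\<in>V \<nu>. \<Union>m\<in>A. T \<nu> k m)"
    have inner: "(\<Union>m\<in>A. T \<nu> k m) \<in> lmeasurable" if "k \<in> V \<nu>" for k
      using that nz(2)[of \<nu>] A by (intro fmeasurable.finite_UN T(1)) auto
    then have RL: "R \<in> lmeasurable"
      unfolding R_def by (rule fmeasurable.finite_UN[OF fin(2)])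
    have "D (Suc \<nu>) \<subseteq> D \<nu> \<union> R"
    proof
      fix x assume x: "x \<in> D (Suc \<nu>)"
      show "x \<in> D \<nu> \<union> R"
      proof (cases "x \<in> X \<nu>")
        case True
        then obtain m k where mk: "m \<in> A" "k \<in> V \<nu>" "x \<in> Z \<nu> k m"
          using x X[of \<nu>] by (auto simp: D_def V_def)
        then have "x \<in> T \<nu> k m"
          using x T(2)[of k m \<nu>] nz(2)[of \<nu>] by (auto simp: D_def)
        then show ?thesis
          using mk by (auto simp: R_def)
      qed (use x in \<open>auto simp: D_def\<close>)
    qed
    then have "measure lebesgue (D (Suc \<nu>)) \<le> measure lebesgue (D \<nu> \<union> R)"
      using DL RL by (intro measure_mono_fmeasurable) auto
    also have "\<dots> \<le> measure lebesgue (D \<nu>) + measure lebesgue R"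
      using DL RL by (intro measure_Un_le) auto
    also have "measure lebesgue R \<le> (\<Sum>k\<in>V \<nu>. measure lebesgue (\<Union>m\<in>A. T \<nu> k m))"
      unfolding R_def using fin inner by (intro measure_UNION_le) auto
    also have "\<dots> \<le> (\<Sum>k\<in>V \<nu>. \<Sum>m\<in>A. b k m)"
    proof (rule sum_mono)
      fix k assume "k \<in> V \<nu>"
      then have k: "k \<noteq> 0"
        using nz(2) by blast
      have "measure lebesgue (\<Union>m\<in>A. T \<nu> k m) \<le> (\<Sum>m\<in>A. measure lebesgue (T \<nu> k m))"
        using A T(1)[OF k] by (intro measure_UNION_le) auto
      also have "\<dots> \<le> (\<Sum>m\<in>A. b k m)"
        by (intro sum_mono T(3) k)
      finally show "measure lebesgue (\<Union>m\<in>A. T \<nu> k m) \<le> (\<Sum>m\<in>A. b k m)" .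
    qed
    finally have "measure lebesgue (D (Suc \<nu>)) \<le> (\<Sum>k\<in>U \<nu>. \<Sum>m\<in>A. b k m) + (\<Sum>k\<in>V \<nu>. \<Sum>m\<in>A. b k m)"
      using Suc by linarith
    then show ?case
      unfolding UV(1) using sum.union_disjoint[OF fin UV(2)] by metis
  qed
  have "(\<lambda>\<nu>. measure lebesgue (D \<nu>)) \<longlonglongrightarrow> measure lebesgue (\<Union>\<nu>. D \<nu>)"
  proof (rule Lim_measure_incseq)
    show "range D \<subseteq> sets lebesgue"
      using DL by auto
    show "incseq D"
      using X by (intro incseq_SucI) (auto simp: D_def)
    have "(\<Union>\<nu>. D \<nu>) \<subseteq> C"
      by (auto simp: D_def)
    then have "emeasure lebesgue (\<Union>\<nu>. D \<nu>) \<le> emeasure lebesgue C"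
      using lmeasurable_compact[OF assms(1)] by (intro emeasure_mono) auto
    also have "\<dots> < \<infinity>"
      using fmeasurableD2[OF lmeasurable_compact[OF assms(1)]]
      by (simp only: infinity_ennreal_def less_top[symmetric] not_False_eq_True simp_thms)
    finally show "emeasure lebesgue (\<Union>\<nu>. D \<nu>) \<noteq> \<infinity>"
      by simp
  qed
  moreover have "measure lebesgue (D \<nu>) \<le> M" for \<nu>
    using le[of \<nu>] total[OF fin(1) nz(1)] by (rule order_trans)
  ultimately have "measure lebesgue (\<Union>\<nu>. D \<nu>) \<le> M"
    by (intro LIMSEQ_le_const2) auto
  moreover have "(\<Union>\<nu>. D \<nu>) = C \<inter> X 0 - (\<Inter>\<nu>. X \<nu>)"
    by (auto simp: D_def)
  ultimately show ?thesis
    by simp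
qed

subsection \<open>The measure estimate\<close>

text \<open>Whitney extension supplies functions on all of \<open>Par\<close>, where derivatives
  along whole segments make sense; step 0 has the zero perturbation. The sign of \<open>c\<close>
  follows because \<open>c * \<gamma>\<close> bounds a measure.\<close>

lemma cantor_data_perturbation:
  assumes cd: "cantor_data q a l iota r J N Om Par A lam om gI gphi c \<gamma> e PI OM LAM" and "0 < \<gamma>"
  shows "0 \<le> c"
    and "\<exists>w v. perturbation q a J N Par c e w v \<and>
      (\<forall>\<xi>\<in>PI \<nu>. OM \<nu> \<xi> = om \<xi> + w \<xi> \<and> LAM \<nu> \<xi> = lam \<xi> + v \<xi>)"
proof -
  have "0 \<le> measure lebesgue (Par - PI 0)"
    by simp
  also have "\<dots> \<le> c * \<gamma>"
    using cd by (simp add: cantor_data_def)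
  finally show c: "0 \<le> c"
    using assms(2) by (simp add: zero_le_mult_iff)
  show "\<exists>w v. perturbation q a J N Par c e w v \<and>
      (\<forall>\<xi>\<in>PI \<nu>. OM \<nu> \<xi> = om \<xi> + w \<xi> \<and> LAM \<nu> \<xi> = lam \<xi> + v \<xi>)"
  proof (cases "\<nu> = 0")
    case True
    then have "OM \<nu> = om" "LAM \<nu> = lam"
      using cd by (auto simp: cantor_data_def)
    then show ?thesis
      using c by (intro exI[of _ "\<lambda>_. 0"]) (auto simp: perturbation_def intro!: Ck_bound_zero)
  next
    case False
    then have "1 \<le> \<nu>"
      by simp
    then have ext:
      "\<And>j. j \<in> N \<Longrightarrow> Ck_bound_closed a Par (PI \<nu>) (\<lambda>\<xi>. OM \<nu> \<xi> $ j - om \<xi> $ j) (c * e powr q 6)"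
      "\<And>j. j \<notin> N \<Longrightarrow> Ck_bound_closed a Par (PI \<nu>) (\<lambda>\<xi>. OM \<nu> \<xi> $ j - om \<xi> $ j) (c * e powr q 7)"
      "\<And>i. i \<in> J \<Longrightarrow> Ck_bound_closed a Par (PI \<nu>) (\<lambda>\<xi>. LAM \<nu> \<xi> $ i - lam \<xi> $ i) (c * e powr q 2)"
      "\<And>i. i \<notin> J \<Longrightarrow> Ck_bound_closed a Par (PI \<nu>) (\<lambda>\<xi>. LAM \<nu> \<xi> $ i - lam \<xi> $ i) (c * e powr q 4)"
      using cd unfolding cantor_data_def by auto
    have "\<forall>j. \<exists>h. Ck_bound a Par h (c * e powr q (if j \<in> N then 6 else 7)) \<and>
        (\<forall>\<xi>\<in>PI \<nu>. h \<xi> = OM \<nu> \<xi> $ j - om \<xi> $ j)"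
    proof
      fix j show "\<exists>h. Ck_bound a Par h (c * e powr q (if j \<in> N then 6 else 7)) \<and>
        (\<forall>\<xi>\<in>PI \<nu>. h \<xi> = OM \<nu> \<xi> $ j - om \<xi> $ j)"
        using ext(1,2)[of j] unfolding Ck_bound_closed_def by (cases "j \<in> N") auto
    qed
    then obtain w where w: "\<And>j. Ck_bound a Par (w j) (c * e powr q (if j \<in> N then 6 else 7))"
      "\<And>j \<xi>. \<xi> \<in> PI \<nu> \<Longrightarrow> w j \<xi> = OM \<nu> \<xi> $ j - om \<xi> $ j"
      by metis
    have "\<forall>i. \<exists>h. Ck_bound a Par h (c * e powr q (if i \<in> J then 2 else 4)) \<and>
        (\<forall>\<xi>\<in>PI \<nu>. h \<xi> = LAM \<nu> \<xi> $ i - lam \<xi> $ i)"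
    proof
      fix i show "\<exists>h. Ck_bound a Par h (c * e powr q (if i \<in> J then 2 else 4)) \<and>
        (\<forall>\<xi>\<in>PI \<nu>. h \<xi> = LAM \<nu> \<xi> $ i - lam \<xi> $ i)"
        using ext(3,4)[of i] unfolding Ck_bound_closed_def by (cases "i \<in> J") auto
    qed
    then obtain v where v: "\<And>i. Ck_bound a Par (v i) (c * e powr q (if i \<in> J then 2 else 4))"
      "\<And>i \<xi>. \<xi> \<in> PI \<nu> \<Longrightarrow> v i \<xi> = LAM \<nu> \<xi> $ i - lam \<xi> $ i"
      by metis
    have "perturbation q a J N Par c e (\<lambda>\<xi>. \<chi> j. w j \<xi>) (\<lambda>\<xi>. \<chi> i. v i \<xi>)"
      unfolding perturbation_def
    proof (intro conjI ballI)
      fix j assume "j \<in> N"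
      then show "Ck_bound a Par (\<lambda>\<xi>. (\<chi> j. w j \<xi>) $ j) (c * e powr q 6)"
        using w(1)[of j] by simp
    next
      fix j assume "j \<in> - N"
      then show "Ck_bound a Par (\<lambda>\<xi>. (\<chi> j. w j \<xi>) $ j) (c * e powr q 7)"
        using w(1)[of j] by simp
    next
      fix i assume "i \<in> J"
      then show "Ck_bound a Par (\<lambda>\<xi>. (\<chi> i. v i \<xi>) $ i) (c * e powr q 2)"
        using v(1)[of i] by simp
    next
      fix i assume "i \<in> - J"
      then show "Ck_bound a Par (\<lambda>\<xi>. (\<chi> i. v i \<xi>) $ i) (c * e powr q 4)"
        using v(1)[of i] by simp
    qed
    moreover have "\<forall>\<xi>\<in>PI \<nu>. OM \<nu> \<xi> = om \<xi> + (\<chi> j. w j \<xi>) \<and> LAM \<nu> \<xi> = lam \<xi> + (\<chi> i. v i \<xi>)"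
      using w(2) v(2) by (auto simp: vec_eq_iff)
    ultimately show ?thesis
      by blast
  qed
qed

lemma compact_inner_approximation:
  fixes S :: "'a::euclidean_space set"
  assumes "open S" "bounded S" "0 < \<delta>"
  obtains C where "compact C" "C \<subseteq> S" "S - C \<in> lmeasurable" "measure lebesgue (S - C) < \<delta>"
proof -
  obtain C where C: "closed C" "C \<subseteq> S" "S - C \<in> lmeasurable" "emeasure lebesgue (S - C) < ennreal \<delta>"
    using sets_lebesgue_inner_closed[OF _ assms(3), of S] assms(1) by auto
  have "compact C"
    using C(1,2) assms(2) bounded_subset compact_eq_bounded_closed by blast
  moreover have "ennreal (measure lebesgue (S - C)) < ennreal \<delta>"
    using C(3,4) emeasure_eq_measure2 by metis
  then have "measure lebesgue (S - C) < \<delta>"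
    using assms(3) by (simp add: ennreal_less_iff)
  ultimately show ?thesis
    using C that by blast
qed

text \<open>The width \<open>\<tau>\<close> solves cc * \<tau>^a = \<gamma> |k|^(-iota - 1), the
  height of the scaled resonance zone; this produces the exponent (iota + 1) / a in the bound. From
  \<open>\<gamma> \<le> cc\<close> and |k| \<ge> 1 it follows that
  \<open>\<tau> \<le> 1\<close>.\<close>

lemma sublevel_of_deviation_small:
  fixes g :: "'a::euclidean_space \<Rightarrow> real ^ 'n" and k :: "int ^ 'n"
  assumes "open S" "compact C" "C \<subseteq> S" "\<And>j. Ck_on a (\<lambda>x. g x $ j) S" "0 < a"
    and core: "\<And>\<kappa> u z \<tau> h. norm \<kappa> = 1 \<Longrightarrow> (P \<longrightarrow> z = 0) \<Longrightarrow> Ck_on a u S \<Longrightarrow>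
      Ck_bound a S (\<lambda>x. u x - (\<Sum>j\<in>UNIV. \<kappa> $ j * g x $ j) - z) \<eta> \<Longrightarrow>
      0 < \<tau> \<Longrightarrow> \<tau> \<le> 1 \<Longrightarrow> h \<le> cc * \<tau> ^ a \<Longrightarrow> measure lborel {x\<in>C. \<bar>u x\<bar> < h} \<le> K * \<tau>"
    and "k \<noteq> 0" "P \<longrightarrow> z = 0" "0 < \<gamma>" "\<gamma> \<le> cc" "0 < iota"
    and dev: "Ck_bound a S (\<lambda>\<xi>. u \<xi> - (\<Sum>j\<in>UNIV. (\<chi> j. of_int (k $ j) / norm2 k) $ j * g \<xi> $ j) - z) \<eta>"
  shows "{x\<in>C. \<bar>u x\<bar> < \<gamma> * norm2 k powr (- iota) / norm2 k} \<in> lmeasurable"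
    and "measure lebesgue {x\<in>C. \<bar>u x\<bar> < \<gamma> * norm2 k powr (- iota) / norm2 k}
      \<le> K * ((\<gamma> / cc) powr (1 / real a) * norm2 k powr (- ((iota + 1) / real a)))"
proof -
  define n where "n = norm2 k"
  define \<kappa> :: "real ^ 'n" where "\<kappa> = (\<chi> j. of_int (k $ j) / n)"
  define h where "h = \<gamma> * n powr (- iota) / n"
  define \<tau> where "\<tau> = (\<gamma> / cc) powr (1 / real a) * n powr (- ((iota + 1) / real a))"
  have n: "1 \<le> n"
    using norm2_ge_1[OF assms(7)] by (simp add: n_def)
  have cc: "0 < cc"
    using assms by linarith
  have "norm \<kappa> = sqrt (\<Sum>j\<in>UNIV. (real_of_int (k $ j) / n)\<^sup>2)"
    by (simp add: \<kappa>_def norm_vec_def L2_set_def power_divide)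
  also have "\<dots> = sqrt ((\<Sum>j\<in>UNIV. (real_of_int (k $ j))\<^sup>2) / n\<^sup>2)"
    by (simp add: power_divide sum_divide_distrib)
  also have "\<dots> = 1"
    using n by (simp add: real_sqrt_divide n_def norm2_def)
  finally have \<kappa>: "norm \<kappa> = 1" .
  have Ckg: "Ck_on a (\<lambda>x. \<Sum>j\<in>UNIV. \<kappa> $ j * g x $ j) S"
    by (rule Ck_on_linear_combination[where L = "\<lambda>j y. \<kappa> $ j * y"])
      (use assms in \<open>auto intro: bounded_linear_mult_right\<close>)
  \<comment> \<open>Regularity of \<open>u\<close> is read off from the deviation, since the
    subtracted terms are regular.\<close>
  have "Ck_on a (\<lambda>x. (u x - (\<Sum>j\<in>UNIV. \<kappa> $ j * g x $ j) - z) + ((\<Sum>j\<in>UNIV. \<kappa> $ j * g x $ j) + z)) S"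
    using dev Ckg unfolding Ck_bound_def n_def[symmetric] \<kappa>_def[symmetric]
    by (intro Ck_on_add[OF assms(1)] Ck_on_const) auto
  then have Cku: "Ck_on a u S"
    by simp
  have \<tau>0: "0 < \<tau>"
    using n cc assms(9) by (simp add: \<tau>_def)
  have \<tau>1: "\<tau> \<le> 1"
  proof -
    have "(\<gamma> / cc) powr (1 / real a) \<le> 1"
      using cc assms by (intro powr_le1) auto
    moreover have "n powr (- ((iota + 1) / real a)) \<le> n powr 0"
      using n assms by (intro powr_mono) auto
    then have "n powr (- ((iota + 1) / real a)) \<le> 1"
      using n by simp
    ultimately show ?thesis
      unfolding \<tau>_def by (intro mult_le_one) auto
  qed
  have "\<tau> ^ a = (\<gamma> / cc) * n powr (- (iota + 1))"
  proof -
    have "((\<gamma> / cc) powr (1 / real a)) ^ a = \<gamma> / cc"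
      using assms(5,9) cc by (simp add: powr_realpow[symmetric] powr_powr)
    moreover have "(n powr (- ((iota + 1) / real a))) ^ a = n powr (- (iota + 1))"
      using assms(5) n by (simp add: powr_realpow[symmetric] powr_powr)
    ultimately show ?thesis
      by (simp add: \<tau>_def power_mult_distrib)
  qed
  moreover have "n powr (- (iota + 1)) = n powr (- iota) / n"
  proof -
    have "n powr (- (iota + 1)) = n powr (- iota - 1)"
      by (rule arg_cong[where f = "\<lambda>t. n powr t"]) simp
    also have "\<dots> = n powr (- iota) / n"
      using n unfolding powr_diff by simp
    finally show ?thesis .
  qed
  ultimately have "h \<le> cc * \<tau> ^ a"
    using cc by (simp add: h_def)
  then have "measure lborel {x\<in>C. \<bar>u x\<bar> < h} \<le> K * \<tau>"
    using dev unfolding n_def[symmetric] \<kappa>_def[symmetric]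
    by (intro core[OF \<kappa> assms(8) Cku _ \<tau>0 \<tau>1])
  moreover have eq: "{x\<in>C. \<bar>u x\<bar> < h} = C \<inter> {x\<in>S. \<bar>u x\<bar> < h}"
    using assms(3) by auto
  have op: "open {x\<in>S. \<bar>u x\<bar> < h}"
    using open_sublevel[OF assms(1) Ck_on_continuous[OF Cku]] .
  then have "{x\<in>C. \<bar>u x\<bar> < h} \<in> sets lborel"
    unfolding eq using assms(2) by (simp add: compact_imp_closed)
  then have "measure lebesgue {x\<in>C. \<bar>u x\<bar> < h} = measure lborel {x\<in>C. \<bar>u x\<bar> < h}"
    by (rule measure_completion)
  moreover have "C \<inter> {x\<in>S. \<bar>u x\<bar> < h} \<in> lmeasurable"
    using op by (intro fmeasurable_Int_fmeasurable lmeasurable_compact assms(2)) simp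
  ultimately show "{x\<in>C. \<bar>u x\<bar> < \<gamma> * norm2 k powr (- iota) / norm2 k} \<in> lmeasurable"
    and "measure lebesgue {x\<in>C. \<bar>u x\<bar> < \<gamma> * norm2 k powr (- iota) / norm2 k}
      \<le> K * ((\<gamma> / cc) powr (1 / real a) * norm2 k powr (- ((iota + 1) / real a)))"
    unfolding h_def[unfolded n_def, symmetric] \<tau>_def[unfolded n_def, symmetric] eq by simp_all
qed

text \<open>Order of the choices: \<open>C\<close>, the constants of the sublevel estimate on
  \<open>C\<close>, the exceptional pairs they leave, \<open>\<gamma>1\<close> and
  \<open>e2\<close>, and \<gamma> last. Budget: less than \<delta>/4 outside \<open>C\<close>, at
  most \<delta>/4 for the exceptional pairs, and at most \<delta>/8 each for the part of
  \<open>Par\<close> outside the initial set and for the sum of the sublevel bounds over all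
  \<open>k\<close>.\<close>

lemma measure_complement_cantor_set_small:
  fixes q :: "nat \<Rightarrow> real" and a :: nat and l iota r c0 c1 estar \<gamma>0 \<delta> :: real
    and J :: "'n1::finite set" and N :: "'n2::finite set"
    and Om :: "(real ^ 'n1) set" and Par :: "(real ^ 'n3) set"
    and lam :: "real ^ 'n3 \<Rightarrow> real \<Rightarrow> complex ^ 'n1"
    and om :: "real ^ 'n3 \<Rightarrow> real \<Rightarrow> real ^ 'n2"
  assumes "0 < r" and Par: "convex Par" "bounded Par" "open Par"
    and H1: "H1 q"
    and H2: "H2 q a J N Par estar c0 c1 A B lam om"
    and H3: "H3 a l iota Om Par estar gI gphi"
    and lim: "limiting_data q a J N Par lam om om20 om21"
    and cantor: "cantor_family q a l iota r J N Om Par estar A lam om gI gphi \<gamma>0 e0 PI OM LAM"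
    and rank1: "\<And>\<xi>. - N = {} \<Longrightarrow> \<xi> \<in> Par \<Longrightarrow>
           dim {iter_partial vs (om_tilde N om om21) \<xi> | vs. vs \<in> multi a} = CARD('n2)"
    and rank2: "\<And>\<xi>. - N \<noteq> {} \<Longrightarrow> \<xi> \<in> Par \<Longrightarrow>
           dim {iter_partial vs (om_tilde N om om21) \<xi> | vs. vs \<in> multi a \<and> 1 \<le> length vs} = CARD('n2)"
    and null: "\<And>(k :: int ^ 'n2) (m :: int ^ 'n1) e.
           k \<noteq> 0 \<Longrightarrow> (\<forall>i\<in>J. m $ i = 0) \<Longrightarrow> 1 \<le> norm1 m \<Longrightarrow> norm1 m \<le> 2 \<Longrightarrow>
           (\<Sum>i\<in>UNIV. m $ i) = 0 \<or> (\<Sum>i\<in>UNIV. m $ i) = - 1 \<Longrightarrow>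
           e \<in> {0<..estar} \<Longrightarrow>
           {\<xi>\<in>Par. pairing k m (om_tilde0 N om20 + (e powr q 5) *\<^sub>R om_tilde N om om21 \<xi>)
                               ((e powr q 3) *\<^sub>R lam \<xi> 0) = 0} \<in> null_sets lebesgue"
    and \<delta>: "0 < \<delta>"
  shows "\<forall>\<^sub>F \<gamma> in at_right 0. \<forall>e\<in>{0<..e0 \<gamma>}.
    closed (cantor_set PI \<gamma> e) \<and> cantor_set PI \<gamma> e \<subseteq> Par \<and>
    measure lebesgue (Par - cantor_set PI \<gamma> e) < \<delta>"
proof -
  have a: "0 < a" and pos: "0 < c1" "0 < estar"
    using H2 by (auto simp: H2_def)
  have q: "0 < q 2" "q 5 \<le> q 3"
    using H1 by (auto simp: H1_def)
  have n2: "1 \<le> real CARD('n2)"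
    by (simp add: Suc_leI)
  have iota: "real a * real CARD('n2) - 1 < iota" "2 * (real a + 1) * (iota + 2) + real a * iota < l"
    using H3 by (auto simp: H3_def)
  have "1 * 1 \<le> real a * real CARD('n2)"
    using a n2 by (intro mult_mono) auto
  then have iota0: "0 < iota"
    using iota(1) by linarith
  have al: "real a \<le> l"
  proof -
    define X where "X = (real a + 1) * (iota + 2)"
    have "(real a + 1) * 1 \<le> X"
      unfolding X_def using iota0 by (intro mult_left_mono) auto
    moreover have "0 \<le> real a * iota"
      using iota0 by simp
    moreover have "2 * X + real a * iota < l"
      using iota(2) by (simp only: X_def mult.assoc)
    moreover have "0 \<le> real a"
      by simp
    ultimately show ?thesis
      by argo
  qed
  obtain c where "\<forall>\<gamma>\<in>{0<..<\<gamma>0}. \<forall>e\<in>{0<..e0 \<gamma>}.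
      cantor_data q a l iota r J N Om Par (\<lambda>\<xi>. A \<xi> e) (\<lambda>\<xi>. lam \<xi> e) (\<lambda>\<xi>. om \<xi> e)
          (\<lambda>I \<phi> \<xi>. gI I \<phi> \<xi> e) (\<lambda>I \<phi> \<xi>. gphi I \<phi> \<xi> e)
          c \<gamma> e (PI \<gamma> e) (OM \<gamma> e) (LAM \<gamma> e)"
    using cantor unfolding cantor_family_def by blast
  then have c: "cantor_data q a l iota r J N Om Par (\<lambda>\<xi>. A \<xi> e) (\<lambda>\<xi>. lam \<xi> e) (\<lambda>\<xi>. om \<xi> e)
          (\<lambda>I \<phi> \<xi>. gI I \<phi> \<xi> e) (\<lambda>I \<phi> \<xi>. gphi I \<phi> \<xi> e)
          c \<gamma> e (PI \<gamma> e) (OM \<gamma> e) (LAM \<gamma> e)"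
    if "0 < \<gamma>" "\<gamma> < \<gamma>0" "0 < e" "e \<le> e0 \<gamma>" for \<gamma> e
    using that by simp
  have \<gamma>0: "0 < \<gamma>0" and e0: "\<And>\<gamma>. 0 < \<gamma> \<Longrightarrow> \<gamma> < \<gamma>0 \<Longrightarrow> 0 < e0 \<gamma>"
    and e0o: "e0 \<in> o[at_right 0](\<lambda>\<gamma>. \<gamma> powr ((real a + 1) / q 2))"
    using cantor unfolding cantor_family_def by auto
  have c0: "0 \<le> c"
    using cantor_data_perturbation(1)[OF c[of "\<gamma>0 / 2" "e0 (\<gamma>0 / 2)"]] \<gamma>0 e0[of "\<gamma>0 / 2"] by simp
  obtain C where C: "compact C" "C \<subseteq> Par" "Par - C \<in> lmeasurable" "measure lebesgue (Par - C) < \<delta> / 4"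
    using compact_inner_approximation[OF Par(3,2), of "\<delta> / 4"] \<delta> by auto
  note Ckt = Ck_on_om_tilde[OF Par(3) lim]
  have nondeg: "\<exists>vs\<in>multi a. (vs \<noteq> [] \<or> N = UNIV) \<and>
      iter_partial vs (\<lambda>\<xi>. \<Sum>j\<in>UNIV. \<kappa> $ j * om_tilde N om om21 \<xi> $ j) \<xi> \<noteq> 0"
    if "\<xi> \<in> Par" "\<kappa> \<noteq> 0" for \<xi> \<kappa>
  proof (rule nondegenerate_of_dim[OF Par(3) that(1) Ckt that(2)])
    show "dim {iter_partial vs (om_tilde N om om21) \<xi> |vs. vs \<in> multi a \<and> (vs \<noteq> [] \<or> N = UNIV)} = CARD('n2)"
    proof (cases "N = UNIV")
      case True
      then show ?thesis
        using rank1[OF _ that(1)] by simp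
    next
      case False
      then have "- N \<noteq> {}"
        by blast
      moreover have "1 \<le> length vs \<longleftrightarrow> vs \<noteq> []" for vs :: "(real ^ 'n3) list"
        by (cases vs) auto
      ultimately show ?thesis
        using rank2[OF _ that(1)] False by simp
    qed
  qed
  obtain cc \<eta> K where core: "0 < cc" "0 < \<eta>" "0 \<le> K" "\<And>\<kappa> u z \<tau> h. norm \<kappa> = 1 \<Longrightarrow> (N = UNIV \<longrightarrow> z = 0) \<Longrightarrow>
      Ck_on a u Par \<Longrightarrow>
      Ck_bound a Par (\<lambda>x. u x - (\<Sum>j\<in>UNIV. \<kappa> $ j * om_tilde N om om21 x $ j) - z) \<eta> \<Longrightarrow>
      0 < \<tau> \<Longrightarrow> \<tau> \<le> 1 \<Longrightarrow> h \<le> cc * \<tau> ^ a \<Longrightarrow> measure lborel {x\<in>C. \<bar>u x\<bar> < h} \<le> K * \<tau>"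
    using uniform_sublevel[where P = "N = UNIV", OF Par(3) C(1,2) Ckt nondeg] by blast
  \<comment> \<open>Decay exponent in |k| of the measure of one zone; the lower bound on
    \<open>iota\<close> in (H3) says that it exceeds the dimension \<open>CARD('n2)\<close>.\<close>
  define s where "s = (iota + 1) / real a"
  have "real CARD('n2) < s"
    using iota(1) a by (simp add: s_def field_simps)
  from lattice_sum_bounded[OF this]
  obtain \<Sigma> where "0 \<le> \<Sigma>"
    and \<Sigma>_bound: "\<forall>F. finite F \<and> (0 :: int ^ 'n2) \<notin> F \<longrightarrow> (\<Sum>k\<in>F. norm2 k powr (- s)) \<le> \<Sigma>"
    by blast
  have \<Sigma>: "(\<Sum>k\<in>F. norm2 k powr (- s)) \<le> \<Sigma>" if "finite F" "(0 :: int ^ 'n2) \<notin> F" for F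
    using \<Sigma>_bound that by simp
  \<comment> \<open>Below this size of \<open>k\<close> the eigenvalue part may compete with the
    frequency part in \<open>divisor_deviation\<close>.\<close>
  define R where "R = 4 * (c1 + c) / \<eta>"
  define A0 where "A0 = (admissible_m :: (int ^ 'n1) set)"
  define U where "U = {k :: int ^ 'n2. norm2 k \<le> R}"
  have fin: "finite A0" "finite U"
    unfolding A0_def U_def admissible_m_def
    by (rule finite_subset[OF _ finite_norm1_le[of 2]], auto) (rule finite_norm2_le)
  define P where "P = real (card U) * real (card A0)"
  \<comment> \<open>Divides \<delta>/4 into one share for each pair in \<open>U \<times> A0\<close>;
    the summand 1 keeps the denominator positive.\<close>
  define \<delta>' where "\<delta>' = \<delta> / (4 * (P + 1))"
  have "0 \<le> P"
    by (simp add: P_def)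
  then have \<delta>': "0 < \<delta>'" "P * \<delta>' \<le> \<delta> / 4"
    using \<delta> by (auto simp: \<delta>'_def field_simps)
  \<comment> \<open>Every admissible pair with \<open>k \<noteq> 0\<close> that satisfies none of
    the three alternatives of \<open>divisor_deviation\<close> belongs to this finite set.\<close>
  define Bd where "Bd = {(k, m). k \<in> U \<and> k \<noteq> 0 \<and> m \<in> A0 \<and> q 3 = q 5 \<and> (\<exists>i\<in>- J. m $ i \<noteq> 0)}"
  have finB: "finite Bd"
    by (rule finite_subset[of _ "U \<times> A0"]) (use fin in \<open>auto simp: Bd_def\<close>)
  define bad where "bad = (\<lambda>(k, m) \<gamma>1 e. \<exists>T\<in>lmeasurable. measure lebesgue T \<le> \<delta>' \<and>
    (\<forall>w v. perturbation q a J N Par c e w v \<longrightarrow>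
      {\<xi>\<in>C. cmod (pairing k m (scale_freq q N e (om \<xi> e + w \<xi>)) (scale_eig q J e (lam \<xi> e + v \<xi>)))
        < \<gamma>1 * e powr q 5} \<subseteq> T))"
  have "\<forall>p\<in>Bd. \<exists>\<gamma>1>0. \<forall>\<^sub>F e in at_right 0. bad p \<gamma>1 e"
  proof
    fix p assume p: "p \<in> Bd"
    obtain k m where km: "p = (k, m)"
      by force
    show "\<exists>\<gamma>1>0. \<forall>\<^sub>F e in at_right 0. bad p \<gamma>1 e"
      unfolding bad_def km prod.case
      by (rule finite_resonance_small[OF Par(3,1) H1 H2 lim C(1,2) c0 \<delta>'(1) _ _ _ _ null])
        (use p in \<open>auto simp: Bd_def km A0_def\<close>)
  qed
  then obtain g1 where g1: "\<And>p. p \<in> Bd \<Longrightarrow> 0 < (g1 p :: real)"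
    "\<And>p. p \<in> Bd \<Longrightarrow> \<forall>\<^sub>F e in at_right 0. bad p (g1 p) e"
    by metis
  \<comment> \<open>The element 1 covers the case without exceptional pairs.\<close>
  define \<gamma>1 where "\<gamma>1 = Min (insert 1 (g1 ` Bd))"
  have \<gamma>1: "0 < \<gamma>1" "\<And>p. p \<in> Bd \<Longrightarrow> \<gamma>1 \<le> g1 p"
    using finB g1(1) by (auto simp: \<gamma>1_def)
  define good where "good = (\<lambda>e. \<forall>w v k m. perturbation q a J N Par c e w v \<longrightarrow> k \<noteq> 0 \<longrightarrow>
    norm1 m \<le> 2 \<longrightarrow> R \<le> norm2 k \<or> q 5 < q 3 \<or> (\<forall>i\<in>- J. m $ i = 0) \<longrightarrow>
    (\<exists>z. (N = UNIV \<longrightarrow> z = 0) \<and>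
      Ck_bound a Par (\<lambda>\<xi>. Im (pairing k m (scale_freq q N e (om \<xi> e + w \<xi>)) (scale_eig q J e (lam \<xi> e + v \<xi>)))
          / (e powr q 5 * norm2 k)
        - (\<Sum>j\<in>UNIV. (\<chi> j. of_int (k $ j) / norm2 k) $ j * om_tilde N om om21 \<xi> $ j) - z) \<eta>))"
  have "\<forall>\<^sub>F e in at_right 0. good e"
    unfolding good_def R_def by (rule divisor_deviation[OF Par(3) H1 H2 lim c0 core(2)])
  moreover have "\<forall>\<^sub>F e in at_right 0. \<forall>p\<in>Bd. bad p (g1 p) e"
    using finB g1(2) by (intro eventually_ball_finite) auto
  ultimately have "\<forall>\<^sub>F e in at_right 0. good e \<and> (\<forall>p\<in>Bd. bad p (g1 p) e)"
    by (rule eventually_conj)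
  then obtain e2 where e2: "0 < e2" "\<And>e. 0 < e \<Longrightarrow> e < e2 \<Longrightarrow> good e \<and> (\<forall>p\<in>Bd. bad p (g1 p) e)"
    unfolding eventually_at_right_field by blast
  define \<theta> where "\<theta> = (\<lambda>\<gamma>. (\<gamma> / cc) powr (1 / real a))"
  define M where "M = real (card A0) * K * \<Sigma>"
  have "\<forall>\<^sub>F \<gamma> in at_right 0. norm (e0 \<gamma>) \<le> e2 / 2 * norm (\<gamma> powr ((real a + 1) / q 2))"
    using e0o e2(1) by (intro landau_o.smallD) auto
  moreover have "\<forall>\<^sub>F \<gamma> in at_right 0. M * (1 / cc) powr (1 / real a) * \<gamma> powr (1 / real a) \<le> \<delta> / 8"
    using a \<delta> by (intro eventually_powr_small) auto
  moreover have "\<forall>\<^sub>F \<gamma> in at_right 0. c * \<gamma> powr 1 \<le> \<delta> / 8"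
    using \<delta> by (intro eventually_powr_small) auto
  moreover have "\<forall>\<^sub>F \<gamma> in at_right 0. 0 < \<gamma> \<and> \<gamma> \<le> 1 \<and> \<gamma> \<le> min (\<gamma>0 / 2) (min cc \<gamma>1)"
    using \<gamma>0 core(1) \<gamma>1(1) by (intro eventually_in_unit) auto
  ultimately show ?thesis
  proof eventually_elim
    case (elim \<gamma>)
    then have \<gamma>: "0 < \<gamma>" "\<gamma> \<le> 1" "\<gamma> < \<gamma>0" "\<gamma> \<le> cc" "\<gamma> \<le> \<gamma>1"
      using \<gamma>0 by auto
    \<comment> \<open>The asymptotic condition on \<open>e0\<close> puts every
      \<open>e \<le> e0 \<gamma>\<close> below \<open>e2\<close>, a threshold fixed before
      \<gamma>.\<close>
    have "\<gamma> powr ((real a + 1) / q 2) \<le> 1"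
      using \<gamma> q by (intro powr_le1) auto
    then have "e2 / 2 * \<gamma> powr ((real a + 1) / q 2) \<le> e2 / 2 * 1"
      using e2(1) by (intro mult_left_mono) auto
    moreover have "e0 \<gamma> \<le> e2 / 2 * \<gamma> powr ((real a + 1) / q 2)"
      using elim(1) by (simp add: abs_le_iff)
    ultimately have e0e2: "e0 \<gamma> < e2"
      using e2(1) by linarith
    have small: "M * \<theta> \<gamma> \<le> \<delta> / 8"
    proof -
      have "\<theta> \<gamma> = (1 / cc) powr (1 / real a) * \<gamma> powr (1 / real a)"
        using \<gamma> core(1) unfolding \<theta>_def by (subst powr_mult[symmetric]) auto
      then show ?thesis
        using elim(2) by (simp add: mult.assoc)
    qed
    show ?case
    proof
      fix e assume "e \<in> {0<..e0 \<gamma>}"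
      then have e: "0 < e" "e \<le> e0 \<gamma>"
        by auto
      note cd = c[OF \<gamma>(1,3) e]
      define X where "X = PI \<gamma> e"
      define Z where "Z = (\<lambda>\<nu>. resonance_zone q J N iota \<gamma> e (X \<nu>) (OM \<gamma> e \<nu>) (LAM \<gamma> e \<nu>))"
      have X: "closed (X \<nu>)" "X \<nu> \<subseteq> Par" "measure lebesgue (Par - X 0) \<le> c * \<gamma>"
        "X (Suc \<nu>) = X \<nu> - (\<Union>m\<in>A0. \<Union>k\<in>{k. Kcut CARD('n2) a l r \<nu> < norm2 k \<and>
          norm2 k \<le> Kcut CARD('n2) a l r (Suc \<nu>)}. Z \<nu> k m)" for \<nu>
        using cd unfolding cantor_data_def X_def Z_def A0_def by auto
      have ge: "good e" "\<And>p. p \<in> Bd \<Longrightarrow> bad p (g1 p) e"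
        using e2(2)[of e] e e0e2 by auto
      \<comment> \<open>One bound for both kinds of pairs: every \<open>k\<close> carries the
        sublevel bound, and every \<open>k\<close> in \<open>U\<close> is charged
        \<open>\<delta>'\<close> in addition, exceptional or not.\<close>
      define b where "b = (\<lambda>(k :: int ^ 'n2) (m :: int ^ 'n1).
        K * (\<theta> \<gamma> * norm2 k powr (- s)) + (if k \<in> U then \<delta>' else 0))"
      have K0: "0 \<le> K * (\<theta> \<gamma> * norm2 k powr (- s))" for k :: "int ^ 'n2"
        using core(3) by (simp add: \<theta>_def)
      have cover: "\<exists>T\<in>lmeasurable. C \<inter> Z \<nu> k m \<subseteq> T \<and> measure lebesgue T \<le> b k m"
        if k: "k \<noteq> 0" and m: "m \<in> A0" for \<nu> k m
      proof -
        obtain w v where wv: "perturbation q a J N Par c e w v"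
          "\<And>\<xi>. \<xi> \<in> X \<nu> \<Longrightarrow> OM \<gamma> e \<nu> \<xi> = om \<xi> e + w \<xi> \<and> LAM \<gamma> e \<nu> \<xi> = lam \<xi> e + v \<xi>"
          using cantor_data_perturbation(2)[OF cd \<gamma>(1), of \<nu>] unfolding X_def by blast
        define Q where "Q = (\<lambda>\<xi>. pairing k m (scale_freq q N e (om \<xi> e + w \<xi>)) (scale_eig q J e (lam \<xi> e + v \<xi>)))"
        have Zsub: "cmod (Q \<xi>) < \<gamma> * e powr q 5 * norm2 k powr (- iota)" if "\<xi> \<in> Z \<nu> k m" for \<xi>
          using that wv(2)[of \<xi>] unfolding Z_def resonance_zone_def Q_def by auto
        have E: "0 < e powr q 5"
          using e by simp
        have k1: "1 \<le> norm2 k"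
          using norm2_ge_1[OF k] .
        show ?thesis
        proof (cases "(k, m) \<in> Bd")
          case True
          then obtain T where T: "T \<in> lmeasurable" "measure lebesgue T \<le> \<delta>'"
            "{\<xi>\<in>C. cmod (Q \<xi>) < g1 (k, m) * e powr q 5} \<subseteq> T"
            using ge(2)[OF True] wv(1) unfolding bad_def prod.case Q_def by blast
          \<comment> \<open>Since |k|^(-iota) \<le> 1 and \<open>\<gamma> \<le> \<gamma>1\<close>,
            the zone lies in the set cut out by the threshold \<open>g1 (k, m)\<close>.\<close>
          have "C \<inter> Z \<nu> k m \<subseteq> T"
          proof
            fix \<xi> assume x: "\<xi> \<in> C \<inter> Z \<nu> k m"
            have "norm2 k powr (- iota) \<le> norm2 k powr 0"
              using k1 iota0 by (intro powr_mono) auto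
            then have "\<gamma> * e powr q 5 * norm2 k powr (- iota) \<le> \<gamma> * e powr q 5 * 1"
              using k1 \<gamma>(1) E by (intro mult_left_mono) auto
            also have "\<dots> \<le> g1 (k, m) * e powr q 5"
              using \<gamma>(5) \<gamma>1(2)[OF True] E by (simp add: mult_right_mono)
            finally have "cmod (Q \<xi>) < g1 (k, m) * e powr q 5"
              using Zsub[of \<xi>] x by auto
            then show "\<xi> \<in> T"
              using T(3) x by blast
          qed
          moreover have "k \<in> U"
            using True by (auto simp: Bd_def)
          then have "measure lebesgue T \<le> b k m"
            using T(2) K0[of k] by (simp add: b_def)
          ultimately show ?thesis
            using T(1) by blast
        next
          case False
          have "norm1 m \<le> 2"
            using m by (auto simp: A0_def admissible_m_def)
          moreover have "R \<le> norm2 k \<or> q 5 < q 3 \<or> (\<forall>i\<in>- J. m $ i = 0)"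
            using False k m q(2) unfolding Bd_def U_def by force
          ultimately obtain z where z: "N = UNIV \<longrightarrow> z = 0"
            "Ck_bound a Par (\<lambda>\<xi>. Im (Q \<xi>) / (e powr q 5 * norm2 k)
              - (\<Sum>j\<in>UNIV. (\<chi> j. of_int (k $ j) / norm2 k) $ j * om_tilde N om om21 \<xi> $ j) - z) \<eta>"
            using ge(1) wv(1) k unfolding good_def Q_def by blast
          define T where "T = {\<xi>\<in>C. \<bar>Im (Q \<xi>) / (e powr q 5 * norm2 k)\<bar> < \<gamma> * norm2 k powr (- iota) / norm2 k}"
          note gc = sublevel_of_deviation_small[OF Par(3) C(1,2) Ckt a core(4) k z(1) \<gamma>(1,4) iota0 z(2)]
          have "C \<inter> Z \<nu> k m \<subseteq> T"
          proof
            fix \<xi> assume x: "\<xi> \<in> C \<inter> Z \<nu> k m"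
            have "\<bar>Im (Q \<xi>)\<bar> < \<gamma> * e powr q 5 * norm2 k powr (- iota)"
              using Zsub[of \<xi>] x abs_Im_le_cmod[of "Q \<xi>"] by auto
            then have "\<bar>Im (Q \<xi>)\<bar> / (e powr q 5 * norm2 k)
                < \<gamma> * e powr q 5 * norm2 k powr (- iota) / (e powr q 5 * norm2 k)"
              using E k1 by (intro divide_strict_right_mono) auto
            then show "\<xi> \<in> T"
              using x E k1 by (simp add: T_def abs_divide abs_mult)
          qed
          moreover have "T \<in> lmeasurable"
            unfolding T_def by (rule gc(1))
          moreover have "measure lebesgue T \<le> b k m"
          proof -
            have "measure lebesgue T \<le> K * (\<theta> \<gamma> * norm2 k powr (- s))"
              unfolding T_def \<theta>_def s_def by (rule gc(2))
            then show ?thesis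
              using \<delta>'(1) by (simp add: b_def)
          qed
          ultimately show ?thesis
            by blast
        qed
      qed
      have total: "(\<Sum>k\<in>F. \<Sum>m\<in>A0. b k m) \<le> M * \<theta> \<gamma> + \<delta> / 4" if F: "finite F" "0 \<notin> F" for F
      proof -
        have "(\<Sum>k\<in>F. \<Sum>m\<in>A0. b k m) = real (card A0) * (\<Sum>k\<in>F. K * (\<theta> \<gamma> * norm2 k powr (- s)))
            + real (card A0) * (\<Sum>k\<in>F. if k \<in> U then \<delta>' else 0)"
          by (simp add: b_def sum_distrib_left sum.distrib distrib_left)
        also have "(\<Sum>k\<in>F. K * (\<theta> \<gamma> * norm2 k powr (- s))) = K * \<theta> \<gamma> * (\<Sum>k\<in>F. norm2 k powr (- s))"
          by (simp add: sum_distrib_left mult.assoc)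
        also have "real (card A0) * (K * \<theta> \<gamma> * (\<Sum>k\<in>F. norm2 k powr (- s))) \<le> real (card A0) * (K * \<theta> \<gamma> * \<Sigma>)"
          using \<Sigma>[OF F] core(3) by (intro mult_left_mono) (auto simp: \<theta>_def)
        also have "(\<Sum>k\<in>F. if k \<in> U then \<delta>' else 0) = real (card (F \<inter> U)) * \<delta>'"
          using F by (simp add: sum.If_cases)
        also have "\<dots> \<le> real (card U) * \<delta>'"
          using fin(2) \<delta>'(1) by (intro mult_right_mono) (auto intro: card_mono)
        finally have "(\<Sum>k\<in>F. \<Sum>m\<in>A0. b k m) \<le>
            real (card A0) * (K * \<theta> \<gamma> * \<Sigma>) + real (card A0) * (real (card U) * \<delta>')"
          by (simp add: mult_left_mono)
        also have "\<dots> = M * \<theta> \<gamma> + P * \<delta>'"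
          by (simp add: M_def P_def)
        finally show ?thesis
          using \<delta>'(2) by linarith
      qed
      have D: "measure lebesgue (C \<inter> X 0 - (\<Inter>\<nu>. X \<nu>)) \<le> M * \<theta> \<gamma> + \<delta> / 4"
        by (rule shell_union_bound[OF C(1) X(1,4) Kcut_zero Kcut_mono[OF assms(1) al] fin(1) cover total])
          (simp_all add: Suc_leI)
      have cs: "cantor_set PI \<gamma> e = (\<Inter>\<nu>. X \<nu>)"
        by (simp add: cantor_set_def X_def)
      have closed: "closed (\<Inter>\<nu>. X \<nu>)"
        using X(1) by auto
      have PL: "Par \<in> lmeasurable"
        using Par by (simp add: lmeasurable_open)
      have L: "Par - X 0 \<in> lmeasurable" "C \<inter> X 0 - (\<Inter>\<nu>. X \<nu>) \<in> lmeasurable"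
        by (intro fmeasurable_Diff PL, use X(1) in simp)
          (intro fmeasurable_Diff lmeasurable_compact compact_Int_closed C(1) X(1), use closed in simp)
      have "Par - (\<Inter>\<nu>. X \<nu>) \<subseteq> ((Par - C) \<union> (Par - X 0)) \<union> (C \<inter> X 0 - (\<Inter>\<nu>. X \<nu>))"
        by auto
      then have "measure lebesgue (Par - (\<Inter>\<nu>. X \<nu>))
          \<le> measure lebesgue (((Par - C) \<union> (Par - X 0)) \<union> (C \<inter> X 0 - (\<Inter>\<nu>. X \<nu>)))"
        using C(3) L PL closed by (intro measure_mono_fmeasurable) auto
      also have "\<dots> \<le> measure lebesgue ((Par - C) \<union> (Par - X 0)) + measure lebesgue (C \<inter> X 0 - (\<Inter>\<nu>. X \<nu>))"
        using C(3) L by (intro measure_Un_le) auto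
      also have "measure lebesgue ((Par - C) \<union> (Par - X 0)) \<le> measure lebesgue (Par - C) + measure lebesgue (Par - X 0)"
        using C(3) L by (intro measure_Un_le) auto
      finally have "measure lebesgue (Par - (\<Inter>\<nu>. X \<nu>)) < \<delta>"
        using C(4) X(3) D small elim(3) \<gamma>(1) \<delta> by simp
      then show "closed (cantor_set PI \<gamma> e) \<and> cantor_set PI \<gamma> e \<subseteq> Par \<and>
          measure lebesgue (Par - cantor_set PI \<gamma> e) < \<delta>"
        unfolding cs using closed X(2) by blast
    qed
  qed
qed

theorem theorem2:
  fixes q :: "nat \<Rightarrow> real" and a :: nat and l iota r c0 c1 estar \<gamma>0 :: real
    and J :: "'n1::finite set" and N :: "'n2::finite set"
    and Om1 Om2 Om :: "(real ^ 'n1) set" and Par :: "(real ^ 'n3) set"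
    and A :: "real ^ 'n3 \<Rightarrow> real \<Rightarrow> real ^ 'n1 ^ 'n1"
    and B :: "real ^ 'n3 \<Rightarrow> real \<Rightarrow> complex ^ 'n1 ^ 'n1"
    and lam :: "real ^ 'n3 \<Rightarrow> real \<Rightarrow> complex ^ 'n1"
    and om :: "real ^ 'n3 \<Rightarrow> real \<Rightarrow> real ^ 'n2"
    and gI :: "real ^ 'n1 \<Rightarrow> real ^ 'n2 \<Rightarrow> real ^ 'n3 \<Rightarrow> real \<Rightarrow> real ^ 'n1"
    and gphi :: "real ^ 'n1 \<Rightarrow> real ^ 'n2 \<Rightarrow> real ^ 'n3 \<Rightarrow> real \<Rightarrow> real ^ 'n2"
    and om20 :: "real ^ 'n2" and om21 :: "real ^ 'n3 \<Rightarrow> real ^ 'n2"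
    and e0 :: "real \<Rightarrow> real"
    and PI :: "real \<Rightarrow> real \<Rightarrow> nat \<Rightarrow> (real ^ 'n3) set"
    and OM :: "real \<Rightarrow> real \<Rightarrow> nat \<Rightarrow> real ^ 'n3 \<Rightarrow> real ^ 'n2"
    and LAM :: "real \<Rightarrow> real \<Rightarrow> nat \<Rightarrow> real ^ 'n3 \<Rightarrow> complex ^ 'n1"
  assumes "openin (top_of_set (coord_subspace J)) Om1" "convex Om1" "0 \<in> Om1"
    and "openin (top_of_set (coord_subspace (- J))) Om2" "convex Om2" "0 \<in> Om2"
    and "Om = {x + y | x y. x \<in> Om1 \<and> y \<in> Om2}"
    and "0 < r"
    and "convex Par" "bounded Par" "open Par" "0 < measure lebesgue Par"
    and "H1 q"
    and "H2 q a J N Par estar c0 c1 A B lam om"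
    and "H3 a l iota Om Par estar gI gphi"
    and "limiting_data q a J N Par lam om om20 om21"
    and "cantor_family q a l iota r J N Om Par estar A lam om gI gphi \<gamma>0 e0 PI OM LAM"
    and "(\<Sum>i=1..a. CARD('n3) ^ i) \<ge> CARD('n2)"
    and "\<And>\<xi>. - N = {} \<Longrightarrow> \<xi> \<in> Par \<Longrightarrow>
           dim {iter_partial vs (om_tilde N om om21) \<xi> | vs. vs \<in> multi a} = CARD('n2)"
    and "\<And>\<xi>. - N \<noteq> {} \<Longrightarrow> \<xi> \<in> Par \<Longrightarrow>
           dim {iter_partial vs (om_tilde N om om21) \<xi> | vs. vs \<in> multi a \<and> 1 \<le> length vs} = CARD('n2)"
    and "\<And>(k :: int ^ 'n2) (m :: int ^ 'n1) e.
           k \<noteq> 0 \<Longrightarrow> (\<forall>i\<in>J. m $ i = 0) \<Longrightarrow> 1 \<le> norm1 m \<Longrightarrow> norm1 m \<le> 2 \<Longrightarrow>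
           (\<Sum>i\<in>UNIV. m $ i) = 0 \<or> (\<Sum>i\<in>UNIV. m $ i) = - 1 \<Longrightarrow>
           e \<in> {0<..estar} \<Longrightarrow>
           {\<xi>\<in>Par. pairing k m (om_tilde0 N om20 + (e powr q 5) *\<^sub>R om_tilde N om om21 \<xi>)
                               ((e powr q 3) *\<^sub>R lam \<xi> 0) = 0} \<in> null_sets lebesgue"
  shows "(\<forall>\<^sub>F \<gamma> in at_right 0. \<forall>e\<in>{0<..e0 \<gamma>}.
            cantor_set PI \<gamma> e \<in> sets lebesgue \<and> 0 < measure lebesgue (cantor_set PI \<gamma> e)) \<and>
         (\<forall>\<delta>>0. \<forall>\<^sub>F \<gamma> in at_right 0. \<forall>e\<in>{0<..e0 \<gamma>}.
            measure lebesgue (Par - cantor_set PI \<gamma> e) < \<delta>)"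
proof -
  have small: "\<forall>\<^sub>F \<gamma> in at_right 0. \<forall>e\<in>{0<..e0 \<gamma>}.
      closed (cantor_set PI \<gamma> e) \<and> cantor_set PI \<gamma> e \<subseteq> Par \<and>
      measure lebesgue (Par - cantor_set PI \<gamma> e) < \<delta>" if "0 < \<delta>" for \<delta>
    by (rule measure_complement_cantor_set_small[OF assms(8-11,13-17) _ _ _ that]) (fact assms)+
  \<comment> \<open>Positivity comes from the smallness of the complement with \<delta> equal to the
    measure of \<open>Par\<close>: less than all of \<open>Par\<close> is removed.\<close>
  have pos: "cantor_set PI \<gamma> e \<in> sets lebesgue \<and> 0 < measure lebesgue (cantor_set PI \<gamma> e)"
    if "closed (cantor_set PI \<gamma> e)" "cantor_set PI \<gamma> e \<subseteq> Par"
      "measure lebesgue (Par - cantor_set PI \<gamma> e) < measure lebesgue Par" for \<gamma> e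
  proof -
    have "Par \<in> lmeasurable"
      using assms(10,11) by (rule lmeasurable_open)
    then have "measure lebesgue (Par - cantor_set PI \<gamma> e) = measure lebesgue Par - measure lebesgue (cantor_set PI \<gamma> e)"
      using that(1,2) by (intro measurable_measure_Diff) auto
    then show ?thesis
      using that by simp
  qed
  show ?thesis
  proof (intro conjI allI impI)
    show "\<forall>\<^sub>F \<gamma> in at_right 0. \<forall>e\<in>{0<..e0 \<gamma>}.
        cantor_set PI \<gamma> e \<in> sets lebesgue \<and> 0 < measure lebesgue (cantor_set PI \<gamma> e)"
      using small[OF assms(12)] by eventually_elim (use pos in blast)
    fix \<delta> :: real assume "0 < \<delta>"
    from small[OF this] show "\<forall>\<^sub>F \<gamma> in at_right 0. \<forall>e\<in>{0<..e0 \<gamma>}.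
        measure lebesgue (Par - cantor_set PI \<gamma> e) < \<delta>"
      by eventually_elim blast
  qed
qed

end
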